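(* Fix $\delta\in(0,1/4)$. There exists $C_\delta>0$ such that for every $\delta$-admissible $\tau\ge2$, every $\xi\in\mathbb R$, and $z=\tau+i\xi$, one has \[ \|R(z)\|_{\mathcal H\to\mathcal H}\le C_\delta\tau^{-1}, \] \[ \|CR(z)\|_{\mathcal H\to\mathbb C^2}+\|R(z)C^*\|_{\mathbb C^2\to\mathcal H}\le C_\delta\tau^{-3/4}, \] \[ \|K(z)\|_{\mathbb C^2\to\mathbb C^2}\le C_\delta\tau^{-1/2}, \] \[ \|zR(z)\|_{\mathcal H\to\mathcal H}+\|L_0^{1/2}R(z)\|_{\mathcal H\to\mathcal H}\le C_\delta, \] \[ \|zR(z)C^*\|_{\mathbb C^2\to\mathcal H}+\|L_0^{1/2}R(z)C^*\|_{\mathbb C^2\to\mathcal H}\le C_\delta\tau^{1/4}. \]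
   Context: Let $\omega(\varphi)=(\sin\varphi)^{1/2}$, $\mathcal H=L^2((0,\pi),\omega\,d\varphi)$, $\mathfrak a_0[f,g]=4\int_0^\pi\omega f'\,\overline{g'}\,d\varphi$ with form domain $\mathcal V=\{f\in\mathcal H:f\in H^1_{\mathrm{loc}}(0,\pi),\int_0^\pi\omega|f'|^2d\varphi<\infty\}$, $\|f\|_{\mathcal V}^2=\mathfrak a_0[f,f]+\|f\|_{\mathcal H}^2$, $\mathcal V^*$ the (anti)dual with pivot $\mathcal H$; $A_0$ is the self-adjoint operator of $\mathfrak a_0$. Its orthonormal eigenbasis is $\Phi_n(\varphi)=\mathfrak h_n^{-1/2}C_n^{1/4}(\cos\varphi)$, $n\ge0$ ($C_n^{1/4}$ Gegenbauer polynomials, $\mathfrak h_n=\frac{\pi\sqrt2\,\Gamma(n+1/2)}{\Gamma(n+1)(n+1/4)\Gamma(1/4)^2}$), with $A_0\Phi_n=2n(2n+1)\Phi_n$. Put $L_0=A_0+\frac14I$ and $\kappa_n=2n+\frac12$, so $L_0\Phi_n=\kappa_n^2\Phi_n$. The trace operator $C:\mathcal V\to\mathbb C^2$, $Cf=(f(0),f(\pi))^{\mathsf T}$, is bounded, with dual $C^*:\mathbb C^2\to\mathcal V^*$; $v_n=C\Phi_n=\Phi_n(0)\,(1,(-1)^n)^{\mathsf T}$. For $z\notin\{\pm\kappa_n\}$ the extrapolated resolvent $R(z):\mathcal V^*\to\mathcal V$ is $R(z)F=\sum_{n\ge0}\frac{\langle F,\Phi_n\rangle_{\mathcal V^*,\mathcal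 V}}{z^2-\kappa_n^2}\Phi_n$; on $\mathcal H$ it equals $(z^2-L_0)^{-1}$. The boundary matrix is $K(z)=CR(z)C^*$, i.e. $K(z)g=\sum_{n\ge0}\frac{v_nv_n^*g}{z^2-\kappa_n^2}$ for $g\in\mathbb C^2$ (absolutely convergent). For $0<\delta<1/4$, a number $\tau\ge2$ is $\delta$-admissible if $\operatorname{dist}\bigl(\tau,\{2n+\frac12:n\in\mathbb N_0\}\bigr)\ge\delta$. *)

theory Defs
  imports "HOL-Analysis.Analysis"
begin

text \<open>
  Elements of the weighted space \<open>L\<^sup>2((0,\<pi>), \<omega> d\<phi>)\<close> are represented by functions
  \<open>real \<Rightarrow> complex\<close>, of which only the values on \<open>(0,\<pi>)\<close>, up to a null set, matter.
\<close>

section \<open>The Hilbert space\<close>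

definition weight :: "real \<Rightarrow> real" where
  "weight \<phi> = sqrt (sin \<phi>)"

definition Mw :: "real measure" where
  "Mw = density (restrict_space lborel {0<..<pi}) (\<lambda>\<phi>. ennreal (weight \<phi>))"

definition H_space :: "(real \<Rightarrow> complex) set" where
  "H_space = {f \<in> borel_measurable Mw. integrable Mw (\<lambda>\<phi>. (cmod (f \<phi>))\<^sup>2)}"

definition H_inner :: "(real \<Rightarrow> complex) \<Rightarrow> (real \<Rightarrow> complex) \<Rightarrow> complex" where
  "H_inner f g = (LINT \<phi>|Mw. f \<phi> * cnj (g \<phi>))"

definition H_norm :: "(real \<Rightarrow> complex) \<Rightarrow> real" where
  "H_norm f = sqrt (LINT \<phi>|Mw. (cmod (f \<phi>))\<^sup>2)"

section \<open>Weak derivatives and the form domain\<close>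

definition L2_loc :: "(real \<Rightarrow> complex) set" where
  "L2_loc = {f \<in> borel_measurable (restrict_space lborel {0<..<pi}).
     \<forall>a b. 0 < a \<and> a < b \<and> b < pi \<longrightarrow> set_integrable lborel {a..b} (\<lambda>\<phi>. (cmod (f \<phi>))\<^sup>2)}"

text \<open>Real-valued test functions suffice, since the defining identity is linear in the
  test function.\<close>

definition test_functions :: "(real \<Rightarrow> real) set" where
  "test_functions = {\<psi>. (\<forall>k x. (deriv ^^ k) \<psi> differentiable (at x)) \<and>
     (\<exists>a b. 0 < a \<and> a < b \<and> b < pi \<and> (\<forall>x. x \<notin> {a..b} \<longrightarrow> \<psi> x = 0))}"

definition is_weak_deriv :: "(real \<Rightarrow> complex) \<Rightarrow> (real \<Rightarrow> complex) \<Rightarrow> bool" where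
  "is_weak_deriv f g \<longleftrightarrow> (\<forall>\<psi>\<in>test_functions.
     (LINT x:{0<..<pi}|lborel. f x * complex_of_real (deriv \<psi> x)) =
     - (LINT x:{0<..<pi}|lborel. g x * complex_of_real (\<psi> x)))"

definition H1_loc :: "(real \<Rightarrow> complex) set" where
  "H1_loc = {f \<in> L2_loc. \<exists>g\<in>L2_loc. is_weak_deriv f g}"

definition weak_deriv :: "(real \<Rightarrow> complex) \<Rightarrow> real \<Rightarrow> complex" where
  "weak_deriv f = (SOME g. g \<in> L2_loc \<and> is_weak_deriv f g)"

definition V_space :: "(real \<Rightarrow> complex) set" where
  "V_space = {f \<in> H_space. f \<in> H1_loc \<and> integrable Mw (\<lambda>\<phi>. (cmod (weak_deriv f \<phi>))\<^sup>2)}"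

definition form_a0 :: "(real \<Rightarrow> complex) \<Rightarrow> (real \<Rightarrow> complex) \<Rightarrow> complex" where
  "form_a0 f g = 4 * (LINT \<phi>|Mw. weak_deriv f \<phi> * cnj (weak_deriv g \<phi>))"

definition V_norm :: "(real \<Rightarrow> complex) \<Rightarrow> real" where
  "V_norm f = sqrt (Re (form_a0 f f) + (H_norm f)\<^sup>2)"

section \<open>The operator of the form and its square root\<close>

text \<open>
  Unbounded operators on the Hilbert space are given by their graphs, which contain a pair
  together with all its almost-everywhere modifications.
\<close>

type_synonym graph = "((real \<Rightarrow> complex) \<times> (real \<Rightarrow> complex)) set"

definition A0 :: graph where
  "A0 = {(f, h). f \<in> V_space \<and> h \<in> H_space \<and> (\<forall>g\<in>V_space. form_a0 f g = H_inner h g)}"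

definition L0 :: graph where
  "L0 = {(f, \<lambda>\<phi>. h \<phi> + (1/4) * f \<phi>) | f h. (f, h) \<in> A0}"

definition adjoint_graph :: "graph \<Rightarrow> graph" where
  "adjoint_graph S = {(g, k). g \<in> H_space \<and> k \<in> H_space \<and>
     (\<forall>(f, h)\<in>S. H_inner h g = H_inner f k)}"

definition densely_defined :: "graph \<Rightarrow> bool" where
  "densely_defined S \<longleftrightarrow>
     (\<forall>f\<in>H_space. \<forall>e>0. \<exists>g\<in>Domain S. H_norm (\<lambda>\<phi>. f \<phi> - g \<phi>) < e)"

text \<open>A graph that equals its adjoint is automatically a linear subspace of pairs from the
  Hilbert space, and density of the domain makes it single-valued almost everywhere.\<close>

definition self_adjoint :: "graph \<Rightarrow> bool" where
  "self_adjoint S \<longleftrightarrow> densely_defined S \<and> adjoint_graph S = S"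

definition nonneg_graph :: "graph \<Rightarrow> bool" where
  "nonneg_graph S \<longleftrightarrow> (\<forall>(f, h)\<in>S. 0 \<le> Re (H_inner h f))"

definition L0_half :: graph where
  "L0_half = (THE S. self_adjoint S \<and> nonneg_graph S \<and> S O S = L0)"

definition apply_graph :: "graph \<Rightarrow> (real \<Rightarrow> complex) \<Rightarrow> real \<Rightarrow> complex" where
  "apply_graph S f = (SOME h. (f, h) \<in> S)"

section \<open>Gegenbauer polynomials and the eigenbasis\<close>

fun gegenbauer :: "real \<Rightarrow> nat \<Rightarrow> real \<Rightarrow> real" where
  "gegenbauer l 0 x = 1"
| "gegenbauer l (Suc 0) x = 2 * l * x"
| "gegenbauer l (Suc (Suc n)) x =
     (2 * x * (real n + 1 + l) * gegenbauer l (Suc n) x - (real n + 2 * l) * gegenbauer l n x)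
       / (real n + 2)"

definition h_const :: "nat \<Rightarrow> real" where
  "h_const n = pi * sqrt 2 * Gamma (real n + 1/2) /
     (Gamma (real n + 1) * (real n + 1/4) * (Gamma (1/4))\<^sup>2)"

definition Phi :: "nat \<Rightarrow> real \<Rightarrow> complex" where
  "Phi n \<phi> = complex_of_real (gegenbauer (1/4) n (cos \<phi>) / sqrt (h_const n))"

definition kappa :: "nat \<Rightarrow> real" where
  "kappa n = 2 * real n + 1/2"

section \<open>Trace, extrapolated resolvent and boundary matrix\<close>

text \<open>Boundary values of an element of the form domain are those of its representative that is
  continuous on \<open>[0,\<pi>]\<close>.\<close>

definition cont_rep :: "(real \<Rightarrow> complex) \<Rightarrow> real \<Rightarrow> complex" where
  "cont_rep f = (SOME h. continuous_on {0..pi} h \<and> (AE \<phi> in Mw. h \<phi> = f \<phi>))"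

definition Ctr :: "(real \<Rightarrow> complex) \<Rightarrow> complex ^ 2" where
  "Ctr f = vector [cont_rep f 0, cont_rep f pi]"

text \<open>An element of the antidual of the form domain is an antilinear functional \<open>F\<close>, with
  \<open>F v\<close> the value of the pairing of \<open>F\<close> with \<open>v\<close>. The pivot identification sends \<open>h\<close> to
  \<open>v \<mapsto> \<langle>h, v\<rangle>\<close>, and the dual of the trace sends \<open>g\<close> to \<open>v \<mapsto> \<langle>g, C v\<rangle>\<close>.\<close>

type_synonym functional = "(real \<Rightarrow> complex) \<Rightarrow> complex"

definition pivot :: "(real \<Rightarrow> complex) \<Rightarrow> functional" where
  "pivot h = (\<lambda>v. H_inner h v)"

definition Ctr_dual :: "complex ^ 2 \<Rightarrow> functional" where
  "Ctr_dual g = (\<lambda>v. \<Sum>i\<in>UNIV. g $ i * cnj (Ctr v $ i))"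

text \<open>The series is summed in the norm of the form domain, which determines the sum
  up to almost-everywhere equality.\<close>

definition Rz :: "complex \<Rightarrow> functional \<Rightarrow> real \<Rightarrow> complex" where
  "Rz z F = (SOME f. f \<in> V_space \<and>
     (\<lambda>N. V_norm (\<lambda>\<phi>. f \<phi> - (\<Sum>n<N. F (Phi n) / (z\<^sup>2 - complex_of_real ((kappa n)\<^sup>2)) * Phi n \<phi>)))
       \<longlonglongrightarrow> 0)"

definition RzH :: "complex \<Rightarrow> (real \<Rightarrow> complex) \<Rightarrow> real \<Rightarrow> complex" where
  "RzH z h = Rz z (pivot h)"

definition RzC :: "complex \<Rightarrow> complex ^ 2 \<Rightarrow> real \<Rightarrow> complex" where
  "RzC z g = Rz z (Ctr_dual g)"

definition Kz :: "complex \<Rightarrow> complex ^ 2 \<Rightarrow> complex ^ 2" where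
  "Kz z g = Ctr (Rz z (Ctr_dual g))"

section \<open>Operator norms and admissibility\<close>

text \<open>Extended-valued, so that unbounded operators get the norm \<open>\<infinity>\<close>.\<close>

definition op_norm :: "'a set \<Rightarrow> ('a \<Rightarrow> real) \<Rightarrow> ('b \<Rightarrow> real) \<Rightarrow> ('a \<Rightarrow> 'b) \<Rightarrow> ennreal" where
  "op_norm X nX nY T = (SUP x\<in>{x\<in>X. nX x \<le> 1}. ennreal (nY (T x)))"

abbreviation norm_HH :: "((real \<Rightarrow> complex) \<Rightarrow> (real \<Rightarrow> complex)) \<Rightarrow> ennreal" where
  "norm_HH \<equiv> op_norm H_space H_norm H_norm"

abbreviation norm_HC :: "((real \<Rightarrow> complex) \<Rightarrow> complex ^ 2) \<Rightarrow> ennreal" where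
  "norm_HC \<equiv> op_norm H_space H_norm norm"

abbreviation norm_CH :: "(complex ^ 2 \<Rightarrow> (real \<Rightarrow> complex)) \<Rightarrow> ennreal" where
  "norm_CH \<equiv> op_norm UNIV norm H_norm"

abbreviation norm_CC :: "(complex ^ 2 \<Rightarrow> complex ^ 2) \<Rightarrow> ennreal" where
  "norm_CC \<equiv> op_norm UNIV norm norm"

definition admissible :: "real \<Rightarrow> real \<Rightarrow> bool" where
  "admissible \<delta> \<tau> \<longleftrightarrow> 2 \<le> \<tau> \<and> \<delta> \<le> infdist \<tau> (range kappa)"

end

theory Submission
  imports Defs
begin

text \<open>
  In the eigenbasis everything is diagonal: \<open>R(z)\<close> multiplies the \<open>n\<close>-th coefficient by
  \<open>1 / (z\<^sup>2 - \<kappa>\<^sub>n\<^sup>2)\<close>, the square root of \<open>L\<^sub>0\<close> multiplies it by \<open>\<kappa>\<^sub>n\<close>, and \<open>C\<^sup>*g\<close> has the coefficients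
  \<open>v\<^sub>n\<^sup>*g\<close>. By Parseval and Cauchy-Schwarz, all norms except that of \<open>K(z)\<close> are controlled by
  suprema and square sums of absolute values. Write \<open>z\<^sup>2 - \<kappa>\<^sub>n\<^sup>2 = (z - \<kappa>\<^sub>n)(z + \<kappa>\<^sub>n)\<close>. The second factor dominates \<open>\<bar>z\<bar>\<close>, \<open>\<tau>\<close> and \<open>\<kappa>\<^sub>n\<close>. The
  first is at least \<open>\<bar>\<tau> - \<kappa>\<^sub>n\<bar> \<ge> \<delta> (1 + \<bar>n - m\<bar>)\<close> with \<open>m = \<lfloor>\<tau>/2\<rfloor>\<close>, because \<open>\<kappa>\<^sub>n\<close> is an arithmetic progression
  with step 2. As \<open>\<bar>v\<^sub>n\<bar>\<^sup>2\<close> has size \<open>sqrt \<kappa>\<^sub>n\<close> (\<open>end_value_sq_le\<close>), the bounds follow from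
  \<open>\<Sum>\<^sub>n sqrt \<kappa>\<^sub>n / (\<tau> - \<kappa>\<^sub>n)\<^sup>2 \<le> C sqrt \<tau>\<close> (\<open>sum_sqrt_kappa\<close>).

  The bound for \<open>K(z)\<close> needs cancellation, since absolute values would cost a factor \<open>log \<tau>\<close>. Up to
  a constant, \<open>\<bar>v\<^sub>n\<bar>\<^sup>2 = \<kappa>\<^sub>n b\<^sub>n\<close> with \<open>b\<^sub>n = (1/2)\<^sub>n / n!\<close>, and \<open>2\<kappa>\<^sub>n / (z\<^sup>2 - \<kappa>\<^sub>n\<^sup>2) = 1/(z - \<kappa>\<^sub>n) - 1/(z + \<kappa>\<^sub>n)\<close>, so
  the singular part of an entry of \<open>K(z)\<close> is \<open>\<Sum>\<^sub>n (\<plusminus>1)\<^sup>n b\<^sub>n / (z - \<kappa>\<^sub>n)\<close>. The weights \<open>b\<^sub>n\<close> vary slowly: for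
  \<open>n \<le> 2m\<close> they may be replaced by \<open>b\<^sub>m\<close>, and then the terms \<open>n\<close> and \<open>2m - n\<close>, which carry the same sign
  \<open>(\<plusminus>1)\<^sup>n\<close>, nearly cancel (\<open>symmetric_sum_bound\<close>, \<open>pole_sum_bound\<close>).

  It remains to see that the objects defined by weak derivatives, adjoints and limits are these
  diagonal ones. Green's formula \<open>green_formula\<close> pairs an arbitrary weakly differentiable function
  with an eigenfunction. It makes the eigenfunctions orthogonal and computes the form on the whole
  form domain. Completeness of the eigenfunctions (\<open>Phi_complete\<close>) comes from polynomial
  approximation and the fundamental lemma of the calculus of variations. Together they describe
  \<open>L\<^sub>0\<close> by coefficients (\<open>L0_iff\<close>), and a short positivity argument shows that the only candidate
  for its root multiplies coefficients by \<open>\<kappa>\<^sub>n\<close> (\<open>L0_half_eq\<close>). The eigenfunctions attain their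
  maximal modulus at the end points (\<open>gegenbauer_le_at_1\<close>), so the series for \<open>R(z)h\<close> and \<open>R(z)C\<^sup>*g\<close>
  converge uniformly, and their traces can be taken term by term (\<open>Ctr_series\<close>).
\<close>

section \<open>The weighted measure\<close>

lemma space_Mw [simp]: "space Mw = {0<..<pi}"
  by (simp add: Mw_def space_restrict_space)

lemma sets_Mw: "sets Mw = sets (restrict_space lborel {0<..<pi})"
  by (simp add: Mw_def)

lemma borel_measurable_Mw:
  "borel_measurable Mw = (borel_measurable (restrict_space lborel {0<..<pi}) :: (real \<Rightarrow> complex) set)"
  by (rule measurable_cong_sets[OF sets_Mw refl])

lemma weight_measurable [measurable]: "weight \<in> borel_measurable borel"
  unfolding weight_def by measurable

lemma weight_pos: "0 < x \<Longrightarrow> x < pi \<Longrightarrow> 0 < weight x"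
  by (simp add: weight_def sin_gt_zero)

lemma weight_le_1: "weight x \<le> 1"
  using sin_le_one[of x] by (simp add: weight_def)

lemma measurable_restrict_borel:
  "(f :: real \<Rightarrow> 'a::{second_countable_topology,t2_space,topological_space}) \<in> borel_measurable borel \<Longrightarrow>
     f \<in> borel_measurable (restrict_space lborel {0<..<pi})"
  by (rule measurable_restrict_space1) simp

lemma AE_Mw: "(AE x in Mw. P x) \<longleftrightarrow> (AE x in lborel. 0 < x \<and> x < pi \<longrightarrow> P x)"
proof -
  have "(AE x in Mw. P x) \<longleftrightarrow> (AE x in restrict_space lborel {0<..<pi}. 0 < ennreal (weight x) \<longrightarrow> P x)"
    unfolding Mw_def
    by (rule AE_density) (rule measurable_compose[OF measurable_restrict_borel[OF weight_measurable]], simp)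
  also have "\<dots> \<longleftrightarrow> (AE x in lborel. x \<in> {0<..<pi} \<longrightarrow> 0 < ennreal (weight x) \<longrightarrow> P x)"
    by (rule AE_restrict_space_iff) simp
  also have "\<dots> \<longleftrightarrow> (AE x in lborel. 0 < x \<and> x < pi \<longrightarrow> P x)"
    by (rule AE_cong) (auto simp: weight_pos)
  finally show ?thesis .
qed

lemma integrable_Mw:
  fixes f :: "real \<Rightarrow> 'a::{banach,second_countable_topology}"
  assumes "f \<in> borel_measurable (restrict_space lborel {0<..<pi})"
  shows "integrable Mw f \<longleftrightarrow> set_integrable lborel {0<..<pi} (\<lambda>x. weight x *\<^sub>R f x)"
proof -
  have "integrable Mw f \<longleftrightarrow> integrable (restrict_space lborel {0<..<pi}) (\<lambda>x. weight x *\<^sub>R f x)"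
    unfolding Mw_def
    by (rule integrable_density[OF assms measurable_restrict_borel[OF weight_measurable]])
       (auto simp: AE_restrict_space_iff weight_pos less_imp_le)
  then show ?thesis by (simp add: integrable_restrict_space set_integrable_def)
qed

lemma integral_Mw:
  fixes f :: "real \<Rightarrow> 'a::{banach,second_countable_topology}"
  assumes "f \<in> borel_measurable (restrict_space lborel {0<..<pi})"
  shows "(LINT x|Mw. f x) = (LINT x:{0<..<pi}|lborel. weight x *\<^sub>R f x)"
proof -
  have "(LINT x|Mw. f x) = (LINT x|restrict_space lborel {0<..<pi}. weight x *\<^sub>R f x)"
    unfolding Mw_def
    by (rule integral_density[OF assms measurable_restrict_borel[OF weight_measurable]])
       (auto simp: AE_restrict_space_iff weight_pos less_imp_le)
  then show ?thesis by (simp add: integral_restrict_space set_lebesgue_integral_def)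
qed

lemma finite_measure_Mw: "finite_measure Mw"
proof
  have "emeasure Mw (space Mw) = (\<integral>\<^sup>+x\<in>{0<..<pi}. ennreal (weight x) * indicator {0<..<pi} x \<partial>lborel)"
    unfolding Mw_def
    by (subst emeasure_density)
       (auto simp: nn_integral_restrict_space space_restrict_space sets_restrict_space
         intro!: measurable_compose[OF measurable_restrict_borel[OF weight_measurable]] nn_integral_cong)
  also have "\<dots> \<le> (\<integral>\<^sup>+x. indicator {0<..<pi} x \<partial>lborel)"
    by (intro nn_integral_mono) (auto simp: indicator_def weight_le_1 ennreal_leI)
  also have "\<dots> = ennreal pi" by simp
  finally show "emeasure Mw (space Mw) \<noteq> \<infinity>" by (auto simp: top_unique)
qed

interpretation Mw: finite_measure Mw by (rule finite_measure_Mw)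

section \<open>The inner product on square integrable functions\<close>

lemma H_space_measurable [measurable_dest]: "f \<in> H_space \<Longrightarrow> f \<in> borel_measurable Mw"
  by (simp add: H_space_def)

lemma H_space_integrable: "f \<in> H_space \<Longrightarrow> integrable Mw (\<lambda>x. (cmod (f x))\<^sup>2)"
  by (simp add: H_space_def)

lemma H_space_dominated:
  assumes [measurable]: "f \<in> borel_measurable Mw" and "integrable Mw g"
    and "\<And>x. (cmod (f x))\<^sup>2 \<le> g x"
  shows "f \<in> H_space"
  unfolding H_space_def mem_Collect_eq
proof
  show "integrable Mw (\<lambda>x. (cmod (f x))\<^sup>2)"
    by (rule Bochner_Integration.integrable_bound[OF assms(2)]) (auto intro!: AE_I2 order_trans[OF assms(3)])
qed fact

lemma H_space_bounded:
  assumes "f \<in> borel_measurable Mw" and "\<And>x. 0 < x \<Longrightarrow> x < pi \<Longrightarrow> cmod (f x) \<le> B"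
  shows "f \<in> H_space"
  unfolding H_space_def mem_Collect_eq
proof
  show "integrable Mw (\<lambda>x. (cmod (f x))\<^sup>2)"
    using assms(1) by (intro Mw.integrable_const_bound[of _ "B\<^sup>2"])
       (auto simp: AE_Mw norm_power intro!: power_mono assms(2) AE_I2)
qed fact

lemma H_add: assumes "f \<in> H_space" "g \<in> H_space" shows "(\<lambda>x. f x + g x) \<in> H_space"
proof (rule H_space_dominated[where g="\<lambda>x. 2 * (cmod (f x))\<^sup>2 + 2 * (cmod (g x))\<^sup>2"])
  show "integrable Mw (\<lambda>x. 2 * (cmod (f x))\<^sup>2 + 2 * (cmod (g x))\<^sup>2)"
    using assms by (auto intro!: Bochner_Integration.integrable_add simp: H_space_integrable)
  show "(cmod (f x + g x))\<^sup>2 \<le> 2 * (cmod (f x))\<^sup>2 + 2 * (cmod (g x))\<^sup>2" for x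
  proof -
    have "(cmod (f x + g x))\<^sup>2 \<le> (cmod (f x) + cmod (g x))\<^sup>2" by (intro power_mono norm_triangle_ineq) auto
    also have "\<dots> \<le> 2 * (cmod (f x))\<^sup>2 + 2 * (cmod (g x))\<^sup>2"
      using sum_squares_bound[of "cmod (f x)" "cmod (g x)"] by (simp add: power2_sum)
    finally show ?thesis .
  qed
qed (use assms in measurable)

lemma H_scale: assumes "f \<in> H_space" shows "(\<lambda>x. c * f x) \<in> H_space"
proof (rule H_space_dominated[where g="\<lambda>x. (cmod c)\<^sup>2 * (cmod (f x))\<^sup>2"])
  show "integrable Mw (\<lambda>x. (cmod c)\<^sup>2 * (cmod (f x))\<^sup>2)"
    using assms by (auto simp: H_space_integrable)
qed (use assms in \<open>auto simp: norm_mult power_mult_distrib\<close>)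

lemma H_zero: "(\<lambda>x. 0) \<in> H_space" by (simp add: H_space_def)

lemma H_diff: "f \<in> H_space \<Longrightarrow> g \<in> H_space \<Longrightarrow> (\<lambda>x. f x - g x) \<in> H_space"
  using H_add[OF _ H_scale[of g "-1"], of f] by simp

lemma H_sum: "(\<And>i. i \<in> I \<Longrightarrow> f i \<in> H_space) \<Longrightarrow> (\<lambda>x. \<Sum>i\<in>I. f i x) \<in> H_space"
  by (induction I rule: infinite_finite_induct) (auto intro: H_add H_zero)

lemma H_cong_AE:
  assumes "f \<in> H_space" "g \<in> borel_measurable Mw" "AE x in Mw. f x = g x"
  shows "g \<in> H_space"
  unfolding H_space_def mem_Collect_eq
proof
  show "integrable Mw (\<lambda>x. (cmod (g x))\<^sup>2)"
    by (rule integrable_cong_AE_imp[OF H_space_integrable[OF assms(1)]]) (use assms in auto)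
qed fact

lemma borel_measurable_cnj [measurable (raw)]:
  "g \<in> borel_measurable M \<Longrightarrow> (\<lambda>x. cnj (g x)) \<in> borel_measurable M"
  by (rule measurable_compose[of g M borel cnj])
     (auto intro!: borel_measurable_continuous_onI continuous_intros)

lemma H_inner_integrable:
  assumes "f \<in> H_space" "g \<in> H_space" shows "integrable Mw (\<lambda>x. f x * cnj (g x))"
proof (rule Bochner_Integration.integrable_bound[where f="\<lambda>x. (cmod (f x))\<^sup>2 + (cmod (g x))\<^sup>2"])
  show "integrable Mw (\<lambda>x. (cmod (f x))\<^sup>2 + (cmod (g x))\<^sup>2)"
    using assms by (auto simp: H_space_integrable)
  have "cmod (f x) * cmod (g x) \<le> (cmod (f x))\<^sup>2 + (cmod (g x))\<^sup>2" for x
    using sum_squares_bound[of "cmod (f x)" "cmod (g x)"]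
      mult_nonneg_nonneg[OF norm_ge_zero[of "f x"] norm_ge_zero[of "g x"]] by linarith
  then show "AE x in Mw. norm (f x * cnj (g x)) \<le> norm ((cmod (f x))\<^sup>2 + (cmod (g x))\<^sup>2)"
    by (auto simp: norm_mult)
qed (use assms in measurable)

lemma H_inner_add_left:
  "f \<in> H_space \<Longrightarrow> g \<in> H_space \<Longrightarrow> h \<in> H_space \<Longrightarrow> H_inner (\<lambda>x. f x + g x) h = H_inner f h + H_inner g h"
  by (simp add: H_inner_def distrib_right H_inner_integrable)

lemma H_inner_diff_left:
  "f \<in> H_space \<Longrightarrow> g \<in> H_space \<Longrightarrow> h \<in> H_space \<Longrightarrow> H_inner (\<lambda>x. f x - g x) h = H_inner f h - H_inner g h"
  by (simp add: H_inner_def left_diff_distrib H_inner_integrable)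

lemma H_inner_scale_left: "H_inner (\<lambda>x. c * f x) h = c * H_inner f h"
  by (simp add: H_inner_def mult.assoc)

lemma H_inner_cnj: "H_inner g f = cnj (H_inner f g)"
  using Bochner_Integration.integral_cnj[of Mw "\<lambda>x. f x * cnj (g x)"] by (simp add: H_inner_def mult.commute)

lemma H_inner_zero_left [simp]: "H_inner (\<lambda>x. 0) h = 0" by (simp add: H_inner_def)

lemma H_inner_sum_left:
  "(\<And>i. i \<in> I \<Longrightarrow> f i \<in> H_space) \<Longrightarrow> h \<in> H_space \<Longrightarrow> H_inner (\<lambda>x. \<Sum>i\<in>I. f i x) h = (\<Sum>i\<in>I. H_inner (f i) h)"
proof (induction I rule: infinite_finite_induct)
  case (insert i I)
  then show ?case using H_inner_add_left[of "f i" "\<lambda>x. \<Sum>i\<in>I. f i x" h] by (auto intro: H_sum)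
qed auto

lemma H_inner_scale_right: "H_inner f (\<lambda>x. c * h x) = cnj c * H_inner f h"
  using H_inner_scale_left[of c h f] by (metis H_inner_cnj complex_cnj_mult)

lemma H_inner_diff_right:
  "f \<in> H_space \<Longrightarrow> g \<in> H_space \<Longrightarrow> h \<in> H_space \<Longrightarrow> H_inner h (\<lambda>x. f x - g x) = H_inner h f - H_inner h g"
  by (subst (1 2 3) H_inner_cnj) (simp add: H_inner_diff_left)

lemma H_inner_sum_right:
  "(\<And>i. i \<in> I \<Longrightarrow> f i \<in> H_space) \<Longrightarrow> h \<in> H_space \<Longrightarrow> H_inner h (\<lambda>x. \<Sum>i\<in>I. f i x) = (\<Sum>i\<in>I. H_inner h (f i))"
  by (subst H_inner_cnj, subst H_inner_sum_left) (auto simp: H_inner_cnj[of h])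

lemma H_inner_cong_AE:
  assumes "f \<in> H_space" "f' \<in> H_space" "g \<in> H_space" "g' \<in> H_space"
    "AE x in Mw. f x = f' x" "AE x in Mw. g x = g' x"
  shows "H_inner f g = H_inner f' g'"
  unfolding H_inner_def using assms
  by (intro integral_cong_AE borel_measurable_integrable H_inner_integrable) auto

lemma H_norm_nonneg [simp]: "0 \<le> H_norm f"
  by (simp add: H_norm_def)

lemma H_norm_sq: "(H_norm f)\<^sup>2 = (LINT x|Mw. (cmod (f x))\<^sup>2)"
  by (simp add: H_norm_def)

lemma H_inner_self: "H_inner f f = complex_of_real ((H_norm f)\<^sup>2)"
  unfolding H_norm_sq H_inner_def
  by (simp add: complex_norm_square[symmetric] flip: integral_complex_of_real of_real_power)

lemma H_norm_cong_AE:
  "f \<in> H_space \<Longrightarrow> g \<in> H_space \<Longrightarrow> AE x in Mw. f x = g x \<Longrightarrow> H_norm f = H_norm g"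
  unfolding H_norm_def by (auto intro!: arg_cong[where f=sqrt] integral_cong_AE)

lemma H_norm_eq_0: "f \<in> H_space \<Longrightarrow> H_norm f = 0 \<longleftrightarrow> (AE x in Mw. f x = 0)"
  using integral_nonneg_eq_0_iff_AE[OF H_space_integrable, of f] by (simp add: H_norm_def)

lemma H_norm_scale: "H_norm (\<lambda>x. c * f x) = cmod c * H_norm f"
  by (simp add: H_norm_def norm_mult power_mult_distrib real_sqrt_mult)

lemma H_norm_diff_sq:
  assumes "f \<in> H_space" "g \<in> H_space"
  shows "(H_norm (\<lambda>x. f x - g x))\<^sup>2 = (H_norm f)\<^sup>2 + (H_norm g)\<^sup>2 - 2 * Re (H_inner f g)"
proof -
  have "complex_of_real ((H_norm (\<lambda>x. f x - g x))\<^sup>2) =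
      H_inner f f - H_inner f g - (cnj (H_inner f g) - H_inner g g)"
    unfolding H_inner_self[symmetric]
    using assms by (simp add: H_inner_diff_left H_inner_diff_right H_diff H_inner_cnj[of g f])
  then have "Re (complex_of_real ((H_norm (\<lambda>x. f x - g x))\<^sup>2)) =
      Re (H_inner f f - H_inner f g - (cnj (H_inner f g) - H_inner g g))" by simp
  then show ?thesis by (simp add: H_inner_self del: of_real_power)
qed

lemma H_Cauchy_Schwarz:
  assumes "f \<in> H_space" "g \<in> H_space"
  shows "cmod (H_inner f g) \<le> H_norm f * H_norm g"
proof (cases "H_norm g = 0")
  case True
  then have "AE x in Mw. g x = 0" using H_norm_eq_0 assms by blast
  then have "H_inner f g = H_inner f (\<lambda>x. 0)" using assms by (intro H_inner_cong_AE) (auto simp: H_zero)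
  then show ?thesis using True by (simp add: H_inner_def)
next
  case False
  define G where "G = (H_norm g)\<^sup>2"
  have G: "G > 0" using False by (simp add: G_def)
  define c where "c = H_inner f g / G"
  have "0 \<le> (H_norm (\<lambda>x. f x - c * g x))\<^sup>2" by simp
  also have "\<dots> = (H_norm f)\<^sup>2 + (cmod c * H_norm g)\<^sup>2 - 2 * Re (cnj c * H_inner f g)"
    using assms by (simp add: H_norm_diff_sq H_scale H_norm_scale H_inner_scale_right)
  also have "(cmod c * H_norm g)\<^sup>2 = (cmod (H_inner f g))\<^sup>2 / G"
    using G by (simp add: c_def norm_divide power_mult_distrib power_divide flip: G_def) (simp add: power2_eq_square)
  also have "Re (cnj c * H_inner f g) = (cmod (H_inner f g))\<^sup>2 / G"
  proof -
    have "cnj c * H_inner f g = complex_of_real ((cmod (H_inner f g))\<^sup>2 / G)"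
      by (simp add: c_def complex_norm_square[symmetric] mult.commute flip: of_real_power)
    then show ?thesis by (metis Re_complex_of_real)
  qed
  finally have "(cmod (H_inner f g))\<^sup>2 / G \<le> (H_norm f)\<^sup>2" by simp
  then have "(cmod (H_inner f g))\<^sup>2 \<le> (H_norm f * H_norm g)\<^sup>2"
    using G by (simp add: field_simps power_mult_distrib G_def)
  then show ?thesis by (rule power2_le_imp_le) simp
qed

lemma H_norm_minus_commute: "H_norm (\<lambda>x. f x - g x) = H_norm (\<lambda>x. g x - f x)"
  by (simp add: H_norm_def norm_minus_commute)

lemma H_norm_triangle_diff:
  assumes "f \<in> H_space" "g \<in> H_space"
  shows "H_norm (\<lambda>x. f x - g x) \<le> H_norm f + H_norm g"
proof -
  have "- Re (H_inner f g) \<le> H_norm f * H_norm g"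
    using H_Cauchy_Schwarz[OF assms] abs_Re_le_cmod[of "H_inner f g"] by linarith
  then have "(H_norm (\<lambda>x. f x - g x))\<^sup>2 \<le> (H_norm f + H_norm g)\<^sup>2"
    by (simp add: H_norm_diff_sq assms power2_sum)
  then show ?thesis by (rule power2_le_imp_le) simp
qed

lemma H_inner_tendsto:
  assumes "\<And>n. s n \<in> H_space" "f \<in> H_space" "h \<in> H_space"
    "(\<lambda>n. H_norm (\<lambda>x. f x - s n x)) \<longlonglongrightarrow> 0"
  shows "(\<lambda>n. H_inner (s n) h) \<longlonglongrightarrow> H_inner f h"
proof -
  have "(\<lambda>n. H_inner f h - H_inner (s n) h) \<longlonglongrightarrow> 0"
  proof (rule Lim_null_comparison)
    show "(\<lambda>n. H_norm (\<lambda>x. f x - s n x) * H_norm h) \<longlonglongrightarrow> 0"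
      using tendsto_mult_right[OF assms(4), of "H_norm h"] by simp
    have "norm (H_inner f h - H_inner (s n) h) \<le> H_norm (\<lambda>x. f x - s n x) * H_norm h" for n
      using H_Cauchy_Schwarz[of "\<lambda>x. f x - s n x" h] assms by (simp add: H_inner_diff_left H_diff)
    then show "\<forall>\<^sub>F n in sequentially. norm (H_inner f h - H_inner (s n) h) \<le> H_norm (\<lambda>x. f x - s n x) * H_norm h"
      by (intro always_eventually) blast
  qed
  then show ?thesis by (rule Lim_transform2[OF tendsto_const])
qed

lemma H_norm_tendsto:
  assumes "\<And>n. s n \<in> H_space" "f \<in> H_space" "(\<lambda>n. H_norm (\<lambda>x. f x - s n x)) \<longlonglongrightarrow> 0"
  shows "(\<lambda>n. H_norm (s n)) \<longlonglongrightarrow> H_norm f"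
proof -
  have "\<bar>H_norm (s n) - H_norm f\<bar> \<le> H_norm (\<lambda>x. f x - s n x)" for n
  proof -
    have "H_norm (s n) \<le> H_norm f + H_norm (\<lambda>x. f x - s n x)"
      using H_norm_triangle_diff[of f "\<lambda>x. f x - s n x"] assms(1,2) by (simp add: H_diff)
    moreover have "H_norm f \<le> H_norm (s n) + H_norm (\<lambda>x. f x - s n x)"
      using H_norm_triangle_diff[of "s n" "\<lambda>x. s n x - f x"] assms(1,2) H_norm_minus_commute[of f "s n"]
      by (simp add: H_diff)
    ultimately show ?thesis by linarith
  qed
  then show ?thesis
    by (intro LIM_zero_cancel[OF Lim_null_comparison[OF _ assms(3)]] always_eventually) simp
qed

text \<open>The total mass of the measure is finite, so square integrable functions are integrable. This turns
  norm estimates into the absolute summability that the proof of completeness needs.\<close>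

lemma H_norm_L1_bound:
  assumes "f \<in> H_space"
  shows "integrable Mw (\<lambda>x. cmod (f x))"
    and "(LINT x|Mw. cmod (f x)) \<le> sqrt (measure Mw (space Mw)) * H_norm f"
proof -
  have f: "(\<lambda>x. complex_of_real (cmod (f x))) \<in> H_space"
    using assms by (auto simp: H_space_def intro!: measurable_compose[of "\<lambda>x. cmod (f x)" Mw borel complex_of_real])
  have 1: "(\<lambda>x. 1) \<in> H_space" by (simp add: H_space_def)
  have i: "integrable Mw (\<lambda>x. complex_of_real (cmod (f x)))"
    using H_inner_integrable[OF f 1] by simp
  then show "integrable Mw (\<lambda>x. cmod (f x))" by (simp only: complex_of_real_integrable_eq)
  have "cmod (H_inner (\<lambda>x. complex_of_real (cmod (f x))) (\<lambda>x. 1)) \<le> H_norm f * sqrt (measure Mw (space Mw))"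
    using H_Cauchy_Schwarz[OF f 1] by (simp add: H_norm_def)
  then show "(LINT x|Mw. cmod (f x)) \<le> sqrt (measure Mw (space Mw)) * H_norm f"
    by (simp add: H_inner_def mult.commute)
qed

text \<open>The classical argument: a subsequence with geometrically small increments converges absolutely
  almost everywhere, and Fatou's lemma identifies its limit as the limit in norm.\<close>

theorem H_complete:
  assumes s: "\<And>n. s n \<in> H_space"
    and Cauchy: "\<And>e. 0 < e \<Longrightarrow> \<exists>N. \<forall>m\<ge>N. \<forall>n\<ge>N. H_norm (\<lambda>x. s m x - s n x) < e"
  obtains f where "f \<in> H_space" "(\<lambda>n. H_norm (\<lambda>x. f x - s n x)) \<longlonglongrightarrow> 0"
proof -
  have [measurable]: "s n \<in> borel_measurable Mw" for n using s by measurable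
  obtain N where N: "\<And>k m n. m \<ge> N k \<Longrightarrow> n \<ge> N k \<Longrightarrow> H_norm (\<lambda>x. s m x - s n x) < (1/2)^k"
    using Cauchy[of "(1/2)^_"] by (metis zero_less_divide_1_iff zero_less_numeral zero_less_power)
  \<comment> \<open>both \<open>r k\<close> and \<open>r (k + 1)\<close> have to be at least \<open>N k\<close>\<close>
  define r where "r k = (\<Sum>j\<le>k. N j) + k" for k
  have rN: "N k \<le> r k" for k unfolding r_def by (simp add: sum_nonneg_leq_bound trans_le_add1 member_le_sum)
  have rS: "N k \<le> r (Suc k)" for k
    using rN[of k] by (simp add: r_def)
  have rk: "k \<le> r k" for k by (simp add: r_def)
  define D where "D k x = s (r (Suc k)) x - s (r k) x" for k x
  have D: "D k \<in> H_space" for k unfolding D_def using H_diff[OF s s] .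
  have [measurable]: "D k \<in> borel_measurable Mw" for k using D by measurable
  have "H_norm (D k) \<le> (1/2)^k" for k
    using N[OF rS rN] by (simp add: D_def[abs_def] less_imp_le)
  then have Dint: "(LINT x|Mw. cmod (D k x)) \<le> sqrt (measure Mw (space Mw)) * (1/2)^k" for k
    using H_norm_L1_bound(2)[OF D[of k]] by (meson mult_left_mono order_trans real_sqrt_ge_zero measure_nonneg)
  have "(\<integral>\<^sup>+x. (\<Sum>k. ennreal (cmod (D k x))) \<partial>Mw) = (\<Sum>k. \<integral>\<^sup>+x. ennreal (cmod (D k x)) \<partial>Mw)"
    by (rule nn_integral_suminf) measurable
  also have "\<dots> = (\<Sum>k. ennreal (LINT x|Mw. cmod (D k x)))"
    by (intro suminf_cong nn_integral_eq_integral H_norm_L1_bound(1) D) auto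
  also have "\<dots> \<le> (\<Sum>k. ennreal (sqrt (measure Mw (space Mw)) * (1/2)^k))"
    by (intro suminf_le ennreal_leI Dint) auto
  also have "\<dots> = ennreal (\<Sum>k. sqrt (measure Mw (space Mw)) * (1/2)^k)"
    by (rule suminf_ennreal_eq) (auto intro!: summable_sums summable_mult summable_geometric)
  finally have "(\<integral>\<^sup>+x. (\<Sum>k. ennreal (cmod (D k x))) \<partial>Mw) \<noteq> \<infinity>" by (auto simp: top_unique)
  then have "AE x in Mw. (\<Sum>k. ennreal (cmod (D k x))) \<noteq> \<infinity>"
    by (intro nn_integral_PInf_AE) auto
  then have AEc: "AE x in Mw. convergent (\<lambda>k. s (r k) x)"
  proof eventually_elim
    case (elim x)
    then have "summable (\<lambda>k. cmod (D k x))"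
      by (intro summable_suminf_not_top) (auto simp: top_unique)
    then have "summable (\<lambda>k. D k x)" by (rule summable_norm_cancel)
    then have "convergent (\<lambda>n. \<Sum>k<n. D k x)" by (simp add: summable_iff_convergent)
    then have "convergent (\<lambda>n. s (r n) x - s (r 0) x)"
      unfolding D_def by (simp only: sum_lessThan_telescope[of "\<lambda>k. s (r k) x"])
    then show ?case by (simp add: convergent_diff_const_right_iff)
  qed
  define f where "f x = lim (\<lambda>k. s (r k) x)" for x
  have [measurable]: "f \<in> borel_measurable Mw" unfolding f_def by measurable
  have lim: "AE x in Mw. (\<lambda>k. s (r k) x) \<longlonglongrightarrow> f x"
    using AEc by eventually_elim (simp add: f_def convergent_LIMSEQ_iff)
  have bound: "(\<integral>\<^sup>+x. ennreal ((cmod (f x - s n x))\<^sup>2) \<partial>Mw) \<le> ennreal (((1/2)^k)\<^sup>2)" if n: "n \<ge> N k" for n k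
  proof -
    have "(\<integral>\<^sup>+x. ennreal ((cmod (f x - s n x))\<^sup>2) \<partial>Mw) =
        (\<integral>\<^sup>+x. liminf (\<lambda>j. ennreal ((cmod (s (r j) x - s n x))\<^sup>2)) \<partial>Mw)"
    proof (intro nn_integral_cong_AE, use lim in eventually_elim)
      case (elim x)
      then have "(\<lambda>j. ennreal ((cmod (s (r j) x - s n x))\<^sup>2)) \<longlonglongrightarrow> ennreal ((cmod (f x - s n x))\<^sup>2)"
        by (intro tendsto_intros)
      then show ?case by (intro lim_imp_Liminf[symmetric]) auto
    qed
    also have "\<dots> \<le> liminf (\<lambda>j. \<integral>\<^sup>+x. ennreal ((cmod (s (r j) x - s n x))\<^sup>2) \<partial>Mw)"
      by (rule nn_integral_liminf) measurable
    also have "\<dots> \<le> ennreal (((1/2)^k)\<^sup>2)"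
    proof -
      have "(\<integral>\<^sup>+x. ennreal ((cmod (s (r j) x - s n x))\<^sup>2) \<partial>Mw) \<le> ennreal (((1/2)^k)\<^sup>2)" if "j \<ge> N k" for j
      proof -
        have "H_norm (\<lambda>x. s (r j) x - s n x) \<le> (1/2)^k"
          using N[of k "r j" n] rk[of j] that n by (simp add: less_imp_le)
        then have "(H_norm (\<lambda>x. s (r j) x - s n x))\<^sup>2 \<le> ((1/2)^k)\<^sup>2" by (rule power_mono) simp
        then show ?thesis
          using H_space_integrable[OF H_diff[OF s[of "r j"] s[of n]]]
          by (subst nn_integral_eq_integral) (auto simp: H_norm_sq intro!: ennreal_leI)
      qed
      then have "eventually (\<lambda>j. (\<integral>\<^sup>+x. ennreal ((cmod (s (r j) x - s n x))\<^sup>2) \<partial>Mw) \<le> ennreal (((1/2)^k)\<^sup>2)) sequentially"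
        by (auto simp: eventually_sequentially)
      then have "liminf (\<lambda>j. \<integral>\<^sup>+x. ennreal ((cmod (s (r j) x - s n x))\<^sup>2) \<partial>Mw) \<le> liminf (\<lambda>j::nat. ennreal (((1/2)^k)\<^sup>2))"
        by (rule Liminf_mono)
      then show ?thesis by (simp add: Liminf_const)
    qed
    finally show ?thesis .
  qed
  have fs: "(\<lambda>x. f x - s n x) \<in> H_space" if "n \<ge> N k" for n k
    unfolding H_space_def mem_Collect_eq
  proof
    show "integrable Mw (\<lambda>x. (cmod (f x - s n x))\<^sup>2)"
    proof (rule integrableI_bounded)
      show "(\<integral>\<^sup>+x. ennreal (norm ((cmod (f x - s n x))\<^sup>2)) \<partial>Mw) < \<infinity>"
        using order_le_less_trans[OF bound[OF that] ennreal_less_top] by simp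
    qed measurable
  qed measurable
  have fH: "f \<in> H_space"
    using H_add[OF fs[of 0 "N 0"] s[of "N 0"]] by simp
  have small: "H_norm (\<lambda>x. f x - s n x) \<le> (1/2)^k" if "n \<ge> N k" for n k
  proof -
    have "ennreal ((H_norm (\<lambda>x. f x - s n x))\<^sup>2) \<le> ennreal (((1/2)^k)\<^sup>2)"
      using bound[OF that] by (subst (asm) nn_integral_eq_integral)
        (auto simp: H_norm_sq intro!: H_space_integrable fs[OF that])
    then show ?thesis by (simp add: power2_le_iff_abs_le)
  qed
  have "(\<lambda>n. H_norm (\<lambda>x. f x - s n x)) \<longlonglongrightarrow> 0"
  proof (rule LIMSEQ_I)
    fix e :: real assume "0 < e"
    then obtain k where "(1/2)^k < e" using real_arch_pow_inv[of e "1/2"] by auto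
    then show "\<exists>no. \<forall>n\<ge>no. norm (H_norm (\<lambda>x. f x - s n x) - 0) < e"
      by (intro exI[of _ "N k"]) (simp add: order_le_less_trans[OF small])
  qed
  then show ?thesis using fH that by blast
qed

section \<open>Smooth functions and the fundamental lemma\<close>

text \<open>Differentiability up to order \<open>k\<close> in a form that suits induction: the derivative is quantified
  instead of being given by \<open>deriv\<close>, so that closure properties reduce to the differentiation
  rules.\<close>

fun Ck :: "nat \<Rightarrow> (real \<Rightarrow> real) \<Rightarrow> bool" where
  "Ck 0 f \<longleftrightarrow> True"
| "Ck (Suc k) f \<longleftrightarrow> (\<exists>f'. (\<forall>x. (f has_real_derivative f' x) (at x)) \<and> Ck k f')"

lemma Ck_Suc_imp: "Ck (Suc k) f \<Longrightarrow> Ck k f"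
  by (induction k arbitrary: f) (simp, metis Ck.simps(2))

lemma Ck_SucI: "(\<And>x. (f has_real_derivative f' x) (at x)) \<Longrightarrow> Ck k f' \<Longrightarrow> Ck (Suc k) f"
  by auto

lemma Ck_deriv: "Ck (Suc k) f \<Longrightarrow> Ck k (deriv f)"
proof -
  assume "Ck (Suc k) f"
  then obtain f' where f': "\<And>x. (f has_real_derivative f' x) (at x)" "Ck k f'" by auto
  have "deriv f = f'" by (rule ext) (rule DERIV_imp_deriv[OF f'(1)])
  then show ?thesis using f'(2) by simp
qed

lemma Ck_all_imp_smooth:
  assumes "\<And>k. Ck k f" shows "(deriv ^^ k) f differentiable (at x)"
proof -
  have "Ck j ((deriv ^^ k) f)" for j
    using assms by (induction k arbitrary: j) (auto intro: Ck_deriv)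
  from this[of "Suc 0"] show ?thesis by (auto simp: real_differentiable_def)
qed

lemma Ck_const: "Ck k (\<lambda>x. c)"
  by (induction k arbitrary: c) (auto intro!: exI[of _ "\<lambda>x. 0"])

lemma Ck_add: "Ck k f \<Longrightarrow> Ck k g \<Longrightarrow> Ck k (\<lambda>x. f x + g x)"
proof (induction k arbitrary: f g)
  case (Suc k)
  obtain f' where f': "\<And>x. (f has_real_derivative f' x) (at x)" "Ck k f'"
    using Suc.prems(1) by auto
  obtain g' where g': "\<And>x. (g has_real_derivative g' x) (at x)" "Ck k g'"
    using Suc.prems(2) by auto
  note d = f' g'
  then show ?case using Suc.IH[of f' g'] d
    by (intro Ck_SucI[where f'="\<lambda>x. f' x + g' x"]) (auto intro: DERIV_add)
qed simp

lemma Ck_mult: "Ck k f \<Longrightarrow> Ck k g \<Longrightarrow> Ck k (\<lambda>x. f x * g x)"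
proof (induction k arbitrary: f g)
  case (Suc k)
  obtain f' where f': "\<And>x. (f has_real_derivative f' x) (at x)" "Ck k f'"
    using Suc.prems(1) by auto
  obtain g' where g': "\<And>x. (g has_real_derivative g' x) (at x)" "Ck k g'"
    using Suc.prems(2) by auto
  note d = f' g'
  have "Ck k (\<lambda>x. f' x * g x + g' x * f x)"
    by (intro Ck_add Suc.IH d(2,4) Suc.prems[THEN Ck_Suc_imp])
  then show ?case using d
    by (intro Ck_SucI[where f'="\<lambda>x. f' x * g x + g' x * f x"]) (auto intro: DERIV_mult)
qed simp

lemma Ck_compose: "Ck k f \<Longrightarrow> Ck k g \<Longrightarrow> Ck k (\<lambda>x. f (g x))"
proof (induction k arbitrary: f g)
  case (Suc k)
  obtain f' where f': "\<And>x. (f has_real_derivative f' x) (at x)" "Ck k f'"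
    using Suc.prems(1) by auto
  obtain g' where g': "\<And>x. (g has_real_derivative g' x) (at x)" "Ck k g'"
    using Suc.prems(2) by auto
  note d = f' g'
  have "Ck k (\<lambda>x. f' (g x) * g' x)"
    by (rule Ck_mult[OF Suc.IH[OF d(2) Ck_Suc_imp[OF Suc.prems(2)]] d(4)])
  then show ?case using d
    by (intro Ck_SucI[where f'="\<lambda>x. f' (g x) * g' x"]) (auto intro: DERIV_chain2)
qed simp

lemma Ck_ident: "Ck k (\<lambda>x. x)"
  by (cases k) (auto intro!: exI[of _ "\<lambda>x. 1"] Ck_const)

lemma Ck_sin_cos: "Ck k sin \<and> Ck k cos"
proof (induction k)
  case (Suc k)
  then have "Ck k (\<lambda>x. (-1) * sin x)" by (intro Ck_mult Ck_const) auto
  then have "Ck k (\<lambda>x. - sin x)" by simp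
  with Suc show ?case
    by (intro conjI Ck_SucI[of sin cos] Ck_SucI[of cos "\<lambda>x. - sin x"] DERIV_sin DERIV_cos) auto
qed simp

lemma Ck_poly: "Ck k (poly p)"
  by (induction k arbitrary: p) (auto intro!: exI[of _ "poly (pderiv _)"] poly_DERIV)

text \<open>With \<open>q = 1 / (c s - 1)\<close> this is \<open>s\<^sup>a q\<^sup>j e\<^sup>-\<^sup>q\<close>, cut off at \<open>s = 1/c\<close>. The family contains smooth
  functions that vanish near \<open>0\<close> and tend to \<open>s\<^sup>a\<close> as \<open>c\<close> grows (the case \<open>j = 0\<close>). The parameters \<open>a\<close> and
  \<open>j\<close> are there because derivatives of members are linear combinations of members.\<close>

definition flat :: "real \<Rightarrow> real \<Rightarrow> nat \<Rightarrow> real \<Rightarrow> real" where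
  "flat c a j s = (if 1 / c < s then s powr a * (1 / (c * s - 1)) ^ j * exp (- (1 / (c * s - 1))) else 0)"

text \<open>Only the point \<open>s = 1/c\<close> is not covered by the differentiation rules. There the difference
  quotient contains one more power of \<open>q\<close>, which the exponential absorbs.\<close>

lemma flat_deriv:
  assumes c: "0 < c"
  shows "(flat c a j has_real_derivative
    a * flat c (a - 1) j s - c * real j * flat c a (Suc j) s + c * flat c a (Suc (Suc j)) s) (at s)"
proof -
  consider "s < 1 / c" | "s > 1 / c" | "s = 1 / c" by linarith
  then show ?thesis
  proof cases
    case 1
    have "((\<lambda>x. 0) has_real_derivative 0) (at s)" by simp
    then have "(flat c a j has_real_derivative 0) (at s)"
      by (rule has_field_derivative_transform_within_open[where S="{..<1/c}"]) (use 1 in \<open>auto simp: flat_def\<close>)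
    then show ?thesis using 1 by (simp add: flat_def)
  next
    case 2
    then have cs: "c * s - 1 > 0" using c by (simp add: field_simps)
    have s: "s > 0" using 2 c by (meson divide_pos_pos less_trans zero_less_one)
    define q where "q = 1 / (c * s - 1)"
    have q: "((\<lambda>s. 1 / (c * s - 1)) has_real_derivative - c * q\<^sup>2) (at s)"
      using cs by (auto intro!: derivative_eq_intros simp: q_def power2_eq_square)
    have j: "real j * q ^ (j - Suc 0) * (- c * q\<^sup>2) = - c * real j * q ^ Suc j"
      by (cases j) (auto simp: power2_eq_square)
    have p: "((\<lambda>s. (1 / (c * s - 1)) ^ j) has_real_derivative - c * real j * q ^ Suc j) (at s)"
      using DERIV_chain2[OF DERIV_pow[of j] q] unfolding q_def[symmetric] j by simp
    have e: "((\<lambda>s. exp (- (1 / (c * s - 1)))) has_real_derivative c * q\<^sup>2 * exp (- q)) (at s)"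
      using DERIV_chain2[OF DERIV_exp DERIV_minus[OF q]] unfolding q_def[symmetric] by (simp add: mult.commute)
    have r: "((\<lambda>s. s powr a) has_real_derivative a * s powr (a - 1)) (at s)"
      using has_real_derivative_powr[OF s, of a] by simp
    have "((\<lambda>s. s powr a * (1 / (c * s - 1)) ^ j * exp (- (1 / (c * s - 1)))) has_real_derivative
        (a * s powr (a - 1) * q ^ j + (- c * real j * q ^ Suc j) * s powr a) * exp (- q)
        + c * q\<^sup>2 * exp (- q) * (s powr a * q ^ j)) (at s)"
      unfolding q_def by (intro DERIV_mult r[unfolded q_def] p[unfolded q_def] e[unfolded q_def])
    then have "(flat c a j has_real_derivative
        (a * s powr (a - 1) * q ^ j + (- c * real j * q ^ Suc j) * s powr a) * exp (- q)
        + c * q\<^sup>2 * exp (- q) * (s powr a * q ^ j)) (at s)"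
      by (rule has_field_derivative_transform_within_open[where S="{1/c<..}"]) (use 2 in \<open>auto simp: flat_def\<close>)
    then show ?thesis using 2
      by (simp add: flat_def q_def[symmetric]) (simp add: algebra_simps power2_eq_square)
  next
    case 3
    have L: "((\<lambda>x. (flat c a j x - flat c a j s) / (x - s)) \<longlongrightarrow> 0) (at s)"
      unfolding filterlim_at_split
    proof
      show "((\<lambda>x. (flat c a j x - flat c a j s) / (x - s)) \<longlongrightarrow> 0) (at_left s)"
        by (rule tendsto_eventually)
           (auto simp: eventually_at_left_field flat_def 3 intro!: exI[of _ "s - 1"])
      have q: "filterlim (\<lambda>x. 1 / (c * x - 1)) at_top (at_right s)"
      proof -
        have "((\<lambda>x. c * x - 1) \<longlongrightarrow> c * s - 1) (at_right s)" by (intro tendsto_intros)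
        moreover have "\<forall>\<^sub>F x in at_right s. 0 < c * x - 1"
          unfolding eventually_at_right_field
        proof (intro exI[of _ "s + 1"] conjI allI impI)
          fix x assume "s < x"
          then have "c * s < c * x" using c by simp
          then show "0 < c * x - 1" using c 3 by simp
        qed simp
        ultimately show ?thesis
          using c 3 filterlim_inverse_at_top[of "\<lambda>x. c * x - 1" "at_right s"] by (simp add: inverse_eq_divide)
      qed
      have "((\<lambda>x. x ^ Suc j / exp x) \<longlongrightarrow> (0::real)) at_top" by (rule tendsto_power_div_exp_0)
      from filterlim_compose[OF this q]
      have "((\<lambda>x. c * (x powr a * ((1 / (c * x - 1)) ^ Suc j / exp (1 / (c * x - 1))))) \<longlongrightarrow> c * (s powr a * 0)) (at_right s)"
        using c 3 by (intro tendsto_intros) auto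
      moreover have "\<forall>\<^sub>F x in at_right s. c * (x powr a * ((1 / (c * x - 1)) ^ Suc j / exp (1 / (c * x - 1)))) =
             (flat c a j x - flat c a j s) / (x - s)"
          unfolding eventually_at_right_field
        proof (intro exI[of _ "s + 1"] conjI allI impI)
          fix x assume "s < x"
          then have x: "1 / c < x" "x - s = (c * x - 1) / c" using 3 c by (auto simp: field_simps)
          have *: "c * (p * ((1 / D) ^ Suc j / exp (1 / D))) = p * (1 / D) ^ j * exp (- (1 / D)) / (D / c)" for p D :: real
            by (simp add: exp_minus divide_inverse)
          have "flat c a j x - flat c a j s = x powr a * (1 / (c * x - 1)) ^ j * exp (- (1 / (c * x - 1)))"
            using x(1) 3 by (simp only: flat_def) simp
          then show "c * (x powr a * ((1 / (c * x - 1)) ^ Suc j / exp (1 / (c * x - 1)))) =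
             (flat c a j x - flat c a j s) / (x - s)"
            unfolding x(2) * by (rule arg_cong[OF sym])
        qed simp
      ultimately show "((\<lambda>x. (flat c a j x - flat c a j s) / (x - s)) \<longlongrightarrow> 0) (at_right s)"
        unfolding mult_zero_right by (rule Lim_transform_eventually)
    qed
    then have "(flat c a j has_real_derivative 0) (at s)" by (simp add: has_field_derivative_iff)
    then show ?thesis using 3 by (simp add: flat_def)
  qed
qed

lemma Ck_flat: assumes "0 < c" shows "Ck k (flat c a j)"
proof (induction k arbitrary: a j)
  case (Suc k)
  have "Ck k (\<lambda>s. a * flat c (a - 1) j s + (- (c * real j)) * flat c a (Suc j) s + c * flat c a (Suc (Suc j)) s)"
    using Suc by (intro Ck_add Ck_mult Ck_const)
  then show ?case by (intro Ck_SucI[OF flat_deriv[OF assms]]) (simp add: algebra_simps)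
qed simp

text \<open>Functions of \<open>sin\<close> are positive on every second half period, so they have to be cut off outside
  \<open>(0,\<pi>)\<close> to become test functions.\<close>

definition restrict_0pi :: "(real \<Rightarrow> real) \<Rightarrow> real \<Rightarrow> real" where
  "restrict_0pi h x = (if 0 < x \<and> x < pi then h x else 0)"

lemma Ck_restrict_0pi:
  assumes "open U" "0 \<in> U" "pi \<in> U"
  shows "Ck k h \<Longrightarrow> (\<And>x. x \<in> U \<Longrightarrow> h x = 0) \<Longrightarrow> Ck k (restrict_0pi h)"
proof (induction k arbitrary: h)
  case (Suc k)
  then obtain h' where h': "\<And>x. (h has_real_derivative h' x) (at x)" "Ck k h'" by auto
  have z: "h' x = 0" if "x \<in> U" for x
  proof -
    have "((\<lambda>x. 0) has_real_derivative 0) (at x)" by simp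
    then have "(h has_real_derivative 0) (at x)"
      by (rule has_field_derivative_transform_within_open[OF _ \<open>open U\<close> that]) (use Suc.prems in auto)
    then show ?thesis using h'(1) DERIV_unique by blast
  qed
  have "(restrict_0pi h has_real_derivative restrict_0pi h' x) (at x)" for x
  proof -
    \<comment> \<open>away from \<open>0\<close> and \<open>\<pi>\<close> the function is locally \<open>h\<close> or \<open>0\<close>; near these points both vanish\<close>
    consider "x \<in> {0<..<pi}" | "x \<in> - {0..pi}" | "x = 0" | "x = pi" by fastforce
    then consider "x \<in> {0<..<pi}" | "x \<in> - {0..pi}" | "x \<in> U" using assms by metis
    then show ?thesis
    proof cases
      case 1
      then show ?thesis
        using has_field_derivative_transform_within_open[OF h'(1) _ 1, of "restrict_0pi h"] by (auto simp: restrict_0pi_def)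
    next
      case 2
      have "((\<lambda>x. 0) has_real_derivative 0) (at x)" by simp
      then have "(restrict_0pi h has_real_derivative 0) (at x)"
        by (rule has_field_derivative_transform_within_open[OF _ _ 2]) (auto simp: restrict_0pi_def)
      then show ?thesis using 2 by (auto simp: restrict_0pi_def)
    next
      case 3
      have "((\<lambda>x. 0) has_real_derivative 0) (at x)" by simp
      then have "(restrict_0pi h has_real_derivative 0) (at x)"
        by (rule has_field_derivative_transform_within_open[OF _ \<open>open U\<close> 3]) (use Suc.prems in \<open>auto simp: restrict_0pi_def\<close>)
      then show ?thesis using z[OF 3] by (auto simp: restrict_0pi_def)
    qed
  qed
  moreover have "Ck k (restrict_0pi h')" by (rule Suc.IH[OF h'(2) z])
  ultimately show ?case by (rule Ck_SucI)
qed simp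

lemma sin_gt_imp:
  assumes "0 < x" "x < pi" "e < sin x" shows "e < x" "x < pi - e"
  using sin_x_le_x[of x] sin_x_le_x[of "pi - x"] assms by auto

text \<open>These are the test functions used in Green's formula: smooth cut-offs of \<open>sin\<^sup>a \<cdot> p(cos)\<close>, where the
  possibly fractional power \<open>a\<close> brings in the weight.\<close>

lemma restrict_flat_test:
  assumes c: "1 \<le> c"
  shows "restrict_0pi (\<lambda>x. flat c a 0 (sin x) * poly p (cos x)) \<in> test_functions"
proof -
  let ?h = "\<lambda>x. flat c a 0 (sin x) * poly p (cos x)"
  have "Ck k (restrict_0pi ?h)" for k
  proof (rule Ck_restrict_0pi[where U="{x. sin x < 1 / c}"])
    show "open {x. sin x < 1 / c}" by (intro open_Collect_less continuous_intros)
    show "Ck k ?h" using c Ck_sin_cos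
      by (intro Ck_mult Ck_compose[of k "flat c a 0" sin] Ck_flat Ck_compose[of k "poly p" cos] Ck_poly) auto
  qed (use c in \<open>auto simp: flat_def\<close>)
  then have "\<forall>k x. (deriv ^^ k) (restrict_0pi ?h) differentiable (at x)" by (auto intro: Ck_all_imp_smooth)
  moreover have c1: "1 / c \<le> 1" "0 < 1 / c" using c by auto
  \<comment> \<open>the support lies in \<open>[1/c, \<pi> - 1/c]\<close> because \<open>sin x \<le> x\<close>\<close>
  have lt: "1 / c < pi - 1 / c" using pi_gt3 c1 by linarith
  have "restrict_0pi ?h x = 0" if "x \<notin> {1/c..pi - 1/c}" for x
    using that sin_gt_imp[of x "1 / c"] by (auto simp: restrict_0pi_def flat_def)
  then have "0 < 1 / c \<and> 1 / c < pi - 1 / c \<and> pi - 1 / c < pi \<and> (\<forall>x. x \<notin> {1/c..pi - 1/c} \<longrightarrow> restrict_0pi ?h x = 0)"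
    using lt c1 by auto
  ultimately show ?thesis unfolding test_functions_def mem_Collect_eq by blast
qed

text \<open>Each factor is \<open>t \<mapsto> e\<^sup>-\<^sup>1\<^sup>/\<^sup>t\<close> for positive \<open>t\<close>, with \<open>t = n (x - a)\<close> or \<open>t = n (b - x)\<close>. The shift by \<open>1\<close>
  compensates the position \<open>1/c = 1\<close> of the cut-off in \<open>flat\<close>.\<close>

definition plateau :: "real \<Rightarrow> real \<Rightarrow> nat \<Rightarrow> real \<Rightarrow> real" where
  "plateau a b n x = flat 1 0 0 (1 + real n * (x - a)) * flat 1 0 0 (1 + real n * (b - x))"

lemma plateau_eq:
  "plateau a b n x = (if 0 < real n * (x - a) \<and> 0 < real n * (b - x)
     then exp (- (1 / (real n * (x - a)))) * exp (- (1 / (real n * (b - x)))) else 0)"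
  by (auto simp: plateau_def flat_def)

lemma plateau_bounds: "0 \<le> plateau a b n x" "plateau a b n x \<le> 1"
  by (auto simp: plateau_eq intro!: mult_le_one divide_nonneg_pos)

lemma plateau_zero: "x \<notin> {a<..<b} \<Longrightarrow> plateau a b n x = 0"
  by (auto simp: plateau_eq zero_less_mult_iff)

lemma Ck_plateau: "Ck k (plateau a b n)"
proof -
  have 1: "Ck k (\<lambda>x. (1 - real n * a) + real n * x)" "Ck k (\<lambda>x. (1 + real n * b) + (- real n) * x)"
    by (intro Ck_add Ck_mult Ck_const Ck_ident)+
  show ?thesis unfolding plateau_def[abs_def]
    using Ck_mult[OF Ck_compose[OF Ck_flat[of 1 k 0 0] 1(1)] Ck_compose[OF Ck_flat[of 1 k 0 0] 1(2)]]
    by (simp add: algebra_simps)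
qed

lemma plateau_test: "0 < a \<Longrightarrow> a < b \<Longrightarrow> b < pi \<Longrightarrow> plateau a b n \<in> test_functions"
  unfolding test_functions_def using plateau_zero[of _ a b n]
  unfolding mem_Collect_eq
  by (intro conjI allI Ck_all_imp_smooth Ck_plateau exI[of _ a] exI[of _ b]) auto

lemma plateau_measurable: "plateau a b n \<in> borel_measurable borel"
proof -
  obtain f' where "\<And>x. (plateau a b n has_real_derivative f' x) (at x)"
    using Ck_plateau[of "Suc 0" a b n] by auto
  then have "continuous_on UNIV (plateau a b n)"
    by (meson DERIV_isCont continuous_at_imp_continuous_on)
  then show ?thesis by (rule borel_measurable_continuous_onI)
qed

lemma plateau_tendsto: "(\<lambda>n. plateau a b n x) \<longlonglongrightarrow> indicator {a<..<b} x"
proof (cases "x \<in> {a<..<b}")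
  case True
  then have x: "x - a > 0" "b - x > 0" by auto
  have "(\<lambda>n. exp (- (1 / (real n * (x - a)))) * exp (- (1 / (real n * (b - x))))) \<longlonglongrightarrow> 1"
  proof -
    have lim: "(\<lambda>n. exp (- (1 / d) * (1 / real n))) \<longlonglongrightarrow> exp (- (1 / d) * 0)" for d
      by (intro tendsto_intros lim_1_over_n)
    show ?thesis
      using tendsto_mult[OF lim[of "x - a"] lim[of "b - x"]] by (simp add: mult.commute)
  qed
  moreover have "\<forall>\<^sub>F n in sequentially. exp (- (1 / (real n * (x - a)))) * exp (- (1 / (real n * (b - x)))) = plateau a b n x"
    using eventually_gt_at_top[of 0] by eventually_elim (use x in \<open>auto simp: plateau_eq\<close>)
  ultimately have "(\<lambda>n. plateau a b n x) \<longlonglongrightarrow> 1" by (rule Lim_transform_eventually)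
  then show ?thesis using True by simp
qed (simp add: plateau_zero)

text \<open>The half lines form an intersection-stable generator of the Borel sets, and the sets on which the
  integral vanishes form a Dynkin system.\<close>

lemma AE_zero_if_interval_integrals_zero:
  fixes G :: "real \<Rightarrow> complex"
  assumes G: "integrable lborel G" and z: "\<And>x. (LINT t:{x<..}|lborel. G t) = 0" and "(LINT t|lborel. G t) = 0"
  shows "AE t in lborel. G t = 0"
proof (rule sigma_finite_measure.density_zero[OF lborel.sigma_finite_measure_axioms G])
  have G': "set_integrable lborel A G" if "A \<in> sets borel" for A
    unfolding set_integrable_def using integrable_mult_indicator[of A lborel G] that G by simp
  fix A :: "real set" assume "A \<in> sets lborel"
  then have A: "A \<in> sigma_sets UNIV (range greaterThan)"
    by (simp add: borel_Ioi)
  have IS: "Int_stable (range greaterThan :: real set set)"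
    by (auto simp: Int_stable_def lessThan_Int_lessThan)
  have sub: "(range greaterThan :: real set set) \<subseteq> Pow UNIV" by simp
  from IS sub A show "(LINT t:A|lborel. G t) = 0"
  proof (induction rule: sigma_sets_induct_disjoint)
    case (basic A)
    then show ?case using z by auto
  next
    case (compl A)
    then have A: "A \<in> sets borel" by (simp add: borel_Ioi)
    have "(LINT t:A \<union> (UNIV - A)|lborel. G t) = (LINT t:A|lborel. G t) + (LINT t:(UNIV - A)|lborel. G t)"
      using A by (intro set_integral_Un G') auto
    moreover have "(LINT t:UNIV|lborel. G t) = 0" using assms(3) by (simp add: set_lebesgue_integral_def)
    ultimately show ?case using compl by simp
  next
    case (union A)
    then have A: "A i \<in> sets borel" for i by (auto simp: borel_Ioi)
    have "(LINT t:(\<Union>i. A i)|lborel. G t) = (\<Sum>i. (LINT t:A i|lborel. G t))"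
      using union(1) A by (intro lebesgue_integral_countable_add G') (auto simp: disjoint_family_on_def)
    then show ?case using union by simp
  next
    case empty
    show ?case by (simp add: set_lebesgue_integral_def)
  qed
qed

text \<open>Plateau functions converge boundedly to the indicator of an interval, so all integrals of \<open>g\<close> over
  compact subintervals vanish.\<close>

theorem fundamental_lemma_calculus_variations:
  fixes g :: "real \<Rightarrow> complex"
  assumes int: "\<And>a b. 0 < a \<Longrightarrow> a < b \<Longrightarrow> b < pi \<Longrightarrow> set_integrable lborel {a..b} g"
    and zero: "\<And>\<psi>. \<psi> \<in> test_functions \<Longrightarrow> (LINT x:{0<..<pi}|lborel. g x * complex_of_real (\<psi> x)) = 0"
  shows "AE x in lborel. 0 < x \<and> x < pi \<longrightarrow> g x = 0"
proof -
  have I: "(LINT x:{a<..<b}|lborel. g x) = 0" if ab: "0 < a" "a < b" "b < pi" for a b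
  proof -
    let ?g = "\<lambda>x. indicator {a..b} x *\<^sub>R g x"
    have g: "integrable lborel ?g" using int[OF ab] by (simp add: set_integrable_def)
    have [measurable]: "plateau a b n \<in> borel_measurable lborel" for n
      using plateau_measurable by simp
    have [measurable]: "?g \<in> borel_measurable lborel" using g by (rule borel_measurable_integrable)
    have "(\<lambda>n. LINT x|lborel. ?g x * complex_of_real (plateau a b n x)) \<longlonglongrightarrow>
        (LINT x|lborel. ?g x * complex_of_real (indicator {a<..<b} x))"
    proof (rule integral_dominated_convergence[where w="\<lambda>x. norm (?g x)"])
      show "integrable lborel (\<lambda>x. norm (?g x))" using g by (rule integrable_norm)
      show "AE x in lborel. (\<lambda>n. ?g x * complex_of_real (plateau a b n x)) \<longlonglongrightarrow>
          ?g x * complex_of_real (indicator {a<..<b} x)"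
        by (intro AE_I2 tendsto_intros plateau_tendsto)
      show "AE x in lborel. norm (?g x * complex_of_real (plateau a b n x)) \<le> norm (?g x)" for n
        unfolding norm_mult using plateau_bounds[of a b n] by (intro AE_I2 mult_left_le) auto
    qed measurable
    moreover have "(LINT x|lborel. ?g x * complex_of_real (plateau a b n x)) = 0" for n
    proof -
      have "(LINT x|lborel. ?g x * complex_of_real (plateau a b n x)) =
          (LINT x:{0<..<pi}|lborel. g x * complex_of_real (plateau a b n x))"
        unfolding set_lebesgue_integral_def
      proof (intro Bochner_Integration.integral_cong refl)
        fix x
        show "?g x * complex_of_real (plateau a b n x) =
            indicator {0<..<pi} x *\<^sub>R (g x * complex_of_real (plateau a b n x))"
          using ab plateau_zero[of x a b n] by (cases "x \<in> {a<..<b}") auto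
      qed
      then show ?thesis using zero[OF plateau_test[OF ab]] by simp
    qed
    moreover have "(LINT x|lborel. ?g x * complex_of_real (indicator {a<..<b} x)) = (LINT x:{a<..<b}|lborel. g x)"
      unfolding set_lebesgue_integral_def
      by (intro Bochner_Integration.integral_cong) (auto simp: indicator_def)
    ultimately show ?thesis by (simp add: LIMSEQ_const_iff)
  qed
  have J: "AE x in lborel. a < x \<and> x < b \<longrightarrow> g x = 0" if ab: "0 < a" "a < b" "b < pi" for a b
  proof -
    let ?G = "\<lambda>x. indicator {a<..<b} x *\<^sub>R g x"
    have "set_integrable lborel {a<..<b} g"
      by (rule set_integrable_subset[OF int[OF ab]]) auto
    then have "integrable lborel ?G" by (simp add: set_integrable_def)
    then have "AE x in lborel. ?G x = 0"
    proof (rule AE_zero_if_interval_integrals_zero)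
      show "(LINT x|lborel. ?G x) = 0" using I[OF ab] by (simp add: set_lebesgue_integral_def)
      fix x
      have *: "(LINT t:{x<..}|lborel. ?G t) = (LINT t:{max a x<..<b}|lborel. g t)"
        unfolding set_lebesgue_integral_def
        by (intro Bochner_Integration.integral_cong) (auto simp: indicator_def)
      show "(LINT t:{x<..}|lborel. ?G t) = 0"
      proof (cases "max a x < b")
        case True
        then show ?thesis unfolding * using ab by (intro I) auto
      next
        case False
        then have "{max a x<..<b} = {}" by auto
        then show ?thesis unfolding * by (simp add: set_lebesgue_integral_def)
      qed
    qed
    then show ?thesis by eventually_elim auto
  qed
  have "AE x in lborel. \<forall>n::nat. 1 / (real n + 1) < x \<and> x < pi - 1 / (real n + 1) \<longrightarrow> g x = 0"
    unfolding AE_all_countable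
  proof
    fix n :: nat
    have "1 / (real n + 1) \<le> 1" "0 < 1 / (real n + 1)" by auto
    then show "AE x in lborel. 1 / (real n + 1) < x \<and> x < pi - 1 / (real n + 1) \<longrightarrow> g x = 0"
      using pi_gt3 by (intro J) linarith+
  qed
  then show ?thesis
  proof eventually_elim
    case (elim x)
    show ?case
    proof
      assume x: "0 < x \<and> x < pi"
      then obtain n where "inverse (real (Suc n)) < min x (pi - x)"
        using reals_Archimedean[of "min x (pi - x)"] by auto
      then show "g x = 0" using elim[rule_format, of n] by (simp add: inverse_eq_divide add.commute)
    qed
  qed
qed

section \<open>Gegenbauer polynomials\<close>

text \<open>The same recursion on formal polynomials, which makes derivatives available.\<close>

fun gegen_poly :: "real \<Rightarrow> nat \<Rightarrow> real poly" where
  "gegen_poly l 0 = 1"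
| "gegen_poly l (Suc 0) = [:0, 2 * l:]"
| "gegen_poly l (Suc (Suc n)) = smult (1 / (real n + 2))
     (smult (2 * (real n + 1 + l)) ([:0, 1:] * gegen_poly l (Suc n)) - smult (real n + 2 * l) (gegen_poly l n))"

lemma poly_gegen_poly: "poly (gegen_poly l n) x = gegenbauer l n x"
  by (induction l n rule: gegen_poly.induct) (simp_all add: diff_divide_distrib mult_ac)

definition dgegen :: "real \<Rightarrow> nat \<Rightarrow> real \<Rightarrow> real" where
  "dgegen l n x = poly (pderiv (gegen_poly l n)) x"

lemma gegenbauer_deriv: "(gegenbauer l n has_real_derivative dgegen l n x) (at x)"
  unfolding dgegen_def poly_gegen_poly[symmetric, abs_def] by (rule poly_DERIV)

lemma dgegen_0: "dgegen l 0 x = 0" and dgegen_1: "dgegen l (Suc 0) x = 2 * l"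
  by (simp_all add: dgegen_def pderiv_pCons)

lemma dgegen_rec:
  "(real n + 2) * dgegen l (Suc (Suc n)) x =
     2 * (real n + 1 + l) * (gegenbauer l (Suc n) x + x * dgegen l (Suc n) x) - (real n + 2 * l) * dgegen l n x"
proof -
  have "dgegen l (Suc (Suc n)) x = (2 * (real n + 1 + l) * (gegenbauer l (Suc n) x + x * dgegen l (Suc n) x)
      - (real n + 2 * l) * dgegen l n x) / (real n + 2)"
    by (simp add: dgegen_def pderiv_smult pderiv_diff pderiv_mult pderiv_pCons poly_gegen_poly
        diff_divide_distrib add_divide_distrib distrib_left mult_ac del: gegenbauer.simps)
  then show ?thesis by (simp del: gegenbauer.simps)
qed

lemma gegenbauer_rec:
  "(real n + 2) * gegenbauer l (Suc (Suc n)) x =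
     2 * (real n + 1 + l) * x * gegenbauer l (Suc n) x - (real n + 2 * l) * gegenbauer l n x"
  by simp

text \<open>The two classical derivative identities have to be proved simultaneously: the induction step of
  either one uses the other.\<close>

lemma dgegen_step:
  "dgegen l (Suc n) x = x * dgegen l n x + (real n + 2 * l) * gegenbauer l n x \<and>
   x * dgegen l (Suc n) x = dgegen l n x + (real n + 1) * gegenbauer l (Suc n) x"
proof (induction n)
  case 0 show ?case by (simp add: dgegen_0 dgegen_1)
next
  case (Suc n)
  define a b c where "a = gegenbauer l n x" and "b = gegenbauer l (Suc n) x" and "c = gegenbauer l (Suc (Suc n)) x"
  define a' b' c' where "a' = dgegen l n x" and "b' = dgegen l (Suc n) x" and "c' = dgegen l (Suc (Suc n)) x"
  define N where "N = real n"
  have N: "N + 2 \<noteq> 0" by (simp add: N_def)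
  have r: "(N + 2) * c = 2 * (N + 1 + l) * x * b - (N + 2 * l) * a"
    unfolding N_def a_def b_def c_def by (rule gegenbauer_rec)
  have d: "(N + 2) * c' = 2 * (N + 1 + l) * (b + x * b') - (N + 2 * l) * a'"
    unfolding N_def a'_def b'_def b_def c'_def by (rule dgegen_rec)
  have p: "b' = x * a' + (N + 2 * l) * a" and q: "x * b' = a' + (N + 1) * b"
    using Suc by (auto simp: a_def b_def a'_def b'_def N_def)
  have a': "a' = x * b' - (N + 1) * b" using q by simp
  have "(N + 2) * c' = (N + 2) * (x * b' + (N + 1 + 2 * l) * b)"
    unfolding d a' by (simp add: algebra_simps)
  then have c': "c' = x * b' + (N + 1 + 2 * l) * b" using N by simp
  have "x * x * b' - b' = (N + 1) * (x * b) - (N + 2 * l) * a"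
    using arg_cong[OF q, of "\<lambda>t. x * t"] p by (simp add: algebra_simps)
  then have "x * c' = b' + (N + 2) * c"
    unfolding c' r by (simp add: algebra_simps)
  then show ?case using c' by (simp add: b_def c_def b'_def c'_def N_def add_ac del: gegenbauer.simps)
qed

lemma gegenbauer_first_order:
  "(1 - x\<^sup>2) * dgegen l (Suc n) x = (real n + 2 * l) * gegenbauer l n x - (real n + 1) * x * gegenbauer l (Suc n) x"
proof -
  have "x * (x * dgegen l (Suc n) x) = x * (dgegen l n x + (real n + 1) * gegenbauer l (Suc n) x)"
    using dgegen_step[of l n x] by metis
  moreover have "dgegen l (Suc n) x = x * dgegen l n x + (real n + 2 * l) * gegenbauer l n x"
    using dgegen_step[of l n x] by blast
  ultimately show ?thesis by (simp add: algebra_simps power2_eq_square del: gegenbauer.simps)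
qed

definition ddgegen :: "real \<Rightarrow> nat \<Rightarrow> real \<Rightarrow> real" where
  "ddgegen l n x = poly (pderiv (pderiv (gegen_poly l n))) x"

lemma dgegen_deriv: "(dgegen l n has_real_derivative ddgegen l n x) (at x)"
  unfolding dgegen_def[abs_def] ddgegen_def by (rule poly_DERIV)

theorem gegenbauer_ode:
  "(1 - x\<^sup>2) * ddgegen l n x = (2 * l + 1) * x * dgegen l n x - real n * (real n + 2 * l) * gegenbauer l n x"
proof (cases n)
  case 0
  then show ?thesis by (simp add: dgegen_def ddgegen_def)
next
  case (Suc m)
  have "((\<lambda>x. (1 - x\<^sup>2) * dgegen l (Suc m) x) has_real_derivative
      (1 - x\<^sup>2) * ddgegen l (Suc m) x - 2 * x * dgegen l (Suc m) x) (at x)"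
    by (auto intro!: derivative_eq_intros dgegen_deriv)
  moreover have "((\<lambda>x. (1 - x\<^sup>2) * dgegen l (Suc m) x) has_real_derivative
      (real m + 2 * l) * dgegen l m x - (real m + 1) * (gegenbauer l (Suc m) x + x * dgegen l (Suc m) x)) (at x)"
    unfolding gegenbauer_first_order
    by (auto intro!: derivative_eq_intros gegenbauer_deriv simp del: gegenbauer.simps) (simp add: algebra_simps)
  ultimately have "(1 - x\<^sup>2) * ddgegen l (Suc m) x - 2 * x * dgegen l (Suc m) x =
      (real m + 2 * l) * dgegen l m x - (real m + 1) * (gegenbauer l (Suc m) x + x * dgegen l (Suc m) x)"
    by (rule DERIV_unique)
  moreover have "dgegen l m x = x * dgegen l (Suc m) x - (real m + 1) * gegenbauer l (Suc m) x"
    using dgegen_step[of l m x] by linarith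
  ultimately show ?thesis unfolding Suc by (simp add: algebra_simps del: gegenbauer.simps)
qed

lemma gegenbauer_at_1: "(real n + 1) * gegenbauer l (Suc n) 1 = (real n + 2 * l) * gegenbauer l n 1"
  using gegenbauer_first_order[of 1 l n] by simp

lemma gegenbauer_parity: "gegenbauer l n (- x) = (-1) ^ n * gegenbauer l n x"
  by (induction l n x rule: gegenbauer.induct) (simp_all add: field_simps)

text \<open>Sonine's argument. For a solution \<open>y\<close> of the Gegenbauer equation, the energy
  \<open>y\<^sup>2 + (1 - x\<^sup>2) y'\<^sup>2 / \<mu>\<close> has derivative \<open>4 l x y'\<^sup>2 / \<mu>\<close>, so on \<open>[0,1]\<close> it is largest at \<open>1\<close>, where it
  equals \<open>y\<^sup>2\<close>. Parity covers negative arguments.\<close>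

lemma gegenbauer_le_at_1:
  assumes "0 < l" "\<bar>x\<bar> \<le> 1"
  shows "\<bar>gegenbauer l n x\<bar> \<le> \<bar>gegenbauer l n 1\<bar>"
proof (cases "n = 0")
  case False
  define mu where "mu = real n * (real n + 2 * l)"
  have mu: "mu > 0" using False assms by (simp add: mu_def)
  define E where "E x = (gegenbauer l n x)\<^sup>2 + (1 - x\<^sup>2) * (dgegen l n x)\<^sup>2 / mu" for x
  have dE: "(E has_real_derivative 4 * l * x * (dgegen l n x)\<^sup>2 / mu) (at x)" for x
  proof -
    have "(E has_real_derivative 2 * gegenbauer l n x * dgegen l n x +
        (2 * dgegen l n x * ((1 - x\<^sup>2) * ddgegen l n x) - 2 * x * (dgegen l n x)\<^sup>2) / mu) (at x)"
      unfolding E_def[abs_def] using mu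
      by (auto intro!: derivative_eq_intros gegenbauer_deriv dgegen_deriv)
         (simp add: field_simps power2_eq_square)?
    moreover have "2 * gegenbauer l n x * dgegen l n x +
        (2 * dgegen l n x * ((1 - x\<^sup>2) * ddgegen l n x) - 2 * x * (dgegen l n x)\<^sup>2) / mu =
        4 * l * x * (dgegen l n x)\<^sup>2 / mu"
      unfolding gegenbauer_ode mu_def[symmetric] using mu by (simp add: field_simps power2_eq_square)
    ultimately show ?thesis by simp
  qed
  have "E \<bar>x\<bar> \<le> E 1"
    using assms mu by (intro DERIV_nonneg_imp_nondecreasing[of "\<bar>x\<bar>" 1 E]) (auto intro!: exI dE)
  moreover have "(gegenbauer l n \<bar>x\<bar>)\<^sup>2 \<le> E \<bar>x\<bar>"
    using assms mu by (simp add: E_def abs_square_le_1)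
  moreover have "E 1 = (gegenbauer l n 1)\<^sup>2" by (simp add: E_def)
  moreover have "\<bar>gegenbauer l n \<bar>x\<bar>\<bar> = \<bar>gegenbauer l n x\<bar>"
    by (cases "x \<ge> 0") (auto simp: gegenbauer_parity abs_mult)
  ultimately show ?thesis by (metis abs_le_square_iff order_trans)
qed simp

section \<open>Sums over the spectrum\<close>

text \<open>The numbers \<open>(1/2)\<^sub>n / n!\<close>, to which \<open>\<bar>v\<^sub>n\<bar>\<^sup>2 / \<kappa>\<^sub>n\<close> is proportional.\<close>

fun wallis :: "nat \<Rightarrow> real" where
  "wallis 0 = 1"
| "wallis (Suc n) = wallis n * (real n + 1/2) / (real n + 1)"

definition rsq :: "nat \<Rightarrow> real" where "rsq n = 1 / sqrt (real n + 1)"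

lemma rsq_pos: "0 < rsq n" by (simp add: rsq_def)

lemma rsq_sq: "(rsq n)\<^sup>2 = 1 / (real n + 1)"
  by (simp add: rsq_def power_divide)

text \<open>Bounding \<open>(n+1)\<^sup>-\<^sup>3\<^sup>/\<^sup>2\<close> by a telescoping difference replaces all integral comparisons below.\<close>

lemma rsq_cube_le: "rsq n ^ 3 \<le> 4 * (rsq n - rsq (Suc n))"
proof -
  define p q where "p = sqrt (real n + 1)" and "q = sqrt (real n + 2)"
  have p: "p > 0" "p\<^sup>2 = real n + 1" and q: "q > 0" "q\<^sup>2 = real n + 2" by (auto simp: p_def q_def)
  have pq: "p \<le> q" by (simp add: p_def q_def)
  have r: "rsq n = 1 / p" "rsq (Suc n) = 1 / q" by (auto simp: rsq_def p_def q_def add_ac)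
  have "(q - p) * (q + p) = 1" using p q by (simp add: algebra_simps power2_eq_square)
  then have "1 / (p * q * (q + p)) = (q - p) * (q + p) / (p * q * (q + p))" by simp
  also have "\<dots> = 1 / p - 1 / q" using p(1) q(1) by (simp add: diff_divide_distrib)
  finally have "1 / p - 1 / q = 1 / (p * q * (q + p))" ..
  moreover have "p * q * (q + p) \<le> p * (2 * q\<^sup>2)" 
    using p(1) q(1) pq mult_left_mono[of p q q] by (simp add: power2_eq_square algebra_simps)
  moreover have "p * (2 * q\<^sup>2) \<le> p * (4 * p\<^sup>2)" unfolding p q using p(1) by (intro mult_left_mono) auto
  moreover have "0 < p * q * (q + p)" using p(1) q(1) by simp
  moreover have "p * (4 * p\<^sup>2) = 4 * p ^ 3" by (simp add: power2_eq_square power3_eq_cube)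
  ultimately have "1 / (4 * p ^ 3) \<le> 1 / p - 1 / q"
    by (simp only:) (rule frac_le, auto)
  then show ?thesis unfolding r by (simp add: power_divide)
qed

lemma sum_rsq_cube: "n0 \<le> N \<Longrightarrow> (\<Sum>n=n0..<N. rsq n ^ 3) \<le> 4 * rsq n0"
proof -
  assume "n0 \<le> N"
  have "(\<Sum>n=n0..<N. rsq n ^ 3) \<le> (\<Sum>n=n0..<N. 4 * (rsq n - rsq (Suc n)))"
    by (intro sum_mono rsq_cube_le)
  also have "\<dots> = 4 * (rsq n0 - rsq N)"
    unfolding sum_distrib_left[symmetric] using sum_Suc_diff'[OF \<open>n0 \<le> N\<close>, of "\<lambda>n. - rsq n"] by simp
  finally show ?thesis using rsq_pos[of N] by simp
qed

lemma sum_rsq: "(\<Sum>n<N. rsq n) \<le> 2 * sqrt (real N)"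
proof (induction N)
  case (Suc N)
  define p q where "p = sqrt (real N)" and "q = sqrt (real N + 1)"
  have p: "p \<ge> 0" "p\<^sup>2 = real N" and q: "q > 0" "q\<^sup>2 = real N + 1" by (auto simp: p_def q_def)
  have "2 * p * q + 1 \<le> 2 * q\<^sup>2"
    using sum_squares_bound[of p q] p q by simp
  then have "1 / q \<le> 2 * q - 2 * p" using q(1) by (simp add: field_simps power2_eq_square)
  then show ?case using Suc by (simp add: rsq_def p_def q_def add_ac)
qed simp

lemma wallis_pos: "0 < wallis n"
  by (induction n) auto

lemma wallis_le: "wallis n \<le> rsq n"
proof (induction n)
  case (Suc n)
  define p q where "p = sqrt (real n + 1)" and "q = sqrt (real n + 2)"
  have p: "p > 0" "p\<^sup>2 = real n + 1" and q: "q > 0" "q\<^sup>2 = real n + 2" by (auto simp: p_def q_def)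
  have "((real n + 1/2) * q)\<^sup>2 \<le> (p ^ 3)\<^sup>2"
  proof -
    have "(p ^ 3)\<^sup>2 = (p\<^sup>2) ^ 3" by (simp add: power2_eq_square power3_eq_cube)
    also have "\<dots> = (real n + 1) ^ 3" by (simp add: p)
    finally have e: "(p ^ 3)\<^sup>2 = (real n + 1) ^ 3" .
    show ?thesis unfolding e power_mult_distrib q by (simp add: power2_eq_square power3_eq_cube algebra_simps)
  qed
  then have "(real n + 1/2) * q \<le> p ^ 3" by (rule power2_le_imp_le) (use p in simp)
  then have *: "(1 / p) * (real n + 1/2) / p\<^sup>2 \<le> 1 / q" using p(1) q(1) 
    by (simp add: field_simps power2_eq_square power3_eq_cube)
  have "wallis (Suc n) \<le> rsq n * (real n + 1/2) / (real n + 1)"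
    using Suc by (auto intro!: divide_right_mono mult_right_mono)
  also have "\<dots> \<le> rsq (Suc n)" using * unfolding p by (simp add: rsq_def p_def q_def add_ac)
  finally show ?case .
qed (simp add: rsq_def)

lemma wallis_diff: "wallis n - wallis (Suc n) \<le> 2 * (rsq n - rsq (Suc n))" "wallis (Suc n) \<le> wallis n"
proof -
  have *: "wallis n - wallis (Suc n) = wallis n / (2 * (real n + 1))" by (simp add: field_simps)
  also have "\<dots> \<le> rsq n / (2 * (real n + 1))" by (intro divide_right_mono wallis_le) auto
  also have "\<dots> = rsq n * (1 / (real n + 1)) / 2" by simp
  also have "\<dots> = rsq n ^ 3 / 2" unfolding rsq_sq[symmetric] by (simp add: power3_eq_cube power2_eq_square)
  also have "\<dots> \<le> 2 * (rsq n - rsq (Suc n))" using rsq_cube_le[of n] by simp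
  finally show "wallis n - wallis (Suc n) \<le> 2 * (rsq n - rsq (Suc n))" .
  have "0 \<le> wallis n / (2 * (real n + 1))" using wallis_pos[of n] by simp
  then show "wallis (Suc n) \<le> wallis n" using * by linarith
qed

lemma wallis_diff_le: "n \<le> m \<Longrightarrow> 0 \<le> wallis n - wallis m \<and> wallis n - wallis m \<le> 2 * (rsq n - rsq m)"
proof (induction m rule: dec_induct)
  case (step k)
  then show ?case using wallis_diff[of k] by (auto simp del: wallis.simps)
qed simp

lemma rsq_diff: "\<bar>rsq n - rsq m\<bar> \<le> \<bar>real n - real m\<bar> * rsq n / (real m + 1)"
proof -
  define p q where "p = sqrt (real n + 1)" and "q = sqrt (real m + 1)"
  have p: "p > 0" "p\<^sup>2 = real n + 1" and q: "q > 0" "q\<^sup>2 = real m + 1" by (auto simp: p_def q_def)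
  have pq: "p * q * (q + p) \<ge> p * q\<^sup>2" using p q by (simp add: algebra_simps power2_eq_square)
  have "1 / p - 1 / q = (q - p) * (q + p) / (p * q * (q + p))" using p(1) q(1) by (simp add: diff_divide_distrib)
  also have "(q - p) * (q + p) = q\<^sup>2 - p\<^sup>2" by (simp add: power2_eq_square algebra_simps)
  finally have "1 / p - 1 / q = (q\<^sup>2 - p\<^sup>2) / (p * q * (q + p))" .
  then have "\<bar>1 / p - 1 / q\<bar> = \<bar>real n - real m\<bar> / (p * q * (q + p))"
    using p q by (simp add: abs_divide abs_mult abs_minus_commute)
  also have "\<dots> \<le> \<bar>real n - real m\<bar> / (p * q\<^sup>2)" using pq p(1) q(1) by (intro divide_left_mono) auto
  finally show ?thesis by (simp add: q rsq_def p_def q_def)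
qed

text \<open>The weights vary slowly: after division by \<open>\<bar>n - m\<bar>\<close>, which in the application is the distance to
  the pole, the variation is still summable over \<open>n \<le> 2m\<close> with a sum of order \<open>m\<^sup>-\<^sup>1\<^sup>/\<^sup>2\<close>.\<close>

lemma wallis_abs_diff: "\<bar>wallis n - wallis m\<bar> \<le> 2 * \<bar>real n - real m\<bar> * rsq n / (real m + 1)"
proof -
  have "\<bar>wallis n - wallis m\<bar> \<le> 2 * \<bar>rsq n - rsq m\<bar>"
    using wallis_diff_le[of n m] wallis_diff_le[of m n] by (cases "n \<le> m") auto
  then show ?thesis using rsq_diff[of n m] by simp
qed

lemma sum_lessThan_split:
  fixes f :: "nat \<Rightarrow> 'a::comm_monoid_add"
  shows "M \<le> N \<Longrightarrow> sum f {..<N} = sum f {..<M} + sum f {M..<N}"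
  by (simp add: sum.atLeastLessThan_concat flip: atLeast0LessThan)

text \<open>The expression \<open>n - m + (m - n)\<close> is \<open>\<bar>n - m\<bar>\<close> in truncated subtraction. Each distance is attained at
  most twice.\<close>

lemma sum_dist_le:
  fixes g :: "nat \<Rightarrow> real"
  assumes g: "\<And>j. 0 \<le> g j" and B: "\<And>J. (\<Sum>j<J. g j) \<le> B"
  shows "(\<Sum>n<N. g (n - m + (m - n))) \<le> 2 * B"
proof -
  have "(\<Sum>n<N. g (n - m + (m - n))) \<le> (\<Sum>n<m+N. g (n - m + (m - n)))"
    using g by (intro sum_mono2) auto
  also have "\<dots> = (\<Sum>n<m. g (n - m + (m - n))) + (\<Sum>n=m..<m+N. g (n - m + (m - n)))"
    by (rule sum_lessThan_split) simp
  also have "(\<Sum>n=m..<m+N. g (n - m + (m - n))) = (\<Sum>j<N. g j)"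
    by (rule sum.reindex_bij_witness[of _ "\<lambda>j. j + m" "\<lambda>n. n - m"]) auto
  also have "(\<Sum>n<m. g (n - m + (m - n))) = (\<Sum>n<m. g (Suc n))"
    by (subst sum.nat_diff_reindex[symmetric]) (auto intro!: sum.cong simp: Suc_diff_Suc)
  also have "\<dots> \<le> (\<Sum>n<Suc m. g n)" using g[of 0] by (simp add: sum.lessThan_Suc_shift del: sum.lessThan_Suc)
  also have "\<dots> \<le> B" by (rule B)
  also have "(\<Sum>n<N. g n) \<le> B" by (rule B)
  finally show ?thesis by simp
qed

text \<open>The bound is uniform in \<open>Q\<close>. Below, \<open>Q\<close> is \<open>1 + \<bar>Im z\<bar>\<close>, and this uniformity is what makes the
  final constants independent of the imaginary part.\<close>

lemma sum_shifted_square: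
  fixes Q :: real
  assumes "1 \<le> Q" shows "(\<Sum>j<J. Q / (Q + real j)\<^sup>2) \<le> 2"
proof -
  have *: "(\<Sum>j<Suc J. Q / (Q + real j)\<^sup>2) \<le> 2 - Q / (Q + real J)" for J
  proof (induction J)
    case 0
    have "Q / Q\<^sup>2 \<le> 1" using assms by (simp add: power2_eq_square)
    then show ?case using assms by simp
  next
    case (Suc J)
    define y where "y = Q + real J"
    have y: "y > 0" using assms by (simp add: y_def)
    have "1 / (y + 1)\<^sup>2 \<le> 1 / (y * (y + 1))"
      using y by (intro divide_left_mono) (auto simp: power2_eq_square)
    also have "1 / (y * (y + 1)) = 1 / y - 1 / (y + 1)" using y by (simp add: field_simps)
    finally have "Q * (1 / (y + 1)\<^sup>2) \<le> Q * (1 / y - 1 / (y + 1))" using assms by (intro mult_left_mono) auto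
    then have "Q / (y + 1)\<^sup>2 \<le> Q / y - Q / (y + 1)" by (simp add: right_diff_distrib)
    then show ?case using Suc by (simp add: y_def add_ac)
  qed
  show ?thesis
  proof (cases J)
    case (Suc k)
    have "0 \<le> Q / (Q + real k)" using assms by simp
    then show ?thesis using *[of k] unfolding Suc by linarith
  qed simp
qed

text \<open>An admissible \<open>\<tau>\<close> together with \<open>m = \<lfloor>\<tau>/2\<rfloor>\<close>, for which \<open>\<kappa>\<^sub>m\<close> is within \<open>3/2\<close> of \<open>\<tau>\<close>.\<close>

locale admissible_shift =
  fixes \<tau> \<delta> :: real and m :: nat
  assumes delta: "0 < \<delta>" "\<delta> < 1/4" and tau: "2 \<le> \<tau>"
    and dist: "\<And>n. \<delta> \<le> \<bar>\<tau> - kappa n\<bar>"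
    and m: "2 * real m \<le> \<tau>" "\<tau> < 2 * real m + 2"
begin

definition offset :: "nat \<Rightarrow> nat" where "offset n = n - m + (m - n)"

lemma offset: "real (offset n) = \<bar>real n - real m\<bar>" by (auto simp: offset_def)

lemma kappa_dist: "\<delta> * (1 + real (offset n)) \<le> \<bar>\<tau> - kappa n\<bar>"
proof (cases "offset n = 0")
  case True
  then show ?thesis using dist[of n] by simp
next
  case False
  then have 1: "1 \<le> real (offset n)" by simp
  have "2 * real (offset n) - 3/2 \<le> \<bar>\<tau> - kappa n\<bar>" 
  proof (cases "m \<le> n")
    case True
    then have "2 * real (offset n) - 3/2 \<le> - (\<tau> - kappa n)" unfolding offset kappa_def using m by simp
    then show ?thesis using abs_ge_minus_self order_trans by blast
  next
    case False
    then have "2 * real (offset n) - 3/2 \<le> \<tau> - kappa n" unfolding offset kappa_def using m by simp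
    then show ?thesis using abs_ge_self order_trans by blast
  qed
  moreover have "\<delta> * (1 + real (offset n)) \<le> 1/4 * (1 + real (offset n))" using delta by (intro mult_right_mono) auto
  ultimately show ?thesis using 1 by argo
qed

lemma rsq_offset: "rsq (offset n) ^ 2 = 1 / (1 + real (offset n))" by (simp add: rsq_sq add_ac)

lemma sum_rsq_offset: "(\<Sum>n<N. rsq (offset n) ^ 3) \<le> 8"
proof -
  have "(\<Sum>j<J. rsq j ^ 3) \<le> 4" for J using sum_rsq_cube[of 0 J] by (simp add: atLeast0LessThan rsq_def)
  from sum_dist_le[of "\<lambda>j. rsq j ^ 3", OF _ this] show ?thesis
    using rsq_pos by (simp add: offset_def less_imp_le)
qed

text \<open>From \<open>\<kappa>\<^sub>n \<le> \<tau> + \<bar>\<tau> - \<kappa>\<^sub>n\<bar>\<close> the root of \<open>\<kappa>\<^sub>n\<close> is at most the sum of two roots. Both resulting sums are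
  bounded by multiples of \<open>\<Sum>\<^sub>n (1 + \<bar>n - m\<bar>)\<^sup>-\<^sup>3\<^sup>/\<^sup>2\<close>.\<close>

lemma sum_sqrt_kappa: "(\<Sum>n<N. sqrt (kappa n) / (\<tau> - kappa n)\<^sup>2) \<le> 16 / \<delta>\<^sup>2 * sqrt \<tau>"
proof -
  have "sqrt (kappa n) / (\<tau> - kappa n)\<^sup>2 \<le> 2 / \<delta>\<^sup>2 * sqrt \<tau> * rsq (offset n) ^ 3" for n
  proof -
    define E where "E = \<bar>\<tau> - kappa n\<bar>"
    define x where "x = rsq (offset n)"
    have x: "0 < x" "x \<le> 1" using rsq_pos by (auto simp: x_def rsq_def)
    have E: "E > 0" using dist[of n] delta by (simp add: E_def)
    have "1 / x\<^sup>2 = 1 + real (offset n)" using rsq_offset[of n] by (simp add: x_def)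
    then have "\<delta> / x\<^sup>2 \<le> E" using kappa_dist[of n] unfolding E_def by (metis times_divide_eq_right mult.right_neutral)
    then have E1: "1 / E \<le> x\<^sup>2 / \<delta>" using E x delta by (simp add: field_simps)
    have E12: "sqrt (1 / E) \<le> x / \<delta>"
    proof (rule real_le_lsqrt)
      have "1 / \<delta> \<le> 1 / \<delta>\<^sup>2" using delta by (simp add: field_simps power2_eq_square)
      then have "x\<^sup>2 / \<delta> \<le> x\<^sup>2 / \<delta>\<^sup>2" using x mult_left_mono[of "1/\<delta>" "1/\<delta>\<^sup>2" "x\<^sup>2"] by simp
      then show "1 / E \<le> (x / \<delta>)\<^sup>2" using E1 by (simp add: power_divide)
    qed (use E x delta in auto)
    have "kappa n \<le> \<tau> + E" by (auto simp: E_def)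
    then have "sqrt (kappa n) \<le> sqrt (\<tau> + E)" by simp
    also have "\<dots> \<le> sqrt \<tau> + sqrt E" using tau E by (intro sqrt_add_le_add_sqrt) auto
    also have "\<dots> \<le> sqrt \<tau> + sqrt \<tau> * sqrt E" using tau E by simp
    finally have "sqrt (kappa n) \<le> sqrt \<tau> * (1 + sqrt E)" by (simp add: distrib_left)
    then have "sqrt (kappa n) / (\<tau> - kappa n)\<^sup>2 \<le> sqrt \<tau> * (1 + sqrt E) / E\<^sup>2"
      unfolding E_def power2_abs by (rule divide_right_mono) simp
    also have "\<dots> = sqrt \<tau> * ((1 / E) * (1 / E) + (1 / E) * sqrt (1 / E))"
    proof -
      have "sqrt (1 / E) = sqrt E / E" using E by (simp add: real_sqrt_divide real_div_sqrt field_simps)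
      then show ?thesis using E by (simp add: power2_eq_square field_simps)
    qed
    also have "\<dots> \<le> sqrt \<tau> * ((x\<^sup>2 / \<delta>) * (x / \<delta>) + (x\<^sup>2 / \<delta>) * (x / \<delta>))"
    proof -
      have "1 / E \<le> x / \<delta>" 
      proof -
        have "x\<^sup>2 / \<delta> \<le> x / \<delta>" using x delta by (intro divide_right_mono) (auto simp: power2_eq_square mult_le_cancel_left1)
        then show ?thesis using E1 by linarith
      qed
      then show ?thesis using tau E E1 E12 x delta
        by (intro mult_left_mono add_mono mult_mono) auto
    qed
    also have "\<dots> = 2 / \<delta>\<^sup>2 * sqrt \<tau> * x ^ 3" by (simp add: power2_eq_square power3_eq_cube)
    finally show ?thesis by (simp add: x_def)
  qed
  then have "(\<Sum>n<N. sqrt (kappa n) / (\<tau> - kappa n)\<^sup>2) \<le> (\<Sum>n<N. 2 / \<delta>\<^sup>2 * sqrt \<tau> * rsq (offset n) ^ 3)"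
    by (intro sum_mono)
  also have "\<dots> = 2 / \<delta>\<^sup>2 * sqrt \<tau> * (\<Sum>n<N. rsq (offset n) ^ 3)" by (rule sum_distrib_left[symmetric])
  also have "\<dots> \<le> 2 / \<delta>\<^sup>2 * sqrt \<tau> * 8" using tau by (intro mult_left_mono sum_rsq_offset) auto
  finally show ?thesis by simp
qed

lemma rsq_m: "rsq m \<le> 2 / sqrt \<tau>"
proof -
  have "sqrt \<tau> \<le> sqrt (4 * (real m + 1))" using m by (intro real_sqrt_le_mono) auto
  then have "sqrt \<tau> \<le> 2 * sqrt (real m + 1)" by (simp only: real_sqrt_mult real_sqrt_four)
  then show ?thesis using tau by (simp add: rsq_def field_simps)
qed

lemma rsq_2m: "rsq (2 * m + 1) \<le> 1 / sqrt \<tau>"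
  using m tau by (auto simp: rsq_def intro!: divide_left_mono)

lemma sum_rsq_2m: "(\<Sum>n<2*m+1. rsq n) \<le> 4 * sqrt \<tau>"
proof -
  have "real (2 * m + 1) \<le> 4 * \<tau>" using m tau by simp
  then have "sqrt (real (2 * m + 1)) \<le> sqrt (4 * \<tau>)" by (rule real_sqrt_le_mono)
  then show ?thesis using sum_rsq[of "2*m+1"] by (simp add: real_sqrt_mult)
qed

context
  fixes \<xi> :: real and z :: complex
  assumes z: "z = Complex \<tau> \<xi>"
begin

lemma z_minus_kappa: "\<bar>\<tau> - kappa n\<bar> \<le> cmod (z - kappa n)"
  using abs_Re_le_cmod[of "z - kappa n"] by (simp add: z)

lemma z_plus_kappa: "\<tau> + kappa n \<le> cmod (z + kappa n)"
  using complex_Re_le_cmod[of "z + kappa n"] by (simp add: z)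

lemma z_dist: "\<delta> * (1 + real (offset n)) \<le> cmod (z - kappa n)"
  using kappa_dist z_minus_kappa order_trans by blast

lemma z_minus_kappa_ne: "z - kappa n \<noteq> 0" and z_plus_kappa_ne: "z + kappa n \<noteq> 0"
proof -
  have "0 < \<delta> * (1 + real (offset n))" using delta by simp
  then have "0 < cmod (z - kappa n)" using z_dist[of n] by linarith
  then show "z - kappa n \<noteq> 0" by simp
  have "0 < \<tau> + kappa n" using tau by (simp add: kappa_def)
  then have "0 < cmod (z + kappa n)" using z_plus_kappa[of n] by linarith
  then show "z + kappa n \<noteq> 0" by simp
qed

lemma z_dist2: "\<delta> / 2 * ((1 + \<bar>\<xi>\<bar>) + real (offset n)) \<le> cmod (z - kappa n)"
proof -
  have "\<bar>\<xi>\<bar> \<le> cmod (z - kappa n)" using abs_Im_le_cmod[of "z - kappa n"] by (simp add: z)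
  moreover have "\<delta> * \<bar>\<xi>\<bar> \<le> 1 * \<bar>\<xi>\<bar>" using delta by (intro mult_right_mono) auto
  ultimately show ?thesis using z_dist[of n] by (simp add: algebra_simps)
qed

text \<open>The poles are symmetric about \<open>\<kappa>\<^sub>m\<close>. With \<open>w = z - \<kappa>\<^sub>m\<close> and \<open>j = n - m\<close>, the terms \<open>n\<close> and \<open>2m - n\<close> add up
  to \<open>2w / (w\<^sup>2 - 4j\<^sup>2)\<close>, which is summable in \<open>j\<close>, whereas each of them alone is of order \<open>1/j\<close>.\<close>

lemma symmetric_sum_bound:
  assumes e: "\<And>n. n \<le> 2 * m \<Longrightarrow> e (2 * m - n) = e n" and e1: "\<And>n. cmod (e n) \<le> 1"
  shows "cmod (\<Sum>n<2*m+1. e n / (z - kappa n)) \<le> 32 / \<delta>\<^sup>2"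
proof -
  define Q where "Q = 1 + \<bar>\<xi>\<bar>"
  define w where "w = z - kappa m"
  define S where "S = (\<Sum>n<2*m+1. e n / (z - kappa n))"
  have Q: "1 \<le> Q" by (simp add: Q_def)
  have w: "cmod w \<le> 2 * Q"
  proof -
    have "cmod w \<le> \<bar>Re w\<bar> + \<bar>Im w\<bar>" by (rule cmod_le)
    also have "Re w = \<tau> - (2 * real m + 1/2)" by (simp add: w_def z kappa_def)
    also have "\<bar>\<tau> - (2 * real m + 1/2)\<bar> \<le> 3/2" using m by arith
    finally show ?thesis by (simp add: Q_def w_def z)
  qed
  \<comment> \<open>reversing the order of summation\<close>
  have refl: "S = (\<Sum>n<2*m+1. e n / (z - kappa (2 * m - n)))"
    unfolding S_def using e
    by (subst sum.nat_diff_reindex[symmetric]) (auto intro!: sum.cong)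
  have pair: "cmod (e n / (z - kappa n) + e n / (z - kappa (2 * m - n))) \<le> 16 / \<delta>\<^sup>2 * (Q / (Q + real (offset n))\<^sup>2)"
    if n: "n \<le> 2 * m" for n
  proof -
    have s: "(z - kappa n) + (z - kappa (2 * m - n)) = 2 * w"
      using n by (simp add: w_def kappa_def of_nat_diff)
    have "e n / (z - kappa n) + e n / (z - kappa (2 * m - n)) =
        e n * ((z - kappa n) + (z - kappa (2 * m - n))) / ((z - kappa n) * (z - kappa (2 * m - n)))"
      using z_minus_kappa_ne[of n] z_minus_kappa_ne[of "2 * m - n"] by (simp add: field_simps)
    then have "cmod (e n / (z - kappa n) + e n / (z - kappa (2 * m - n))) =
        cmod (e n) * (2 * cmod w) / (cmod (z - kappa n) * cmod (z - kappa (2 * m - n)))"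
      unfolding s by (simp add: norm_mult norm_divide)
    also have "\<dots> \<le> 1 * (2 * (2 * Q)) / ((\<delta> / 2 * (Q + real (offset n))) * (\<delta> / 2 * (Q + real (offset n))))"
    proof (intro frac_le mult_mono w e1)
      have "offset (2 * m - n) = offset n" using n by (auto simp: offset_def)
      then show "\<delta> / 2 * (Q + real (offset n)) \<le> cmod (z - kappa (2 * m - n))"
        using z_dist2[of "2 * m - n"] by (simp add: Q_def)
      show "\<delta> / 2 * (Q + real (offset n)) \<le> cmod (z - kappa n)"
        using z_dist2[of n] by (simp add: Q_def)
    qed (use Q delta in \<open>auto intro!: mult_nonneg_nonneg\<close>)
    also have "\<dots> = 16 / \<delta>\<^sup>2 * (Q / (Q + real (offset n))\<^sup>2)"
      using delta Q by (simp add: power2_eq_square field_simps)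
    finally show ?thesis .
  qed
  have "2 * S = (\<Sum>n<2*m+1. e n / (z - kappa n) + e n / (z - kappa (2 * m - n)))"
    using refl by (simp add: sum.distrib S_def)
  then have "2 * cmod S \<le> (\<Sum>n<2*m+1. 16 / \<delta>\<^sup>2 * (Q / (Q + real (offset n))\<^sup>2))"
    using pair by (metis (no_types, lifting) norm_mult norm_numeral sum_norm_le less_Suc_eq_le Suc_eq_plus1 lessThan_iff)
  also have "\<dots> = 16 / \<delta>\<^sup>2 * (\<Sum>n<2*m+1. Q / (Q + real (offset n))\<^sup>2)" by (rule sum_distrib_left[symmetric])
  also have "\<dots> \<le> 16 / \<delta>\<^sup>2 * (2 * 2)"
  proof (intro mult_left_mono)
    show "(\<Sum>n<2*m+1. Q / (Q + real (offset n))\<^sup>2) \<le> 2 * 2"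
      unfolding offset_def by (rule sum_dist_le[OF _ sum_shifted_square[OF Q]]) (use Q in simp)
  qed simp
  finally show ?thesis by (simp add: S_def)
qed

text \<open>Three contributions of order \<open>\<tau>\<^sup>-\<^sup>1\<^sup>/\<^sup>2\<close>: the tail \<open>n > 2m\<close>, the error of freezing the weight at \<open>m\<close>,
  and the frozen sum, where \<open>b\<^sub>m\<close> has this order and the sum of the poles is bounded.\<close>

lemma pole_sum_bound:
  assumes e: "\<And>n. n \<le> 2 * m \<Longrightarrow> e (2 * m - n) = e n" and e1: "\<And>n. cmod (e n) \<le> 1" and N: "2 * m + 1 \<le> N"
  shows "cmod (\<Sum>n<N. e n * wallis n / (z - kappa n)) \<le> 100 / \<delta>\<^sup>2 / sqrt \<tau>"
proof -
  have dd: "\<delta>\<^sup>2 \<le> \<delta>" using delta by (simp add: power2_eq_square)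
  have D: "1 / \<delta> \<le> 1 / \<delta>\<^sup>2" using delta dd by (intro divide_left_mono) auto
  have st: "sqrt \<tau> > 0" using tau by simp
  have far: "cmod (\<Sum>n=2*m+1..<N. e n * wallis n / (z - kappa n)) \<le> 8 / \<delta> / sqrt \<tau>"
  proof -
    have "cmod (e n * wallis n / (z - kappa n)) \<le> 2 / \<delta> * rsq n ^ 3" if "2 * m + 1 \<le> n" for n
    proof -
      have "real n + 1 \<le> 2 * (1 + real (offset n))" using that by (simp add: offset)
      then have "\<delta> * (real n + 1) \<le> 2 * (\<delta> * (1 + real (offset n)))"
        using delta mult_left_mono[of "real n + 1" "2 * (1 + real (offset n))" \<delta>] by simp
      then have z1: "\<delta> * (real n + 1) / 2 \<le> cmod (z - kappa n)" using z_dist[of n] by linarith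
      have "cmod (e n * wallis n / (z - kappa n)) = cmod (e n) * wallis n / cmod (z - kappa n)"
        using wallis_pos[of n] by (simp add: norm_mult norm_divide)
      also have "\<dots> \<le> 1 * rsq n / (\<delta> * (real n + 1) / 2)"
        using z1 e1[of n] wallis_le[of n] wallis_pos[of n] rsq_pos[of n] delta by (intro frac_le mult_mono) auto
      also have "\<dots> = 2 / \<delta> * (rsq n * (1 / (real n + 1)))" using delta by (simp add: field_simps)
      also have "\<dots> = 2 / \<delta> * rsq n ^ 3" unfolding rsq_sq[symmetric] by (simp add: power2_eq_square power3_eq_cube)
      finally show ?thesis .
    qed
    then have "cmod (\<Sum>n=2*m+1..<N. e n * wallis n / (z - kappa n)) \<le> (\<Sum>n=2*m+1..<N. 2 / \<delta> * rsq n ^ 3)"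
      by (intro sum_norm_le) auto
    also have "\<dots> = 2 / \<delta> * (\<Sum>n=2*m+1..<N. rsq n ^ 3)" by (rule sum_distrib_left[symmetric])
    also have "\<dots> \<le> 2 / \<delta> * (4 * (1 / sqrt \<tau>))"
      using sum_rsq_cube[OF N] rsq_2m delta by (intro mult_left_mono) auto
    finally show ?thesis by simp
  qed
  have near: "cmod (\<Sum>n<2*m+1. e n * (wallis n - wallis m) / (z - kappa n)) \<le> 16 / \<delta> / sqrt \<tau>"
  proof -
    have "cmod (e n * (wallis n - wallis m) / (z - kappa n)) \<le> 2 / \<delta> / (real m + 1) * rsq n" for n
    proof -
      have "cmod (e n * (wallis n - wallis m) / (z - kappa n)) = cmod (e n) * \<bar>wallis n - wallis m\<bar> / cmod (z - kappa n)"
        by (simp add: norm_mult norm_divide flip: of_real_diff)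
      also have "\<dots> \<le> 1 * (2 * real (offset n) * rsq n / (real m + 1)) / (\<delta> * (1 + real (offset n)))"
        using wallis_abs_diff[of n m] e1[of n] z_dist[of n] delta rsq_pos[of n]
        by (intro frac_le mult_mono) (auto simp: offset)
      also have "\<dots> = 2 / \<delta> / (real m + 1) * rsq n * (real (offset n) / (1 + real (offset n)))"
        using delta by (simp add: field_simps)
      also have "\<dots> \<le> 2 / \<delta> / (real m + 1) * rsq n * 1"
        using delta rsq_pos[of n] by (intro mult_left_mono) auto
      finally show ?thesis by simp
    qed
    then have "cmod (\<Sum>n<2*m+1. e n * (wallis n - wallis m) / (z - kappa n)) \<le> (\<Sum>n<2*m+1. 2 / \<delta> / (real m + 1) * rsq n)"
      by (intro sum_norm_le)
    also have "\<dots> = 2 / \<delta> / (real m + 1) * (\<Sum>n<2*m+1. rsq n)" by (rule sum_distrib_left[symmetric])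
    also have "\<dots> \<le> 2 / \<delta> / (\<tau> / 2) * (4 * sqrt \<tau>)"
      using sum_rsq_2m m tau delta rsq_pos by (intro mult_mono divide_left_mono sum_nonneg) (auto simp: less_imp_le)
    also have "\<dots> = 16 / \<delta> / sqrt \<tau>" using delta tau by (simp add: field_simps)
    finally show ?thesis .
  qed
  have mid: "cmod (wallis m * (\<Sum>n<2*m+1. e n / (z - kappa n))) \<le> 64 / \<delta>\<^sup>2 / sqrt \<tau>"
  proof -
    have "cmod (wallis m * (\<Sum>n<2*m+1. e n / (z - kappa n))) \<le> (2 / sqrt \<tau>) * (32 / \<delta>\<^sup>2)"
      unfolding norm_mult using symmetric_sum_bound[of e, OF e e1] wallis_le[of m] rsq_m wallis_pos[of m] tau
      by (intro mult_mono) auto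
    also have "(2 / sqrt \<tau>) * (32 / \<delta>\<^sup>2) = 64 / \<delta>\<^sup>2 / sqrt \<tau>" by simp
    finally show ?thesis .
  qed
  have "(\<Sum>n<N. e n * wallis n / (z - kappa n)) =
      (\<Sum>n<2*m+1. e n * wallis n / (z - kappa n)) + (\<Sum>n=2*m+1..<N. e n * wallis n / (z - kappa n))"
    by (rule sum_lessThan_split[OF N])
  also have "(\<Sum>n<2*m+1. e n * wallis n / (z - kappa n)) =
      (\<Sum>n<2*m+1. e n * (wallis n - wallis m) / (z - kappa n)) + wallis m * (\<Sum>n<2*m+1. e n / (z - kappa n))"
    by (simp only: sum_distrib_left sum.distrib[symmetric]) (auto intro!: sum.cong simp: diff_divide_distrib algebra_simps)
  finally have eq: "(\<Sum>n<N. e n * wallis n / (z - kappa n)) =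
      (\<Sum>n<2*m+1. e n * (wallis n - wallis m) / (z - kappa n)) + wallis m * (\<Sum>n<2*m+1. e n / (z - kappa n))
      + (\<Sum>n=2*m+1..<N. e n * wallis n / (z - kappa n))" .
  have "cmod (\<Sum>n<N. e n * wallis n / (z - kappa n)) \<le> 16 / \<delta> / sqrt \<tau> + 64 / \<delta>\<^sup>2 / sqrt \<tau> + 8 / \<delta> / sqrt \<tau>"
    unfolding eq by (intro norm_triangle_mono near mid far)
  also have "\<dots> = (24 * (1 / \<delta>) + 64 * (1 / \<delta>\<^sup>2)) / sqrt \<tau>" by (simp add: add_divide_distrib)
  also have "\<dots> \<le> (100 / \<delta>\<^sup>2) / sqrt \<tau>" 
  proof (rule divide_right_mono)
    have "24 * (1 / \<delta>) + 64 * (1 / \<delta>\<^sup>2) \<le> 100 * (1 / \<delta>\<^sup>2)"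
      using D zero_le_divide_1_iff[of "\<delta>\<^sup>2"] zero_le_power2[of \<delta>] by linarith
    then show "24 * (1 / \<delta>) + 64 * (1 / \<delta>\<^sup>2) \<le> 100 / \<delta>\<^sup>2" by simp
  qed (use st in simp)
  finally show ?thesis .
qed

lemma plus_sum_bound:
  assumes e1: "\<And>n. cmod (e n) \<le> 1" and N: "2 * m + 1 \<le> N"
  shows "cmod (\<Sum>n<N. e n * wallis n / (z + kappa n)) \<le> 12 / sqrt \<tau>"
proof -
  have t: "cmod (e n * wallis n / (z + kappa n)) \<le> rsq n / (\<tau> + kappa n)" for n
  proof -
    have "cmod (e n * wallis n / (z + kappa n)) = cmod (e n) * wallis n / cmod (z + kappa n)"
      using wallis_pos[of n] by (simp add: norm_mult norm_divide)
    also have "\<dots> \<le> 1 * rsq n / (\<tau> + kappa n)"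
      using e1[of n] wallis_le[of n] wallis_pos[of n] z_plus_kappa[of n] tau
      by (intro frac_le mult_mono) (auto simp: kappa_def)
    finally show ?thesis by simp
  qed
  have "cmod (\<Sum>n<N. e n * wallis n / (z + kappa n)) \<le> (\<Sum>n<N. rsq n / (\<tau> + kappa n))"
    by (intro sum_norm_le t)
  also have "\<dots> = (\<Sum>n<2*m+1. rsq n / (\<tau> + kappa n)) + (\<Sum>n=2*m+1..<N. rsq n / (\<tau> + kappa n))"
    by (rule sum_lessThan_split[OF N])
  also have "(\<Sum>n<2*m+1. rsq n / (\<tau> + kappa n)) \<le> (\<Sum>n<2*m+1. 1 / \<tau> * rsq n)"
  proof (rule sum_mono)
    fix n
    show "rsq n / (\<tau> + kappa n) \<le> 1 / \<tau> * rsq n"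
      using rsq_pos[of n] tau by (simp add: frac_le kappa_def)
  qed
  also have "\<dots> = 1 / \<tau> * (\<Sum>n<2*m+1. rsq n)" by (rule sum_distrib_left[symmetric])
  also have "\<dots> \<le> 1 / \<tau> * (4 * sqrt \<tau>)" using sum_rsq_2m tau by (intro mult_left_mono) auto
  also have "\<dots> = 4 / sqrt \<tau>" using tau by (simp add: field_simps)
  also have "(\<Sum>n=2*m+1..<N. rsq n / (\<tau> + kappa n)) \<le> (\<Sum>n=2*m+1..<N. 2 * rsq n ^ 3)"
  proof (rule sum_mono)
    fix n
    have "rsq n / (\<tau> + kappa n) \<le> rsq n / ((real n + 1) / 2)"
      using rsq_pos[of n] tau by (intro divide_left_mono) (auto simp: kappa_def)
    also have "\<dots> = 2 * (rsq n * (1 / (real n + 1)))" by simp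
    also have "\<dots> = 2 * rsq n ^ 3" unfolding rsq_sq[symmetric] by (simp add: power2_eq_square power3_eq_cube)
    finally show "rsq n / (\<tau> + kappa n) \<le> 2 * rsq n ^ 3" .
  qed
  also have "\<dots> = 2 * (\<Sum>n=2*m+1..<N. rsq n ^ 3)" by (rule sum_distrib_left[symmetric])
  also have "\<dots> \<le> 2 * (4 * (1 / sqrt \<tau>))" using sum_rsq_cube[OF N] rsq_2m by simp
  finally show ?thesis by simp
qed

lemma resolvent_sum_bound:
  assumes e: "\<And>n. n \<le> 2 * m \<Longrightarrow> e (2 * m - n) = e n" and e1: "\<And>n. cmod (e n) \<le> 1" and N: "2 * m + 1 \<le> N"
  shows "cmod (\<Sum>n<N. e n * (2 * kappa n * wallis n) / (z\<^sup>2 - (kappa n)\<^sup>2)) \<le> 112 / \<delta>\<^sup>2 / sqrt \<tau>"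
proof -
  have "e n * (2 * kappa n * wallis n) / (z\<^sup>2 - (kappa n)\<^sup>2) =
      e n * wallis n / (z - kappa n) - e n * wallis n / (z + kappa n)" for n
  proof -
    have "z\<^sup>2 - (complex_of_real (kappa n))\<^sup>2 = (z - kappa n) * (z + kappa n)" by (simp add: power2_eq_square algebra_simps)
    then show ?thesis using z_minus_kappa_ne[of n] z_plus_kappa_ne[of n] by (simp add: field_simps)
  qed
  then have "cmod (\<Sum>n<N. e n * (2 * kappa n * wallis n) / (z\<^sup>2 - (kappa n)\<^sup>2)) \<le> 100 / \<delta>\<^sup>2 / sqrt \<tau> + 12 / sqrt \<tau>"
    using pole_sum_bound[of e N, OF e e1 N] plus_sum_bound[of e N, OF e1 N]
    by (simp add: sum_subtractf norm_triangle_le_diff)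
  also have "\<dots> \<le> 112 / \<delta>\<^sup>2 / sqrt \<tau>"
  proof -
    have "\<delta>\<^sup>2 \<le> 1" using delta by (simp add: power_le_one)
    then have "12 \<le> 12 / \<delta>\<^sup>2" using delta by (simp add: field_simps)
    then have "(100 / \<delta>\<^sup>2 + 12) / sqrt \<tau> \<le> (112 / \<delta>\<^sup>2) / sqrt \<tau>" using tau by (intro divide_right_mono) auto
    then show ?thesis by (simp add: add_divide_distrib)
  qed
  finally show ?thesis .
qed

end

end

section \<open>Weak derivatives and the form domain\<close>

lemma test_functionsE:
  assumes "\<psi> \<in> test_functions"
  obtains a b where "0 < a" "a < b" "b < pi" "\<And>x. x \<notin> {a..b} \<Longrightarrow> \<psi> x = 0" "\<And>x. x \<notin> {a..b} \<Longrightarrow> deriv \<psi> x = 0"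
    "\<And>x. (\<psi> has_real_derivative deriv \<psi> x) (at x)" "continuous_on UNIV \<psi>" "continuous_on UNIV (deriv \<psi>)"
proof -
  have s: "(deriv ^^ k) \<psi> differentiable (at x)" for k x using assms by (auto simp: test_functions_def)
  obtain a b where ab: "0 < a" "a < b" "b < pi" and z: "\<And>x. x \<notin> {a..b} \<Longrightarrow> \<psi> x = 0"
    using assms by (auto simp: test_functions_def)
  have d: "(\<psi> has_real_derivative deriv \<psi> x) (at x)" for x
    using s[of 0 x] by (auto simp: real_differentiable_def DERIV_imp_deriv)
  have c1: "continuous_on UNIV \<psi>"
    using s[of 0] by (auto intro!: differentiable_imp_continuous_on simp: differentiable_on_def differentiable_at_withinI)
  have c2: "continuous_on UNIV (deriv \<psi>)"
    using s[of 1] by (auto intro!: differentiable_imp_continuous_on simp: differentiable_on_def differentiable_at_withinI)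
  have dz: "deriv \<psi> x = 0" if "x \<notin> {a..b}" for x
  proof -
    have "((\<lambda>x. 0) has_real_derivative 0) (at x)" by simp
    then have "(\<psi> has_real_derivative 0) (at x)"
      by (rule has_field_derivative_transform_within_open[where S="- {a..b}"]) (use that z in auto)
    then show ?thesis by (rule DERIV_imp_deriv)
  qed
  show ?thesis by (rule that[OF ab z dz d c1 c2])
qed

definition compact_cont :: "(real \<Rightarrow> real) \<Rightarrow> bool" where
  "compact_cont u \<longleftrightarrow> continuous_on UNIV u \<and> (\<exists>a b. 0 < a \<and> a < b \<and> b < pi \<and> (\<forall>x. x \<notin> {a..b} \<longrightarrow> u x = 0))"

lemma test_compact_cont:
  assumes "\<psi> \<in> test_functions" shows "compact_cont \<psi>" "compact_cont (deriv \<psi>)"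
  using test_functionsE[OF assms] unfolding compact_cont_def by metis+

text \<open>An integral against \<open>u\<close> is a weighted inner product with \<open>u / \<omega>\<close>. In this form weak differentiability
  is a family of equations between inner products and passes to limits in norm.\<close>

definition over_weight :: "(real \<Rightarrow> real) \<Rightarrow> real \<Rightarrow> complex" where
  "over_weight u x = complex_of_real (u x / weight x)"

lemma continuous_on_weight: "continuous_on S weight"
  unfolding weight_def[abs_def] by (intro continuous_intros)

lemma over_weight_H:
  assumes "compact_cont u" shows "over_weight u \<in> H_space"
proof -
  obtain a b where ab: "0 < a" "a < b" "b < pi" and z: "\<And>x. x \<notin> {a..b} \<Longrightarrow> u x = 0" and c: "continuous_on UNIV u"
    using assms by (auto simp: compact_cont_def)
  have w: "weight x \<noteq> 0" if "x \<in> {a..b}" for x using weight_pos[of x] that ab by auto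
  have "continuous_on {a..b} (\<lambda>x. u x / weight x)"
    using w by (intro continuous_intros continuous_on_weight continuous_on_subset[OF c]) auto
  then have "compact ((\<lambda>x. u x / weight x) ` {a..b})" by (intro compact_continuous_image) auto
  then have "bounded ((\<lambda>x. u x / weight x) ` {a..b})" by (rule compact_imp_bounded)
  then obtain B where "\<forall>x\<in>{a..b}. \<bar>u x / weight x\<bar> \<le> B" by (auto simp: bounded_iff)
  then have B: "\<bar>u x / weight x\<bar> \<le> max B 0" for x
    using z[of x] by (cases "x \<in> {a..b}") (auto intro: max.coboundedI1)
  have [measurable]: "u \<in> borel_measurable borel" using c by (rule borel_measurable_continuous_onI)
  show ?thesis
  proof (rule H_space_bounded)
    show "over_weight u \<in> borel_measurable Mw" unfolding borel_measurable_Mw over_weight_def[abs_def]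
      by (rule measurable_restrict_borel) measurable
    show "cmod (over_weight u x) \<le> max B 0" for x unfolding over_weight_def norm_of_real by (rule B)
  qed
qed

lemma H_inner_over_weight:
  assumes "f \<in> H_space" "compact_cont u"
  shows "H_inner f (over_weight u) = (LINT x:{0<..<pi}|lborel. f x * complex_of_real (u x))"
proof -
  have "(\<lambda>x. f x * cnj (over_weight u x)) \<in> borel_measurable Mw"
    by (rule borel_measurable_integrable[OF H_inner_integrable[OF assms(1) over_weight_H[OF assms(2)]]])
  then have "H_inner f (over_weight u) = (LINT x:{0<..<pi}|lborel. weight x *\<^sub>R (f x * cnj (over_weight u x)))"
    unfolding H_inner_def borel_measurable_Mw by (rule integral_Mw)
  also have "\<dots> = (LINT x:{0<..<pi}|lborel. f x * complex_of_real (u x))"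
  proof (rule set_lebesgue_integral_cong)
    show "\<forall>x. x \<in> {0<..<pi} \<longrightarrow> weight x *\<^sub>R (f x * cnj (over_weight u x)) = f x * complex_of_real (u x)"
      using weight_pos by (force simp: over_weight_def scaleR_conv_of_real)
  qed simp
  finally show ?thesis .
qed

lemma is_weak_deriv_iff:
  assumes "f \<in> H_space" "g \<in> H_space"
  shows "is_weak_deriv f g \<longleftrightarrow>
    (\<forall>\<psi>\<in>test_functions. H_inner f (over_weight (deriv \<psi>)) = - H_inner g (over_weight \<psi>))"
  unfolding is_weak_deriv_def using assms by (auto simp: H_inner_over_weight test_compact_cont)

lemma measurable_indicator_restrict:
  fixes g :: "real \<Rightarrow> complex"
  assumes "g \<in> borel_measurable (restrict_space lborel {0<..<pi})" "A \<in> sets borel" "A \<subseteq> {0<..<pi}"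
  shows "(\<lambda>x. indicator A x *\<^sub>R g x) \<in> borel_measurable lborel"
proof -
  have "(\<lambda>x. indicator {0<..<pi} x *\<^sub>R g x) \<in> borel_measurable lborel"
    using assms(1) by (subst (asm) borel_measurable_restrict_space_iff) auto
  then have "(\<lambda>x. indicator A x *\<^sub>R (indicator {0<..<pi} x *\<^sub>R g x)) \<in> borel_measurable lborel"
    using assms(2) by measurable
  also have "(\<lambda>x. indicator A x *\<^sub>R (indicator {0<..<pi} x *\<^sub>R g x)) = (\<lambda>x. indicator A x *\<^sub>R g x)"
    using assms(3) by (auto simp: indicator_def fun_eq_iff)
  finally show ?thesis .
qed

lemma L2_loc_integrable:
  assumes "g \<in> L2_loc" "0 < a" "a < b" "b < pi"
  shows "set_integrable lborel {a..b} g"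
  unfolding set_integrable_def
proof (rule Bochner_Integration.integrable_bound)
  have "integrable lborel (\<lambda>x. indicator {a..b} x *\<^sub>R (cmod (g x))\<^sup>2)"
    using assms by (auto simp: L2_loc_def set_integrable_def)
  moreover have "integrable lborel (indicator {a..b} :: real \<Rightarrow> real)"
    by (rule integrable_real_indicator) (auto simp: emeasure_lborel_Icc_eq)
  ultimately show "integrable lborel (\<lambda>x. indicator {a..b} x + indicator {a..b} x *\<^sub>R (cmod (g x))\<^sup>2)"
    by (rule Bochner_Integration.integrable_add[rotated])
  show "(\<lambda>x. indicator {a..b} x *\<^sub>R g x) \<in> borel_measurable lborel"
    using assms by (intro measurable_indicator_restrict) (auto simp: L2_loc_def)
  have "r \<le> 1 + r\<^sup>2" for r :: real
    using zero_le_power2[of "r - 1/2"] by (simp add: power2_eq_square algebra_simps)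
  then show "AE x in lborel. norm (indicator {a..b} x *\<^sub>R g x) \<le> norm (indicator {a..b} x + indicator {a..b} x *\<^sub>R (cmod (g x))\<^sup>2)"
    by (intro AE_I2) (auto simp: indicator_def)
qed

text \<open>On a compact subinterval the weight is bounded below by a positive constant.\<close>

lemma H_space_L2_loc:
  assumes f: "f \<in> H_space" shows "f \<in> L2_loc"
  unfolding L2_loc_def mem_Collect_eq
proof (intro conjI allI impI)
  show meas: "f \<in> borel_measurable (restrict_space lborel {0<..<pi})"
    using f by (simp add: H_space_def flip: borel_measurable_Mw)
  fix a b assume ab: "0 < a \<and> a < b \<and> b < pi"
  obtain c where c: "c \<in> {a..b}" "\<And>x. x \<in> {a..b} \<Longrightarrow> weight c \<le> weight x"
    using continuous_attains_inf[of "{a..b}" weight] continuous_on_weight ab by (auto simp: Ball_def)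
  have wc: "0 < weight c" using c(1) ab weight_pos by auto
  have "(\<lambda>x. (cmod (f x))\<^sup>2) \<in> borel_measurable (restrict_space lborel {0<..<pi})"
    using meas by measurable
  then have "set_integrable lborel {0<..<pi} (\<lambda>x. weight x *\<^sub>R (cmod (f x))\<^sup>2)"
    using H_space_integrable[OF f] integrable_Mw by blast
  then have "integrable lborel (\<lambda>x. (1 / weight c) * (indicator {0<..<pi} x *\<^sub>R (weight x *\<^sub>R (cmod (f x))\<^sup>2)))"
    unfolding set_integrable_def by (intro integrable_mult_right) auto
  then show "set_integrable lborel {a..b} (\<lambda>x. (cmod (f x))\<^sup>2)"
    unfolding set_integrable_def
  proof (rule Bochner_Integration.integrable_bound)
    have "(\<lambda>x. (cmod (indicator {a..b} x *\<^sub>R f x))\<^sup>2) \<in> borel_measurable lborel"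
    proof -
      have "{a..b} \<subseteq> {0<..<pi}" using ab by auto
      from measurable_indicator_restrict[OF meas _ this] show ?thesis by measurable
    qed
    also have "(\<lambda>x. (cmod (indicator {a..b} x *\<^sub>R f x))\<^sup>2) = (\<lambda>x. indicator {a..b} x *\<^sub>R (cmod (f x))\<^sup>2)"
      by (auto simp: indicator_def fun_eq_iff)
    finally show "(\<lambda>x. indicator {a..b} x *\<^sub>R (cmod (f x))\<^sup>2) \<in> borel_measurable lborel" .
    have "(cmod (f x))\<^sup>2 \<le> \<bar>weight x * (cmod (f x))\<^sup>2\<bar> / \<bar>weight c\<bar>" if "x \<in> {a..b}" for x
    proof -
      have "(cmod (f x))\<^sup>2 * weight c \<le> \<bar>weight x * (cmod (f x))\<^sup>2\<bar>"
        using mult_right_mono[OF c(2)[OF that], of "(cmod (f x))\<^sup>2"] by (simp add: mult.commute)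
      then show ?thesis using wc by (simp add: field_simps)
    qed
    then show "AE x in lborel. norm (indicator {a..b} x *\<^sub>R (cmod (f x))\<^sup>2)
        \<le> norm ((1 / weight c) * (indicator {0<..<pi} x *\<^sub>R (weight x *\<^sub>R (cmod (f x))\<^sup>2)))"
      using ab by (intro AE_I2) (auto simp: indicator_def)
  qed
qed

lemma L2_loc_test_integrable:
  assumes "g \<in> L2_loc" "compact_cont u"
  shows "set_integrable lborel {0<..<pi} (\<lambda>x. g x * complex_of_real (u x))"
proof -
  obtain a b where ab: "0 < a" "a < b" "b < pi" and z: "\<And>x. x \<notin> {a..b} \<Longrightarrow> u x = 0" and c: "continuous_on UNIV u"
    using assms by (auto simp: compact_cont_def)
  have "compact (u ` {a..b})" by (intro compact_continuous_image continuous_on_subset[OF c]) auto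
  then have "bounded (u ` {a..b})" by (rule compact_imp_bounded)
  then obtain B where "\<forall>x\<in>{a..b}. \<bar>u x\<bar> \<le> B" by (auto simp: bounded_iff)
  then have B: "\<bar>u x\<bar> \<le> max B 0" for x
    using z[of x] by (cases "x \<in> {a..b}") (auto intro: max.coboundedI1)
  have [measurable]: "u \<in> borel_measurable borel" using c by (rule borel_measurable_continuous_onI)
  have g: "integrable lborel (\<lambda>x. indicator {a..b} x *\<^sub>R g x)"
    using L2_loc_integrable[OF assms(1) ab] by (simp add: set_integrable_def)
  then have [measurable]: "(\<lambda>x. indicator {a..b} x *\<^sub>R g x) \<in> borel_measurable lborel" by (rule borel_measurable_integrable)
  have "integrable lborel (\<lambda>x. (indicator {a..b} x *\<^sub>R g x) * complex_of_real (u x))"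
  proof (rule Bochner_Integration.integrable_bound)
    show "integrable lborel (\<lambda>x. max B 0 * norm (indicator {a..b} x *\<^sub>R g x))"
      using g by (intro integrable_mult_right integrable_norm) auto
    show "AE x in lborel. norm ((indicator {a..b} x *\<^sub>R g x) * complex_of_real (u x)) \<le>
        norm (max B 0 * norm (indicator {a..b} x *\<^sub>R g x))"
    proof (rule AE_I2)
      fix x
      have "norm ((indicator {a..b} x *\<^sub>R g x) * complex_of_real (u x)) = \<bar>u x\<bar> * norm (indicator {a..b} x *\<^sub>R g x)"
        by (simp only: norm_mult norm_of_real mult.commute)
      also have "\<dots> \<le> max B 0 * norm (indicator {a..b} x *\<^sub>R g x)" by (rule mult_right_mono[OF B norm_ge_zero])
      also have "\<dots> \<le> norm (max B 0 * norm (indicator {a..b} x *\<^sub>R g x))" unfolding real_norm_def by (rule abs_ge_self)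
      finally show "norm ((indicator {a..b} x *\<^sub>R g x) * complex_of_real (u x)) \<le>
        norm (max B 0 * norm (indicator {a..b} x *\<^sub>R g x))" .
    qed
  qed measurable
  also have "(\<lambda>x. (indicator {a..b} x *\<^sub>R g x) * complex_of_real (u x)) =
      (\<lambda>x. indicator {0<..<pi} x *\<^sub>R (g x * complex_of_real (u x)))"
  proof
    show "(indicator {a..b} x *\<^sub>R g x) * complex_of_real (u x) = indicator {0<..<pi} x *\<^sub>R (g x * complex_of_real (u x))" for x
      using z[of x] ab by (cases "x \<in> {a..b}") auto
  qed
  finally show ?thesis by (simp add: set_integrable_def)
qed

theorem weak_deriv_unique:
  assumes "g1 \<in> L2_loc" "g2 \<in> L2_loc" "is_weak_deriv f g1" "is_weak_deriv f g2"
  shows "AE x in Mw. g1 x = g2 x"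
proof -
  have "AE x in lborel. 0 < x \<and> x < pi \<longrightarrow> g1 x - g2 x = 0"
  proof (rule fundamental_lemma_calculus_variations)
    show "set_integrable lborel {a..b} (\<lambda>x. g1 x - g2 x)" if "0 < a" "a < b" "b < pi" for a b
      by (rule set_integral_diff(1)[OF L2_loc_integrable[OF assms(1) that] L2_loc_integrable[OF assms(2) that]])
    fix \<psi> assume \<psi>: "\<psi> \<in> test_functions"
    have "(LINT x:{0<..<pi}|lborel. g1 x * complex_of_real (\<psi> x)) = (LINT x:{0<..<pi}|lborel. g2 x * complex_of_real (\<psi> x))"
      using assms(3,4)[unfolded is_weak_deriv_def, THEN bspec, OF \<psi>] by simp
    then show "(LINT x:{0<..<pi}|lborel. (g1 x - g2 x) * complex_of_real (\<psi> x)) = 0"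
      using assms(1,2) test_compact_cont[OF \<psi>]
      by (simp add: left_diff_distrib set_integral_diff L2_loc_test_integrable)
  qed
  then show ?thesis unfolding AE_Mw by eventually_elim auto
qed

lemma V_weak_deriv:
  assumes "f \<in> V_space"
  shows "f \<in> H_space" "weak_deriv f \<in> H_space" "is_weak_deriv f (weak_deriv f)"
proof -
  show "f \<in> H_space" using assms by (simp add: V_space_def)
  have *: "weak_deriv f \<in> L2_loc \<and> is_weak_deriv f (weak_deriv f)"
    unfolding weak_deriv_def
    by (rule someI_ex[of "\<lambda>g. g \<in> L2_loc \<and> is_weak_deriv f g"]) (use assms in \<open>auto simp: V_space_def H1_loc_def\<close>)
  then show "is_weak_deriv f (weak_deriv f)" by blast
  show "weak_deriv f \<in> H_space"
    using * assms by (simp add: V_space_def H_space_def L2_loc_def borel_measurable_Mw)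
qed

text \<open>The derivative chosen in the definition of the form domain agrees with any given weak derivative
  almost everywhere, by \<open>weak_deriv_unique\<close>.\<close>

lemma V_spaceI:
  assumes "f \<in> H_space" "g \<in> H_space" "is_weak_deriv f g"
  shows "f \<in> V_space" "AE x in Mw. weak_deriv f x = g x"
proof -
  have g: "g \<in> L2_loc \<and> is_weak_deriv f g" using assms H_space_L2_loc by blast
  then have w: "weak_deriv f \<in> L2_loc \<and> is_weak_deriv f (weak_deriv f)" unfolding weak_deriv_def
    by (rule someI[of "\<lambda>g. g \<in> L2_loc \<and> is_weak_deriv f g"])
  then show ae: "AE x in Mw. weak_deriv f x = g x" using weak_deriv_unique g by blast
  then have "AE x in Mw. g x = weak_deriv f x" by eventually_elim simp
  then have "weak_deriv f \<in> H_space"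
    using w by (intro H_cong_AE[OF assms(2)]) (auto simp: L2_loc_def borel_measurable_Mw)
  then show "f \<in> V_space"
    using assms g H_space_L2_loc[OF assms(1)] by (auto simp: V_space_def H1_loc_def H_space_def)
qed

lemma V_diff:
  assumes "f \<in> V_space" "g \<in> V_space"
  shows "(\<lambda>x. f x - g x) \<in> V_space" "AE x in Mw. weak_deriv (\<lambda>x. f x - g x) x = weak_deriv f x - weak_deriv g x"
proof -
  note f = V_weak_deriv[OF assms(1)] and g = V_weak_deriv[OF assms(2)]
  have "is_weak_deriv (\<lambda>x. f x - g x) (\<lambda>x. weak_deriv f x - weak_deriv g x)"
    using f g by (simp add: is_weak_deriv_iff H_diff H_inner_diff_left over_weight_H test_compact_cont)
  from V_spaceI[OF H_diff[OF f(1) g(1)] H_diff[OF f(2) g(2)] this]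
  show "(\<lambda>x. f x - g x) \<in> V_space" "AE x in Mw. weak_deriv (\<lambda>x. f x - g x) x = weak_deriv f x - weak_deriv g x" by auto
qed

lemma is_weak_deriv_sum:
  assumes "\<And>i. i \<in> I \<Longrightarrow> f i \<in> H_space" "\<And>i. i \<in> I \<Longrightarrow> g i \<in> H_space" "\<And>i. i \<in> I \<Longrightarrow> is_weak_deriv (f i) (g i)"
  shows "is_weak_deriv (\<lambda>x. \<Sum>i\<in>I. c i * f i x) (\<lambda>x. \<Sum>i\<in>I. c i * g i x)"
  using assms
  by (simp add: is_weak_deriv_iff H_sum H_scale H_inner_sum_left over_weight_H test_compact_cont H_inner_scale_left
      sum_negf[symmetric])

lemma is_weak_deriv_limit:
  assumes "\<And>n. s n \<in> H_space" "\<And>n. t n \<in> H_space" "\<And>n. is_weak_deriv (s n) (t n)" "f \<in> H_space" "g \<in> H_space"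
    "(\<lambda>n. H_norm (\<lambda>x. f x - s n x)) \<longlonglongrightarrow> 0" "(\<lambda>n. H_norm (\<lambda>x. g x - t n x)) \<longlonglongrightarrow> 0"
  shows "is_weak_deriv f g"
  unfolding is_weak_deriv_iff[OF assms(4,5)]
proof
  fix \<psi> assume \<psi>: "\<psi> \<in> test_functions"
  have "(\<lambda>n. H_inner (s n) (over_weight (deriv \<psi>))) \<longlonglongrightarrow> H_inner f (over_weight (deriv \<psi>))"
    by (rule H_inner_tendsto[OF assms(1,4) over_weight_H[OF test_compact_cont(2)[OF \<psi>]] assms(6)])
  moreover have "(\<lambda>n. - H_inner (t n) (over_weight \<psi>)) \<longlonglongrightarrow> - H_inner g (over_weight \<psi>)"
    by (rule tendsto_minus[OF H_inner_tendsto[OF assms(2,5) over_weight_H[OF test_compact_cont(1)[OF \<psi>]] assms(7)]])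
  moreover have "H_inner (s n) (over_weight (deriv \<psi>)) = - H_inner (t n) (over_weight \<psi>)" for n
    using assms(3)[of n] \<psi> by (simp add: is_weak_deriv_iff assms(1,2))
  ultimately show "H_inner f (over_weight (deriv \<psi>)) = - H_inner g (over_weight \<psi>)"
    by (simp add: LIMSEQ_unique)
qed

lemma V_norm_sq:
  assumes "f \<in> V_space"
  shows "V_norm f = sqrt (4 * (H_norm (weak_deriv f))\<^sup>2 + (H_norm f)\<^sup>2)"
proof -
  have "form_a0 f f = complex_of_real (4 * (H_norm (weak_deriv f))\<^sup>2)"
    unfolding form_a0_def H_inner_def[symmetric] H_inner_self by simp
  then show ?thesis by (simp add: V_norm_def del: of_real_mult of_real_power)
qed

section \<open>Green's formula against the eigenfunctions\<close>

lemma H_inner_dominated: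
  assumes f: "f \<in> H_space" and u: "\<And>k. u k \<in> borel_measurable Mw" "v \<in> borel_measurable Mw"
    and B: "\<And>k x. 0 < x \<Longrightarrow> x < pi \<Longrightarrow> cmod (u k x) \<le> B"
    and lim: "\<And>x. 0 < x \<Longrightarrow> x < pi \<Longrightarrow> (\<lambda>k. u k x) \<longlonglongrightarrow> v x"
  shows "(\<lambda>k. H_inner f (u k)) \<longlonglongrightarrow> H_inner f v"
  unfolding H_inner_def
proof (rule integral_dominated_convergence[where w="\<lambda>x. cmod (f x) * B"])
  have [measurable]: "f \<in> borel_measurable Mw" using f by measurable
  note u[measurable]
  show "(\<lambda>x. f x * cnj (v x)) \<in> borel_measurable Mw" "(\<lambda>x. f x * cnj (u k x)) \<in> borel_measurable Mw" for k
    by measurable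
  show "integrable Mw (\<lambda>x. cmod (f x) * B)" using H_norm_L1_bound(1)[OF f] by simp
  show "AE x in Mw. (\<lambda>k. f x * cnj (u k x)) \<longlonglongrightarrow> f x * cnj (v x)"
    using lim by (intro AE_I2 tendsto_intros) auto
  show "AE x in Mw. norm (f x * cnj (u k x)) \<le> cmod (f x) * B" for k
    using B by (intro AE_I2) (auto simp: norm_mult intro!: mult_left_mono)
qed

lemma continuous_measurable_Mw:
  fixes u :: "real \<Rightarrow> complex"
  assumes "continuous_on UNIV u" shows "u \<in> borel_measurable Mw"
  unfolding borel_measurable_Mw
  by (rule measurable_restrict_borel) (rule borel_measurable_continuous_onI[OF assms])

lemma continuous_H_space:
  fixes u :: "real \<Rightarrow> complex"
  assumes "continuous_on UNIV u" shows "u \<in> H_space"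
proof -
  have "compact (u ` {0..pi})" by (intro compact_continuous_image continuous_on_subset[OF assms]) auto
  then have "bounded (u ` {0..pi})" by (rule compact_imp_bounded)
  then obtain B where "\<forall>x\<in>{0..pi}. cmod (u x) \<le> B" by (auto simp: bounded_iff)
  then show ?thesis
    by (intro H_space_bounded[OF continuous_measurable_Mw[OF assms], of B]) auto
qed

lemma classical_imp_weak_deriv:
  fixes F F' :: "real \<Rightarrow> complex"
  assumes d: "\<And>x. (F has_vector_derivative F' x) (at x)" and c: "continuous_on UNIV F'"
  shows "is_weak_deriv F F'"
  unfolding is_weak_deriv_def
proof
  fix \<psi> assume "\<psi> \<in> test_functions"
  then obtain a b where ab: "0 < a" "b < pi" and z: "\<And>x. x \<notin> {a..b} \<Longrightarrow> \<psi> x = 0" "\<And>x. x \<notin> {a..b} \<Longrightarrow> deriv \<psi> x = 0"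
    and d\<psi>: "\<And>x. (\<psi> has_real_derivative deriv \<psi> x) (at x)" and cc: "continuous_on UNIV \<psi>" "continuous_on UNIV (deriv \<psi>)"
    using test_functionsE by metis
  have cF: "continuous_on UNIV F"
    using d by (meson continuous_at_imp_continuous_on has_vector_derivative_continuous)
  have i: "set_integrable lborel {0..pi} (\<lambda>x. F' x * complex_of_real (\<psi> x))"
    "set_integrable lborel {0..pi} (\<lambda>x. F x * complex_of_real (deriv \<psi> x))"
    by (intro borel_integrable_atLeastAtMost' continuous_intros continuous_on_subset[OF c] continuous_on_subset[OF cF]
        continuous_on_subset[OF cc(1)] continuous_on_subset[OF cc(2)]; simp)+
  have op: "(LINT x:{0<..<pi}|lborel. u x) = (LINT x:{0..pi}|lborel. u x)" if "u 0 = 0" "u pi = 0" for u :: "real \<Rightarrow> complex"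
    unfolding set_lebesgue_integral_def
  proof (rule Bochner_Integration.integral_cong[OF refl])
    show "indicator {0<..<pi} x *\<^sub>R u x = indicator {0..pi} x *\<^sub>R u x" for x
      using that by (cases "x = 0"; cases "x = pi") (auto simp: indicator_def)
  qed
  have "(LINT x:{0..pi}|lborel. F' x * complex_of_real (\<psi> x) + F x * complex_of_real (deriv \<psi> x)) =
      F pi * complex_of_real (\<psi> pi) - F 0 * complex_of_real (\<psi> 0)"
    unfolding set_lebesgue_integral_def
  proof (rule integral_FTC_atLeastAtMost)
    show "((\<lambda>x. F x * complex_of_real (\<psi> x)) has_vector_derivative F' x * complex_of_real (\<psi> x) + F x * complex_of_real (deriv \<psi> x))
        (at x within {0..pi})" for x
    proof -
      have "((\<lambda>x. complex_of_real (\<psi> x)) has_vector_derivative complex_of_real (deriv \<psi> x)) (at x)"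
        using d\<psi>[of x] by (intro has_vector_derivative_of_real) (simp add: has_real_derivative_iff_has_vector_derivative)
      from has_vector_derivative_mult[OF d this]
      have "((\<lambda>x. F x * complex_of_real (\<psi> x)) has_vector_derivative F x * complex_of_real (deriv \<psi> x) + F' x * complex_of_real (\<psi> x)) (at x)" .
      then show ?thesis by (simp add: add.commute has_vector_derivative_at_within)
    qed
    show "continuous_on {0..pi} (\<lambda>x. F' x * complex_of_real (\<psi> x) + F x * complex_of_real (deriv \<psi> x))"
      by (intro continuous_intros continuous_on_subset[OF c] continuous_on_subset[OF cF]
        continuous_on_subset[OF cc(1)] continuous_on_subset[OF cc(2)]; simp)
  qed simp
  also have "\<dots> = 0" using z(1)[of 0] z(1)[of pi] ab by simp
  finally have "(LINT x:{0..pi}|lborel. F' x * complex_of_real (\<psi> x)) + (LINT x:{0..pi}|lborel. F x * complex_of_real (deriv \<psi> x)) = 0"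
    using set_integral_add(2)[OF i] by simp
  then have "(LINT x:{0..pi}|lborel. F x * complex_of_real (deriv \<psi> x)) = - (LINT x:{0..pi}|lborel. F' x * complex_of_real (\<psi> x))"
    by (simp add: eq_neg_iff_add_eq_0 add.commute)
  then show "(LINT x:{0<..<pi}|lborel. F x * complex_of_real (deriv \<psi> x)) = - (LINT x:{0<..<pi}|lborel. F' x * complex_of_real (\<psi> x))"
    using z(1)[of 0] z(1)[of pi] z(2)[of 0] z(2)[of pi] ab by (simp add: op)
qed

text \<open>The eigenfunctions without their normalization.\<close>

definition gcos :: "nat \<Rightarrow> real \<Rightarrow> complex" where
  "gcos n x = complex_of_real (gegenbauer (1/4) n (cos x))"

definition dgcos :: "nat \<Rightarrow> real \<Rightarrow> complex" where
  "dgcos n x = complex_of_real (- (sin x * dgegen (1/4) n (cos x)))"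

lemma continuous_poly_cos: "continuous_on S (\<lambda>x. poly p (cos x))" for p :: "real poly" and S :: "real set"
  by (intro continuous_intros)

lemma gcos_cont: "continuous_on S (gcos n)" and dgcos_cont: "continuous_on S (dgcos n)"
  unfolding gcos_def[abs_def] dgcos_def[abs_def] poly_gegen_poly[symmetric] dgegen_def
  by (intro continuous_intros)+

lemma gcos_H: "gcos n \<in> H_space" and dgcos_H: "dgcos n \<in> H_space"
  by (intro continuous_H_space gcos_cont dgcos_cont)+

lemma gcos_weak_deriv: "is_weak_deriv (gcos n) (dgcos n)"
proof (rule classical_imp_weak_deriv[OF _ dgcos_cont])
  fix x
  have "((\<lambda>x. gegenbauer (1/4) n (cos x)) has_real_derivative dgegen (1/4) n (cos x) * (- sin x)) (at x)"
    by (rule DERIV_chain2[OF gegenbauer_deriv DERIV_cos])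
  then show "(gcos n has_vector_derivative dgcos n x) (at x)"
    unfolding gcos_def[abs_def] dgcos_def
    by (intro has_vector_derivative_of_real) (simp add: has_real_derivative_iff_has_vector_derivative mult.commute)
qed

lemma flat_div_sqrt: "0 < s \<Longrightarrow> flat c a j s / sqrt s = flat c (a - 1/2) j s"
  by (simp add: flat_def powr_diff powr_half_sqrt)

lemma flat_bounds: "0 < c \<Longrightarrow> 0 < s \<Longrightarrow> s \<le> 1 \<Longrightarrow> 0 \<le> a \<Longrightarrow> \<bar>flat c a 0 s\<bar> \<le> 1"
proof -
  assume *: "0 < c" "0 < s" "s \<le> 1" "0 \<le> a"
  have "0 \<le> 1 / (c * s - 1)" if "1 / c < s" using that * by (simp add: field_simps)
  moreover have "s powr a \<le> 1" using * by (intro powr_le1) auto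
  ultimately show ?thesis by (auto simp: flat_def abs_mult intro!: mult_le_one)
qed

lemma flat_deriv_term:
  assumes "0 < c" "1 / c < s"
  shows "c * flat c 1 2 s = ((1 / (c * s - 1))\<^sup>2 + 1 / (c * s - 1)) * exp (- (1 / (c * s - 1)))"
proof -
  have s: "0 < s" using assms by (meson divide_pos_pos less_trans zero_less_one)
  have cs: "c * s - 1 > 0" using assms by (simp add: field_simps)
  have "c * flat c 1 2 s = (c * s) * (1 / (c * s - 1))\<^sup>2 * exp (- (1 / (c * s - 1)))"
    using assms s by (simp add: flat_def)
  also have "(c * s) * (1 / (c * s - 1))\<^sup>2 = (1 / (c * s - 1))\<^sup>2 + 1 / (c * s - 1)"
  proof -
    have "(D + 1) * (1 / D)\<^sup>2 = (1 / D)\<^sup>2 + 1 / D" if "0 < D" for D :: real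
      using that by (simp add: add_divide_distrib power2_eq_square)
    from this[OF cs] show ?thesis by simp
  qed
  finally show ?thesis .
qed

text \<open>In terms of \<open>q = 1 / (c s - 1)\<close> the expression is \<open>(q\<^sup>2 + q) e\<^sup>-\<^sup>q\<close>. It is what remains of the derivative of
  the cut-off after multiplication by \<open>sin\<close>, and it has to be bounded uniformly in \<open>c\<close>.\<close>

lemma flat_deriv_term_bound:
  assumes "0 < c" shows "\<bar>c * flat c 1 2 s\<bar> \<le> 2"
proof (cases "1 / c < s")
  case True
  define q where "q = 1 / (c * s - 1)"
  have q: "0 < q" using True assms by (simp add: q_def field_simps)
  have "q\<^sup>2 + q \<le> 2 * exp q" using exp_lower_Taylor_quadratic[of q] q by simp
  then have "(q\<^sup>2 + q) * exp (- q) \<le> 2" by (simp add: exp_minus field_simps)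
  moreover have "0 \<le> (q\<^sup>2 + q) * exp (- q)" using q by simp
  ultimately show ?thesis unfolding flat_deriv_term[OF assms True] q_def[symmetric] by simp
qed (simp add: flat_def)

lemma flat_tendsto:
  assumes s: "0 < s"
  shows "(\<lambda>k. flat (real (Suc k)) a 0 s) \<longlonglongrightarrow> s powr a"
    and "(\<lambda>k. real (Suc k) * flat (real (Suc k)) 1 2 s) \<longlonglongrightarrow> 0"
proof -
  define q where "q k = 1 / (real (Suc k) * s - 1)" for k
  have "filterlim (\<lambda>k. real (Suc k)) at_top sequentially"
    using filterlim_real_sequentially filterlim_sequentially_Suc by blast
  then have "filterlim (\<lambda>k. s * real (Suc k)) at_top sequentially"
    by (rule filterlim_tendsto_pos_mult_at_top[OF tendsto_const s])
  then have "filterlim (\<lambda>k. -1 + s * real (Suc k)) at_top sequentially"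
    by (rule filterlim_tendsto_add_at_top[OF tendsto_const])
  then have t: "filterlim (\<lambda>k. real (Suc k) * s - 1) at_top sequentially" by (simp add: algebra_simps)
  have q: "q \<longlonglongrightarrow> 0" unfolding q_def[abs_def]
    by (rule tendsto_divide_0[OF tendsto_const filterlim_at_top_imp_at_infinity[OF t]])
  have ev: "\<forall>\<^sub>F k in sequentially. 1 / real (Suc k) < s"
  proof -
    have "\<forall>\<^sub>F k in sequentially. 0 < real (Suc k) * s - 1"
      by (rule t[unfolded filterlim_at_top_dense, rule_format])
    then show ?thesis by eventually_elim (simp add: field_simps)
  qed
  have "(\<lambda>k. s powr a * exp (- q k)) \<longlonglongrightarrow> s powr a * exp (- 0)" by (intro tendsto_intros q)
  moreover have "\<forall>\<^sub>F k in sequentially. s powr a * exp (- q k) = flat (real (Suc k)) a 0 s"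
    using ev by eventually_elim (simp add: flat_def q_def)
  ultimately show "(\<lambda>k. flat (real (Suc k)) a 0 s) \<longlonglongrightarrow> s powr a"
    using Lim_transform_eventually by fastforce
  have "(\<lambda>k. ((q k)\<^sup>2 + q k) * exp (- q k)) \<longlonglongrightarrow> (0\<^sup>2 + 0) * exp (- 0)" by (intro tendsto_intros q)
  moreover have "\<forall>\<^sub>F k in sequentially. ((q k)\<^sup>2 + q k) * exp (- q k) = real (Suc k) * flat (real (Suc k)) 1 2 s"
    using ev by eventually_elim (simp only: q_def flat_deriv_term of_nat_0_less_iff zero_less_Suc)
  ultimately show "(\<lambda>k. real (Suc k) * flat (real (Suc k)) 1 2 s) \<longlonglongrightarrow> 0"
    using Lim_transform_eventually by fastforce
qed

text \<open>The function to test with is \<open>\<omega>\<close> times the derivative of the eigenfunction, that is \<open>sin\<^sup>3\<^sup>/\<^sup>2 \<cdot> p(cos)\<close> up to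
  sign. It vanishes at the end points but does not have compact support, so it is multiplied by a
  cut-off in \<open>sin\<close> at height \<open>1/c\<close>. The derivative of the cut-off grows like \<open>c\<close>, but it is concentrated where
  \<open>sin\<close> is of order \<open>1/c\<close>, so the additional term stays bounded and tends to \<open>0\<close> pointwise. Dominated
  convergence and the Gegenbauer equation give the formula.\<close>

theorem green_formula:
  assumes f: "f \<in> H_space" and g: "g \<in> H_space" and w: "is_weak_deriv f g"
  shows "H_inner g (dgcos n) = real n * (real n + 1/2) * H_inner f (gcos n)"
proof -
  define p where "p = pderiv (gegen_poly (1/4) n)"
  define c where "c k = real (Suc k)" for k
  have c: "0 < c k" "1 \<le> c k" for k by (auto simp: c_def)
  define h where "h k x = flat (c k) (3/2) 0 (sin x) * poly p (cos x)" for k x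
  \<comment> \<open>the test function; \<open>U\<close> and \<open>W\<close> below are it and its derivative divided by the weight\<close>
  define T where "T k = restrict_0pi (h k)" for k
  have T: "T k \<in> test_functions" for k
    unfolding T_def h_def[abs_def] by (rule restrict_flat_test[OF c(2)])
  define U where "U k x = complex_of_real (flat (c k) 1 0 (sin x) * poly p (cos x))" for k x
  define W where "W k x = complex_of_real ((3/2 * flat (c k) 0 0 (sin x) + c k * flat (c k) 1 2 (sin x)) * (cos x * poly p (cos x))
      - flat (c k) 1 0 (sin x) * (sin x * poly (pderiv p) (cos x)))" for k x
  have sin: "0 < sin x" "sin x \<le> 1" if "0 < x" "x < pi" for x using that by (auto simp: sin_gt_zero)
  have TU: "over_weight (T k) x = U k x" if "0 < x" "x < pi" for k x
  proof -
    have "T k x / weight x = (flat (c k) (3/2) 0 (sin x) / sqrt (sin x)) * poly p (cos x)"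
      using that by (simp add: T_def restrict_0pi_def h_def weight_def)
    then show ?thesis unfolding over_weight_def U_def flat_div_sqrt[OF sin(1)[OF that]] by simp
  qed
  have TW: "over_weight (deriv (T k)) x = W k x" if x: "0 < x" "x < pi" for k x
  proof -
    note s = sin(1)[OF x]
    have "(h k has_real_derivative
      (3/2 * flat (c k) (3/2 - 1) 0 (sin x) - c k * real 0 * flat (c k) (3/2) (Suc 0) (sin x) + c k * flat (c k) (3/2) (Suc (Suc 0)) (sin x)) * cos x * poly p (cos x)
      + poly (pderiv p) (cos x) * (- sin x) * flat (c k) (3/2) 0 (sin x)) (at x)"
      unfolding h_def[abs_def]
      by (intro DERIV_mult DERIV_chain2[OF flat_deriv[OF c(1)] DERIV_sin] DERIV_chain2[OF poly_DERIV DERIV_cos])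
    then have "(T k has_real_derivative
      (3/2 * flat (c k) (3/2 - 1) 0 (sin x) - c k * real 0 * flat (c k) (3/2) (Suc 0) (sin x) + c k * flat (c k) (3/2) (Suc (Suc 0)) (sin x)) * cos x * poly p (cos x)
      + poly (pderiv p) (cos x) * (- sin x) * flat (c k) (3/2) 0 (sin x)) (at x)"
      by (rule has_field_derivative_transform_within_open[where S="{0<..<pi}"])
         (use x in \<open>auto simp: T_def restrict_0pi_def\<close>)
    then have d: "deriv (T k) x = (3/2 * flat (c k) (1/2) 0 (sin x) + c k * flat (c k) (3/2) 2 (sin x)) * (cos x * poly p (cos x))
      - flat (c k) (3/2) 0 (sin x) * (sin x * poly (pderiv p) (cos x))"
      by (subst DERIV_imp_deriv) (auto simp: eval_nat_numeral algebra_simps)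
    have fl: "flat (c k) (1/2) 0 (sin x) = flat (c k) 0 0 (sin x) * sqrt (sin x)"
      "flat (c k) (3/2) 2 (sin x) = flat (c k) 1 2 (sin x) * sqrt (sin x)"
      "flat (c k) (3/2) 0 (sin x) = flat (c k) 1 0 (sin x) * sqrt (sin x)"
      using s flat_div_sqrt[OF s, of "c k" "1/2" 0] flat_div_sqrt[OF s, of "c k" "3/2" 2] flat_div_sqrt[OF s, of "c k" "3/2" 0]
      by (simp_all add: field_simps)
    have "deriv (T k) x = ((3/2 * flat (c k) 0 0 (sin x) + c k * flat (c k) 1 2 (sin x)) * (cos x * poly p (cos x))
      - flat (c k) 1 0 (sin x) * (sin x * poly (pderiv p) (cos x))) * sqrt (sin x)"
      unfolding d fl by (simp add: algebra_simps)
    then show ?thesis using s by (simp add: over_weight_def W_def weight_def del: of_real_mult of_real_add of_real_diff)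
  qed
  have meas_flat: "flat (c k) a j \<in> borel_measurable borel" for k a j
  proof -
    have "continuous_on UNIV (flat (c k) a j)"
      using flat_deriv[OF c(1)] by (meson DERIV_isCont continuous_at_imp_continuous_on)
    then show ?thesis by (rule borel_measurable_continuous_onI)
  qed
  have meas: "U k \<in> borel_measurable Mw" "W k \<in> borel_measurable Mw" for k
  proof -
    note meas_flat[measurable]
    have [measurable]: "(\<lambda>x. poly q (cos x)) \<in> borel_measurable borel" for q :: "real poly"
      by (rule borel_measurable_continuous_onI[OF continuous_poly_cos])
    have "(\<lambda>x. flat (c k) 1 0 (sin x) * poly p (cos x)) \<in> borel_measurable borel" by measurable
    then show "U k \<in> borel_measurable Mw" unfolding borel_measurable_Mw U_def[abs_def]
      by (intro measurable_restrict_borel) measurable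
    show "W k \<in> borel_measurable Mw" unfolding borel_measurable_Mw W_def[abs_def]
      by (intro measurable_restrict_borel) measurable
  qed
  have bd: "\<exists>B. \<forall>x. \<bar>poly q (cos x)\<bar> \<le> B" for q :: "real poly"
  proof -
    have "compact (poly q ` {-1..1})" by (intro compact_continuous_image continuous_intros) auto
    then have "bounded (poly q ` {-1..1})" by (rule compact_imp_bounded)
    then obtain B where "\<forall>x\<in>{-1..1}. \<bar>poly q x\<bar> \<le> B" by (auto simp: bounded_iff)
    then show ?thesis by (intro exI[of _ B]) auto
  qed
  obtain B1 where B1: "\<And>x. \<bar>poly p (cos x)\<bar> \<le> B1" using bd by blast
  obtain B2 where B2: "\<And>x. \<bar>poly (pderiv p) (cos x)\<bar> \<le> B2" using bd by blast
  have B0: "0 \<le> B1" "0 \<le> B2" using B1[of 0] B2[of 0] by linarith+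
  have limU: "(\<lambda>k. U k x) \<longlonglongrightarrow> - dgcos n x" if x: "0 < x" "x < pi" for x
  proof -
    have "(\<lambda>k. U k x) \<longlonglongrightarrow> complex_of_real (sin x powr 1 * poly p (cos x))"
      unfolding U_def c_def by (intro tendsto_intros flat_tendsto sin x)
    then show ?thesis using sin(1)[OF x] by (simp add: dgcos_def dgegen_def p_def)
  qed
  have limW: "(\<lambda>k. W k x) \<longlonglongrightarrow> complex_of_real (real n * (real n + 1/2)) * gcos n x" if x: "0 < x" "x < pi" for x
  proof -
    have "(\<lambda>k. W k x) \<longlonglongrightarrow> complex_of_real ((3/2 * (sin x powr 0) + 0) * (cos x * poly p (cos x))
        - sin x powr 1 * (sin x * poly (pderiv p) (cos x)))"
      unfolding W_def c_def by (intro tendsto_intros flat_tendsto sin x)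
    also have "(3/2 * (sin x powr 0) + 0) * (cos x * poly p (cos x)) - sin x powr 1 * (sin x * poly (pderiv p) (cos x))
        = 3/2 * cos x * dgegen (1/4) n (cos x) - (1 - (cos x)\<^sup>2) * ddgegen (1/4) n (cos x)"
    proof -
      have "1 - (cos x)\<^sup>2 = sin x * sin x" by (metis sin_squared_eq power2_eq_square)
      then show ?thesis using sin(1)[OF x] by (simp add: dgegen_def ddgegen_def p_def)
    qed
    also have "\<dots> = real n * (real n + 1/2) * gegenbauer (1/4) n (cos x)"
      unfolding gegenbauer_ode by (simp add: algebra_simps)
    finally show ?thesis by (simp add: gcos_def)
  qed
  have bU: "cmod (U k x) \<le> B1" if x: "0 < x" "x < pi" for k x
  proof -
    have "cmod (U k x) = \<bar>flat (c k) 1 0 (sin x)\<bar> * \<bar>poly p (cos x)\<bar>"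
      unfolding U_def norm_of_real abs_mult ..
    also have "\<dots> \<le> 1 * B1" using flat_bounds[OF c(1) sin[OF x], of 1 k] B1 by (intro mult_mono) auto
    finally show ?thesis by simp
  qed
  have bW: "cmod (W k x) \<le> 4 * B1 + B2" if x: "0 < x" "x < pi" for k x
  proof -
    have 1: "\<bar>3/2 * flat (c k) 0 0 (sin x) + c k * flat (c k) 1 2 (sin x)\<bar> \<le> 4"
      using flat_bounds[OF c(1) sin[OF x], of 0 k] flat_deriv_term_bound[OF c(1), of k "sin x"] by linarith
    have 2: "\<bar>cos x * poly p (cos x)\<bar> \<le> 1 * B1"
      unfolding abs_mult using B1 by (intro mult_mono) auto
    have 3: "\<bar>sin x * poly (pderiv p) (cos x)\<bar> \<le> 1 * B2"
      unfolding abs_mult using B2 by (intro mult_mono) auto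
    have "cmod (W k x) \<le> \<bar>3/2 * flat (c k) 0 0 (sin x) + c k * flat (c k) 1 2 (sin x)\<bar> * \<bar>cos x * poly p (cos x)\<bar>
        + \<bar>flat (c k) 1 0 (sin x)\<bar> * \<bar>sin x * poly (pderiv p) (cos x)\<bar>"
      unfolding W_def norm_of_real abs_mult[symmetric] by (rule abs_triangle_ineq4)
    also have "\<dots> \<le> 4 * (1 * B1) + 1 * (1 * B2)"
      using flat_bounds[OF c(1) sin[OF x], of 1 k] 1 2 3 B0 by (intro add_mono mult_mono) auto
    finally show ?thesis by simp
  qed
  have "(\<lambda>k. H_inner f (W k)) \<longlonglongrightarrow> H_inner f (\<lambda>x. complex_of_real (real n * (real n + 1/2)) * gcos n x)"
    by (rule H_inner_dominated[OF f meas(2) _ bW limW])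
       (intro continuous_measurable_Mw continuous_intros gcos_cont)
  moreover have "(\<lambda>k. - H_inner g (U k)) \<longlonglongrightarrow> - H_inner g (\<lambda>x. - dgcos n x)"
    by (rule tendsto_minus[OF H_inner_dominated[OF g meas(1) _ bU limU]])
       (intro continuous_measurable_Mw continuous_intros dgcos_cont)
  moreover have "H_inner f (W k) = - H_inner g (U k)" for k
  proof -
    have WH: "W k \<in> H_space" "U k \<in> H_space"
      using H_space_bounded[OF meas(2) bW] H_space_bounded[OF meas(1) bU] by auto
    have "H_inner f (W k) = H_inner f (over_weight (deriv (T k)))"
      using WH f TW by (intro H_inner_cong_AE over_weight_H test_compact_cont T AE_I2) auto
    also have "\<dots> = - H_inner g (over_weight (T k))" using w T unfolding is_weak_deriv_iff[OF f g] by blast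
    also have "H_inner g (over_weight (T k)) = H_inner g (U k)"
      using WH g TU by (intro H_inner_cong_AE over_weight_H test_compact_cont T AE_I2) auto
    finally show ?thesis .
  qed
  ultimately have "H_inner f (\<lambda>x. complex_of_real (real n * (real n + 1/2)) * gcos n x) = - H_inner g (\<lambda>x. - dgcos n x)"
    by (simp add: LIMSEQ_unique)
  then show ?thesis using H_inner_scale_right[of g "-1" "dgcos n"] by (simp add: H_inner_scale_right)
qed

section \<open>The orthonormal eigenbasis\<close>

text \<open>Substitution of \<open>t = (1 - cos x) / 2\<close> in the Beta integral; then \<open>t (1 - t) = (sin x / 2)\<^sup>2\<close>.\<close>

lemma nn_integral_weight: "(\<integral>\<^sup>+x. ennreal (weight x) * indicator {0..pi} x \<partial>lborel) = ennreal (sqrt 2 * Beta (3/4) (3/4))"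
proof -
  let ?f = "\<lambda>t::real. t powr (-1/4) * (1 - t) powr (-1/4)"
  have "(?f has_integral Beta (3/4) (3/4)) {0..1}"
    using has_integral_Beta_real[of "3/4" "3/4"] by simp
  then have "ennreal (Beta (3/4) (3/4)) = (\<integral>\<^sup>+t. ennreal (?f t * indicator {0..1} t) \<partial>lborel)"
    using nn_integral_has_integral_lebesgue[of "{0..1}" ?f "Beta (3/4) (3/4)"] by (simp add: mult_ac ennreal_mult' ennreal_indicator)
  also have "\<dots> = (\<integral>\<^sup>+t. ennreal (?f t * indicator {(1 - cos 0) / 2..(1 - cos pi) / 2} t) \<partial>lborel)" by simp
  also have "\<dots> = (\<integral>\<^sup>+x. ennreal (?f ((1 - cos x) / 2) * (sin x / 2) * indicator {0..pi} x) \<partial>lborel)"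
    by (subst nn_integral_substitution[where g="\<lambda>x. (1 - cos x) / 2" and g'="\<lambda>x. sin x / 2" and a=0 and b=pi])
       (auto intro!: derivative_eq_intros continuous_intros sin_ge_zero simp: set_borel_measurable_def)
  also have "\<dots> = (\<integral>\<^sup>+x. ennreal (1 / sqrt 2) * (ennreal (weight x) * indicator {0..pi} x) \<partial>lborel)"
  proof (intro nn_integral_cong)
    fix x :: real
    have "?f ((1 - cos x) / 2) * (sin x / 2) = 1 / sqrt 2 * weight x" if x: "0 \<le> x" "x \<le> pi"
    proof (cases "sin x = 0")
      case False
      then have s: "0 < sin x" using sin_ge_zero[OF x] by simp
      have c: "(1 - cos x) / 2 \<ge> 0" "1 - (1 - cos x) / 2 \<ge> 0" by (auto simp: field_simps) (smt (verit) cos_ge_minus_one)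
      have "?f ((1 - cos x) / 2) = ((1 - cos x) / 2 * (1 - (1 - cos x) / 2)) powr (-1/4)"
        by (metis c powr_mult)
      also have "(1 - cos x) / 2 * (1 - (1 - cos x) / 2) = (sin x / 2)\<^sup>2"
      proof -
        have "(1 - cos x) / 2 * (1 - (1 - cos x) / 2) = (1 - (cos x)\<^sup>2) / 4" by (simp add: field_simps power2_eq_square)
        then show ?thesis by (simp add: power_divide sin_squared_eq)
      qed
      also have "((sin x / 2)\<^sup>2) powr (-1/4) = (sin x / 2) powr (- 1/2)"
        using s by (simp add: powr_powr flip: powr_numeral)
      also have "(sin x / 2) powr (-1/2) * (sin x / 2) = (sin x / 2) powr (-1/2 + 1)"
        using s by (subst powr_add) simp
      also have "\<dots> = sqrt (sin x / 2)" using s by (simp add: powr_half_sqrt)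
      finally show ?thesis by (simp add: weight_def real_sqrt_divide)
    qed (simp add: weight_def)
    then show "ennreal (?f ((1 - cos x) / 2) * (sin x / 2) * indicator {0..pi} x) =
        ennreal (1 / sqrt 2) * (ennreal (weight x) * indicator {0..pi} x)"
      using sin_ge_zero[of x] by (auto simp: indicator_def weight_def simp flip: ennreal_mult)
  qed
  also have "\<dots> = ennreal (1 / sqrt 2) * (\<integral>\<^sup>+x. ennreal (weight x) * indicator {0..pi} x \<partial>lborel)"
    by (rule nn_integral_cmult) measurable
  finally have "ennreal (sqrt 2) * ennreal (Beta (3/4) (3/4)) =
      ennreal (sqrt 2) * ennreal (1 / sqrt 2) * (\<integral>\<^sup>+x. ennreal (weight x) * indicator {0..pi} x \<partial>lborel)"
    by (simp add: mult.assoc)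
  also have "ennreal (sqrt 2) * ennreal (1 / sqrt 2) = 1"
    by (simp flip: ennreal_mult)
  finally show ?thesis by (simp add: ennreal_mult')
qed

lemma integral_weight: "(LINT x|Mw. (1::real)) = sqrt 2 * Beta (3/4) (3/4)"
proof -
  have B: "0 \<le> Beta (3/4) (3/4 :: real)" by (simp add: Beta_def Gamma_real_nonneg)
  have "(LINT x|Mw. (1::real)) = (LINT x:{0<..<pi}|lborel. weight x *\<^sub>R (1::real))"
    by (rule integral_Mw) simp
  also have "\<dots> = enn2real (\<integral>\<^sup>+x. ennreal (indicator {0<..<pi} x *\<^sub>R (weight x *\<^sub>R (1::real))) \<partial>lborel)"
    unfolding set_lebesgue_integral_def
    by (rule integral_eq_nn_integral) (auto intro!: AE_I2 simp: indicator_def weight_pos less_imp_le)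
  also have "(\<integral>\<^sup>+x. ennreal (indicator {0<..<pi} x *\<^sub>R (weight x *\<^sub>R (1::real))) \<partial>lborel) =
      (\<integral>\<^sup>+x. ennreal (weight x) * indicator {0..pi} x \<partial>lborel)"
  proof (intro nn_integral_cong)
    show "ennreal (indicator {0<..<pi} x *\<^sub>R (weight x *\<^sub>R (1::real))) = ennreal (weight x) * indicator {0..pi} x" for x
      by (cases "x = 0"; cases "x = pi") (auto simp: indicator_def weight_def)
  qed
  finally show ?thesis using B by (simp add: nn_integral_weight)
qed

lemma Gamma_three_quarters: "Gamma (3/4 :: real) = pi * sqrt 2 / Gamma (1/4)"
proof -
  have "Gamma (complex_of_real (1/4)) * Gamma (1 - complex_of_real (1/4)) = complex_of_real pi / sin (complex_of_real pi * complex_of_real (1/4))"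
    by (rule Gamma_reflection_complex)
  also have "1 - complex_of_real (1/4) = complex_of_real (3/4)"
  proof -
    have "(3/4 :: real) = 1 - 1/4" by simp
    then show ?thesis by (simp only: of_real_diff of_real_1)
  qed
  finally have "complex_of_real (Gamma (1/4) * Gamma (3/4)) = complex_of_real (pi / sin (pi / 4))"
    unfolding Gamma_complex_of_real of_real_mult[symmetric] sin_of_real of_real_divide[symmetric] by simp
  then have "Gamma (1/4) * Gamma (3/4) = pi / sin (pi / 4)" unfolding of_real_eq_iff .
  also have "\<dots> = pi * sqrt 2" by (simp add: sin_45 field_simps)
  finally have "Gamma (3/4) * Gamma (1/4) = pi * sqrt 2" by (simp only: mult.commute)
  moreover have "Gamma (1/4 :: real) > 0" by (rule Gamma_real_pos) simp
  then have "Gamma (1/4 :: real) \<noteq> 0" by (metis less_irrefl)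
  ultimately show ?thesis by (simp add: eq_divide_eq)
qed

lemma Gamma_plus1_pos: "0 < x \<Longrightarrow> Gamma (x + 1) = x * Gamma x" for x :: real
  by (rule Gamma_plus1) (use nonpos_Ints_nonpos in force)

lemma h_const_0: "h_const 0 = sqrt 2 * Beta (3/4) (3/4)"
proof -
  have g: "Gamma (1/4 :: real) > 0" by (simp add: Gamma_real_pos)
  have G: "Gamma (3/2 :: real) = sqrt pi / 2"
    using Gamma_plus1_pos[of "1/2"] by (simp add: Gamma_one_half_real)
  have s: "3/4 + 3/4 = (3/2 :: real)" by simp
  have "sqrt 2 * Beta (3/4) (3/4) = sqrt 2 * (pi * sqrt 2 / Gamma (1/4))\<^sup>2 * 2 / sqrt pi"
    unfolding Beta_def s Gamma_three_quarters G by (simp add: power2_eq_square)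
  also have "\<dots> = h_const 0"
  proof -
    have "sqrt 2 * (pi * sqrt 2 / Gamma (1/4))\<^sup>2 * 2 / sqrt pi = (pi / sqrt pi) * (pi * sqrt 2 * 4 / (Gamma (1/4))\<^sup>2)"
    proof -
      have "(pi * sqrt 2 / Gamma (1/4))\<^sup>2 = pi * pi * 2 / (Gamma (1/4))\<^sup>2"
        by (simp add: power_divide power_mult_distrib power2_eq_square[of pi])
      then show ?thesis by (simp add: mult_ac)
    qed
    also have "\<dots> = sqrt pi * (pi * sqrt 2 * 4 / (Gamma (1/4))\<^sup>2)" by (simp only: real_div_sqrt pi_ge_zero)
    also have "\<dots> = h_const 0" by (simp add: h_const_def Gamma_one_half_real)
    finally show ?thesis .
  qed
  finally show ?thesis ..
qed

lemma h_const_pos: "0 < h_const n"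
  by (auto simp: h_const_def intro!: divide_pos_pos mult_pos_pos Gamma_real_pos zero_less_power)

lemma h_const_Suc: "h_const (Suc n) * ((real n + 1) * (real n + 5/4)) = (real n + 1/4) * (real n + 1/2) * h_const n"
proof -
  have 1: "Gamma (real (Suc n) + 1/2) = (real n + 1/2) * Gamma (real n + 1/2)"
    using Gamma_plus1_pos[of "real n + 1/2"] by (simp add: add_ac)
  have 2: "Gamma (real (Suc n) + 1) = (real n + 1) * Gamma (real n + 1)"
    using Gamma_plus1_pos[of "real n + 1"] by (simp add: add_ac)
  define g where "g = Gamma (real n + 1)"
  define k where "k = Gamma (1/4 :: real)"
  have g: "g > 0" "k > 0" by (auto simp: g_def k_def Gamma_real_pos)
  have "h_const (Suc n) = pi * sqrt 2 * ((real n + 1/2) * Gamma (real n + 1/2)) / ((real n + 1) * g * (real n + 5/4) * k\<^sup>2)"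
    unfolding h_const_def 1 2 g_def k_def by (simp add: add_ac)
  moreover have "h_const n = pi * sqrt 2 * Gamma (real n + 1/2) / (g * (real n + 1/4) * k\<^sup>2)"
    by (simp add: h_const_def g_def k_def)
  moreover have "real n + 1 \<noteq> 0" "real n + 5/4 \<noteq> 0" "real n + 1/4 \<noteq> 0" by auto
  ultimately show ?thesis using g by simp
qed

text \<open>Green's formula applied in both orders gives two eigenvalues for the same inner product.\<close>

lemma gcos_orthogonal:
  assumes "m \<noteq> n" shows "H_inner (gcos m) (gcos n) = 0"
proof -
  have 1: "H_inner (dgcos m) (dgcos n) = real n * (real n + 1/2) * H_inner (gcos m) (gcos n)" for m n
    by (rule green_formula[OF gcos_H dgcos_H gcos_weak_deriv])
  have "H_inner (dgcos m) (dgcos n) = cnj (H_inner (dgcos n) (dgcos m))" by (rule H_inner_cnj)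
  also have "\<dots> = real m * (real m + 1/2) * cnj (H_inner (gcos n) (gcos m))" unfolding 1 by simp
  also have "cnj (H_inner (gcos n) (gcos m)) = H_inner (gcos m) (gcos n)" by (rule H_inner_cnj[symmetric])
  finally have "real n * (real n + 1/2) * H_inner (gcos m) (gcos n) = real m * (real m + 1/2) * H_inner (gcos m) (gcos n)"
    unfolding 1 .
  then have "complex_of_real ((real n - real m) * (real n + real m + 1/2)) * H_inner (gcos m) (gcos n) = 0"
  proof -
    have "complex_of_real ((real n - real m) * (real n + real m + 1/2)) =
        complex_of_real (real n * (real n + 1/2)) - complex_of_real (real m * (real m + 1/2))"
      unfolding of_real_diff[symmetric] by (rule arg_cong[of _ _ complex_of_real]) (simp add: field_simps)
    then show ?thesis
      using \<open>real n * (real n + 1/2) * H_inner (gcos m) (gcos n) = real m * (real m + 1/2) * H_inner (gcos m) (gcos n)\<close>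
      by (simp only: left_diff_distrib) simp
  qed
  moreover have "(real n - real m) * (real n + real m + 1/2) \<noteq> 0" using assms by simp
  ultimately show ?thesis by (metis mult_eq_0_iff of_real_eq_0_iff)
qed

lemma gcos_rec: "2 * (real n + 5/4) * (complex_of_real (cos x) * gcos (Suc n) x) =
    (real n + 2) * gcos (Suc (Suc n)) x + (real n + 1/2) * gcos n x"
proof -
  have "2 * (real n + 5/4) * (cos x * gegenbauer (1/4) (Suc n) (cos x)) =
      (real n + 2) * gegenbauer (1/4) (Suc (Suc n)) (cos x) + (real n + 1/2) * gegenbauer (1/4) n (cos x)"
    using gegenbauer_rec[of n "1/4" "cos x"] by (simp add: algebra_simps del: gegenbauer.simps)
  from arg_cong[OF this, of complex_of_real] show ?thesis by (simp add: gcos_def del: gegenbauer.simps)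
qed

lemma gcos_rec0: "complex_of_real (cos x) * gcos 0 x = 2 * gcos (Suc 0) x"
  by (simp add: gcos_def)

text \<open>The three-term recurrence as multiplication by \<open>cos\<close>; at \<open>n = 0\<close> the index \<open>n - 1\<close> is truncated to
  \<open>0\<close> and its coefficient vanishes.\<close>

lemma cos_gcos_eq:
  "\<exists>b. (\<lambda>x. 2 * (real n + 1/4) * (complex_of_real (cos x) * gcos n x)) =
     (\<lambda>x. (real n + 1) * gcos (Suc n) x + complex_of_real b * gcos (n - 1) x) \<and> (n = 0 \<longrightarrow> b = 0)"
proof (cases n)
  case 0
  then show ?thesis using gcos_rec0 by (intro exI[of _ 0]) (simp add: fun_eq_iff)
next
  case (Suc k)
  then show ?thesis using gcos_rec[of k]
    by (intro exI[of _ "real k + 1/2"]) (simp add: fun_eq_iff add_ac)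
qed

text \<open>Multiplication by \<open>cos\<close> is symmetric. Its matrix entry between \<open>n\<close> and \<open>n + 1\<close> is computed from the
  recurrence in both rows.\<close>

lemma gcos_norm_rec:
  "(real n + 1) * (real n + 5/4) * (H_norm (gcos (Suc n)))\<^sup>2 = (real n + 1/4) * (real n + 1/2) * (H_norm (gcos n))\<^sup>2"
proof -
  define X where "X = H_inner (\<lambda>x. complex_of_real (cos x) * gcos n x) (gcos (Suc n))"
  have X': "H_inner (\<lambda>x. complex_of_real (cos x) * gcos (Suc n) x) (gcos n) = cnj X"
    unfolding X_def H_inner_cnj[of "\<lambda>x. complex_of_real (cos x) * gcos n x" "gcos (Suc n)"] complex_cnj_cnj
    by (simp add: H_inner_def gcos_def mult_ac)
  obtain b where b: "(\<lambda>x. 2 * (real n + 1/4) * (complex_of_real (cos x) * gcos n x)) =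
     (\<lambda>x. (real n + 1) * gcos (Suc n) x + complex_of_real b * gcos (n - 1) x)"
    using cos_gcos_eq by blast
  have o: "H_inner (gcos (n - 1)) (gcos (Suc n)) = 0" "H_inner (gcos (Suc (Suc n))) (gcos n) = 0"
    by (auto intro!: gcos_orthogonal)
  have "2 * (real n + 1/4) * X = H_inner (\<lambda>x. 2 * (real n + 1/4) * (complex_of_real (cos x) * gcos n x)) (gcos (Suc n))"
    unfolding X_def by (rule H_inner_scale_left[symmetric])
  also have "\<dots> = (real n + 1) * complex_of_real ((H_norm (gcos (Suc n)))\<^sup>2)"
    unfolding b by (subst H_inner_add_left) (simp_all add: H_scale gcos_H H_inner_scale_left o[unfolded One_nat_def] H_inner_self)
  finally have 1: "2 * (real n + 1/4) * X = complex_of_real ((real n + 1) * (H_norm (gcos (Suc n)))\<^sup>2)" by simp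
  have "2 * (real n + 5/4) * cnj X = H_inner (\<lambda>x. 2 * (real n + 5/4) * (complex_of_real (cos x) * gcos (Suc n) x)) (gcos n)"
    unfolding X'[symmetric] by (rule H_inner_scale_left[symmetric])
  also have "\<dots> = (real n + 1/2) * complex_of_real ((H_norm (gcos n))\<^sup>2)"
    unfolding gcos_rec by (subst H_inner_add_left) (simp_all add: H_scale gcos_H H_inner_scale_left o H_inner_self)
  finally have 2: "2 * (real n + 5/4) * cnj X = complex_of_real ((real n + 1/2) * (H_norm (gcos n))\<^sup>2)" by simp
  have r1: "2 * (real n + 1/4) * Re X = (real n + 1) * (H_norm (gcos (Suc n)))\<^sup>2"
    using arg_cong[OF 1, of Re] by simp
  have r2: "2 * (real n + 5/4) * Re X = (real n + 1/2) * (H_norm (gcos n))\<^sup>2"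
    using arg_cong[OF 2, of Re] by simp
  have "(real n + 1) * (real n + 5/4) * (H_norm (gcos (Suc n)))\<^sup>2 = (real n + 5/4) * (2 * (real n + 1/4) * Re X)"
    unfolding r1 by simp
  also have "\<dots> = (real n + 1/4) * (2 * (real n + 5/4) * Re X)" by (simp only: mult_ac)
  also have "\<dots> = (real n + 1/4) * (real n + 1/2) * (H_norm (gcos n))\<^sup>2" unfolding r2 by simp
  finally show ?thesis .
qed

theorem gcos_norm: "(H_norm (gcos n))\<^sup>2 = h_const n"
proof (induction n)
  case 0
  show ?case unfolding H_norm_sq h_const_0 integral_weight[symmetric] by (simp add: gcos_def)
next
  case (Suc n)
  have "((real n + 1) * (real n + 5/4)) * (H_norm (gcos (Suc n)))\<^sup>2 = ((real n + 1) * (real n + 5/4)) * h_const (Suc n)"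
    using gcos_norm_rec[of n] h_const_Suc[of n] Suc by (simp add: mult.commute)
  moreover have "(real n + 1) * (real n + 5/4) \<noteq> 0" by simp
  ultimately show ?case by (metis mult_left_cancel)
qed

definition dPhi :: "nat \<Rightarrow> real \<Rightarrow> complex" where
  "dPhi n x = complex_of_real (1 / sqrt (h_const n)) * dgcos n x"

lemma Phi_eq: "Phi n = (\<lambda>x. complex_of_real (1 / sqrt (h_const n)) * gcos n x)"
  by (simp add: Phi_def gcos_def fun_eq_iff)

lemma Phi_H: "Phi n \<in> H_space" and dPhi_H: "dPhi n \<in> H_space"
  unfolding Phi_eq dPhi_def[abs_def] by (intro H_scale gcos_H dgcos_H)+

lemma Phi_weak_deriv: "is_weak_deriv (Phi n) (dPhi n)"
  using is_weak_deriv_sum[of "{n}" gcos dgcos "\<lambda>_. complex_of_real (1 / sqrt (h_const n))"]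
  by (simp add: gcos_H dgcos_H gcos_weak_deriv Phi_eq dPhi_def[abs_def])

lemma Phi_V: "Phi n \<in> V_space" and Phi_deriv_AE: "AE x in Mw. weak_deriv (Phi n) x = dPhi n x"
  using V_spaceI[OF Phi_H dPhi_H Phi_weak_deriv] by auto

lemma Phi_orthonormal: "H_inner (Phi m) (Phi n) = (if m = n then 1 else 0)"
proof (cases "m = n")
  case True
  have "H_inner (Phi n) (Phi n) = complex_of_real (1 / sqrt (h_const n) * (1 / sqrt (h_const n)) * h_const n)"
    unfolding Phi_eq H_inner_scale_left H_inner_scale_right
    unfolding H_inner_self gcos_norm by (simp only: of_real_mult complex_cnj_complex_of_real mult.assoc)
  also have "1 / sqrt (h_const n) * (1 / sqrt (h_const n)) * h_const n = 1" using h_const_pos[of n] by simp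
  finally show ?thesis using True by simp
next
  case False
  then show ?thesis unfolding Phi_eq H_inner_scale_left H_inner_scale_right by (simp add: gcos_orthogonal)
qed

text \<open>A quarter of the eigenvalue \<open>2n (2n + 1)\<close>, and the squared norm of the derivative of \<open>\<Phi>\<^sub>n\<close>.\<close>

definition mu :: "nat \<Rightarrow> real" where "mu n = real n * (real n + 1/2)"

lemma green_Phi:
  assumes "f \<in> H_space" "g \<in> H_space" "is_weak_deriv f g"
  shows "H_inner g (dPhi n) = mu n * H_inner f (Phi n)"
  unfolding dPhi_def[abs_def] Phi_eq H_inner_scale_right green_formula[OF assms] mu_def by simp

lemma dPhi_orthogonal: "H_inner (dPhi m) (dPhi n) = (if m = n then complex_of_real (mu n) else 0)"
  using green_Phi[OF Phi_H dPhi_H Phi_weak_deriv, of m n] by (simp add: Phi_orthonormal)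

lemma H_inner_gcos_powers:
  assumes f: "f \<in> H_space" and z: "\<And>n. H_inner f (gcos n) = 0"
  shows "H_inner f (\<lambda>x. complex_of_real (cos x) ^ k * gcos n x) = 0"
proof (induction k arbitrary: n)
  case 0
  then show ?case using z by simp
next
  case (Suc k)
  let ?c = "\<lambda>n x. complex_of_real (cos x) ^ k * gcos n x"
  have H: "?c n \<in> H_space" for n by (intro continuous_H_space continuous_intros gcos_cont)
  obtain b where b: "(\<lambda>x. 2 * (real n + 1/4) * (complex_of_real (cos x) * gcos n x)) =
     (\<lambda>x. (real n + 1) * gcos (Suc n) x + complex_of_real b * gcos (n - 1) x)"
    using cos_gcos_eq by blast
  have "H_inner f (\<lambda>x. complex_of_real (2 * (real n + 1/4)) * (complex_of_real (cos x) ^ Suc k * gcos n x)) =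
      H_inner f (\<lambda>x. complex_of_real (real n + 1) * ?c (Suc n) x - complex_of_real (- b) * ?c (n - 1) x)"
  proof (intro arg_cong[of _ _ "H_inner f"] ext)
    fix x
    have "complex_of_real (2 * (real n + 1/4)) * (complex_of_real (cos x) ^ Suc k * gcos n x) =
        complex_of_real (cos x) ^ k * (2 * (real n + 1/4) * (complex_of_real (cos x) * gcos n x))" by simp
    also have "\<dots> = complex_of_real (cos x) ^ k * ((real n + 1) * gcos (Suc n) x + complex_of_real b * gcos (n - 1) x)"
      using fun_cong[OF b, of x] by simp
    also have "\<dots> = complex_of_real (real n + 1) * ?c (Suc n) x - complex_of_real (- b) * ?c (n - 1) x"
      by (simp add: algebra_simps)
    finally show "complex_of_real (2 * (real n + 1/4)) * (complex_of_real (cos x) ^ Suc k * gcos n x) =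
      complex_of_real (real n + 1) * ?c (Suc n) x - complex_of_real (- b) * ?c (n - 1) x" .
  qed
  also have "\<dots> = 0"
    by (subst H_inner_diff_right) (simp_all add: H_scale H f H_inner_scale_right Suc del: of_real_minus of_real_add)
  finally show ?case unfolding H_inner_scale_right by (auto simp: complex_eq_iff)
qed

lemma H_inner_poly_cos:
  assumes f: "f \<in> H_space" and z: "\<And>n. H_inner f (gcos n) = 0"
  shows "H_inner f (\<lambda>x. complex_of_real (\<Sum>i\<le>N. a i * cos x ^ i)) = 0"
proof -
  have 1: "gcos 0 = (\<lambda>x. 1)" by (simp add: gcos_def fun_eq_iff)
  have "(\<lambda>x. complex_of_real (\<Sum>i\<le>N. a i * cos x ^ i)) =
      (\<lambda>x. \<Sum>i\<le>N. complex_of_real (a i) * (complex_of_real (cos x) ^ i * gcos 0 x))" by (simp add: 1)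
  then show ?thesis
    using f H_inner_gcos_powers[OF f z]
    by (simp only:) (subst H_inner_sum_right,
      auto intro!: H_scale continuous_H_space continuous_intros gcos_cont sum.neutral simp: H_inner_scale_right)
qed

text \<open>A function orthogonal to all eigenfunctions is orthogonal to all polynomials in \<open>cos\<close>, hence, by
  Weierstrass, to all continuous functions and in particular to all test functions.\<close>

theorem Phi_complete:
  assumes f: "f \<in> H_space" and z: "\<And>n. H_inner f (Phi n) = 0"
  shows "AE x in Mw. f x = 0"
proof -
  have zg: "H_inner f (gcos n) = 0" for n
    using z[of n] h_const_pos[of n] unfolding Phi_eq H_inner_scale_right by simp
  have zc: "H_inner f (\<lambda>x. complex_of_real (\<psi> x)) = 0" if \<psi>: "continuous_on UNIV \<psi>" for \<psi> :: "real \<Rightarrow> real"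
  proof -
    let ?u = "\<lambda>x. complex_of_real (\<psi> x)"
    have u: "?u \<in> H_space" by (intro continuous_H_space continuous_intros \<psi>)
    define T where "T = sqrt (LINT x|Mw. (1::real))"
    have T: "0 \<le> T" by (simp add: T_def)
    have eps: "cmod (H_inner f ?u) \<le> e" if "0 < e" for e
    proof -
      define e' where "e' = e / (H_norm f * T + 1)"
      have pos: "0 < H_norm f * T + 1" using T by (simp add: add_nonneg_pos)
      then have e': "0 < e'" using that by (simp add: e'_def)
      have "continuous_on {-1..1} (\<lambda>x. \<psi> (arccos x))"
        by (rule continuous_on_compose2[OF \<psi> continuous_on_arccos']) auto
      then obtain g where g: "real_polynomial_function g" "\<And>x. x \<in> {-1..1} \<Longrightarrow> \<bar>\<psi> (arccos x) - g x\<bar> < e'"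
        using Stone_Weierstrass_real_polynomial_function[of "{-1..1}" "\<lambda>x. \<psi> (arccos x)" e'] e' by auto
      obtain a N where gN: "g = (\<lambda>x. \<Sum>i\<le>N. a i * x ^ i)"
        using g(1) real_polynomial_function_iff_sum by blast
      let ?p = "\<lambda>x. complex_of_real (\<Sum>i\<le>N. a i * cos x ^ i)"
      have p: "?p \<in> H_space" by (intro continuous_H_space continuous_intros)
      have d: "(\<lambda>x. ?u x - ?p x) \<in> H_space" by (rule H_diff[OF u p])
      have "cmod (?u x - ?p x) \<le> e'" if "0 < x" "x < pi" for x
      proof -
        have "?u x - ?p x = complex_of_real (\<psi> (arccos (cos x)) - g (cos x))"
          using that by (simp add: gN arccos_cos)
        then have "cmod (?u x - ?p x) = \<bar>\<psi> (arccos (cos x)) - g (cos x)\<bar>" by (simp only: norm_of_real)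
        then show ?thesis using g(2)[of "cos x"] by simp
      qed
      then have "(LINT x|Mw. (cmod (?u x - ?p x))\<^sup>2) \<le> (LINT x|Mw. e'\<^sup>2)"
        using d by (intro integral_mono_AE H_space_integrable) (auto intro!: AE_I2 power_mono)
      then have "H_norm (\<lambda>x. ?u x - ?p x) \<le> sqrt (e'\<^sup>2 * (LINT x|Mw. (1::real)))"
        unfolding H_norm_def by (intro real_sqrt_le_mono) (simp add: mult.commute)
      also have "\<dots> = e' * T" using e' by (simp add: real_sqrt_mult T_def)
      finally have n: "H_norm (\<lambda>x. ?u x - ?p x) \<le> e' * T" .
      have "H_inner f ?u = H_inner f (\<lambda>x. ?u x - ?p x)"
        using H_inner_diff_right[OF u p f] H_inner_poly_cos[OF f zg, of a N] by simp
      then have "cmod (H_inner f ?u) \<le> H_norm f * H_norm (\<lambda>x. ?u x - ?p x)"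
        using H_Cauchy_Schwarz[OF f d] by simp
      also have "\<dots> \<le> H_norm f * (e' * T)" using n by (intro mult_left_mono) auto
      also have "\<dots> \<le> e' * (H_norm f * T + 1)" using e' by (simp add: algebra_simps)
      also have "\<dots> = e" using pos by (simp add: e'_def)
      finally show ?thesis .
    qed
    have "cmod (H_inner f ?u) \<le> 0" by (rule field_le_epsilon) (simp add: eps)
    then show ?thesis by simp
  qed
  have "AE x in lborel. 0 < x \<and> x < pi \<longrightarrow> weight x *\<^sub>R f x = 0"
  proof (rule fundamental_lemma_calculus_variations)
    fix a b assume ab: "0 < a" "a < b" "b < pi"
    show "set_integrable lborel {a..b} (\<lambda>x. weight x *\<^sub>R f x)"
      unfolding set_integrable_def
    proof (rule Bochner_Integration.integrable_bound)
      have i: "integrable lborel (\<lambda>x. indicator {a..b} x *\<^sub>R f x)"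
        using L2_loc_integrable[OF H_space_L2_loc[OF f] ab] by (simp add: set_integrable_def)
      then show "integrable lborel (\<lambda>x. indicator {a..b} x *\<^sub>R f x)" .
      have "(\<lambda>x. weight x *\<^sub>R (indicator {a..b} x *\<^sub>R f x)) \<in> borel_measurable lborel"
        using borel_measurable_integrable[OF i] by measurable
      then show "(\<lambda>x. indicator {a..b} x *\<^sub>R (weight x *\<^sub>R f x)) \<in> borel_measurable lborel" by (simp add: mult.commute)
      have "\<bar>weight x\<bar> \<le> 1" if "x \<in> {a..b}" for x
        using weight_pos[of x] weight_le_1[of x] that ab by auto
      then show "AE x in lborel. norm (indicator {a..b} x *\<^sub>R (weight x *\<^sub>R f x)) \<le> norm (indicator {a..b} x *\<^sub>R f x)"
        by (intro AE_I2) (auto simp: indicator_def intro: mult_left_le_one_le)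
    qed
  next
    fix \<psi> assume \<psi>: "\<psi> \<in> test_functions"
    then have c: "continuous_on UNIV \<psi>" using test_functionsE by metis
    let ?u = "\<lambda>x. complex_of_real (\<psi> x)"
    have u: "?u \<in> H_space" by (intro continuous_H_space continuous_intros c)
    have "(\<lambda>x. f x * cnj (?u x)) \<in> borel_measurable Mw"
      by (rule borel_measurable_integrable[OF H_inner_integrable[OF f u]])
    then have "H_inner f ?u = (LINT x:{0<..<pi}|lborel. weight x *\<^sub>R (f x * cnj (?u x)))"
      unfolding H_inner_def borel_measurable_Mw by (rule integral_Mw)
    then show "(LINT x:{0<..<pi}|lborel. (weight x *\<^sub>R f x) * complex_of_real (\<psi> x)) = 0"
      using zc[OF c] by simp
  qed
  then show ?thesis unfolding AE_Mw
  proof eventually_elim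
    case (elim x)
    then show ?case using weight_pos[of x] by auto
  qed
qed

section \<open>Expansion in the eigenbasis\<close>

lemma orthogonal_sum_norm:
  assumes e: "\<And>i. e i \<in> H_space" and o: "\<And>i j. i \<noteq> j \<Longrightarrow> H_inner (e i) (e j) = 0" and fin: "finite A"
  shows "(H_norm (\<lambda>x. \<Sum>i\<in>A. c i * e i x))\<^sup>2 = (\<Sum>i\<in>A. (cmod (c i))\<^sup>2 * (H_norm (e i))\<^sup>2)"
proof -
  let ?S = "\<lambda>x. \<Sum>i\<in>A. c i * e i x"
  have S: "?S \<in> H_space" by (intro H_sum H_scale e)
  have i: "H_inner (e i) ?S = cnj (c i) * complex_of_real ((H_norm (e i))\<^sup>2)" if "i \<in> A" for i
  proof -
    have "H_inner (e i) ?S = (\<Sum>j\<in>A. cnj (c j) * H_inner (e i) (e j))"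
      by (subst H_inner_sum_right) (auto intro!: H_scale e simp: H_inner_scale_right)
    also have "\<dots> = (\<Sum>j\<in>A. if j = i then cnj (c i) * complex_of_real ((H_norm (e i))\<^sup>2) else 0)"
      using o by (intro sum.cong) (auto simp: H_inner_self)
    finally show ?thesis using that fin by simp
  qed
  have "complex_of_real ((H_norm ?S)\<^sup>2) = H_inner ?S ?S" by (rule H_inner_self[symmetric])
  also have "\<dots> = (\<Sum>i\<in>A. c i * H_inner (e i) ?S)"
    using S by (subst H_inner_sum_left) (auto intro!: H_scale e simp: H_inner_scale_left)
  also have "\<dots> = (\<Sum>i\<in>A. complex_of_real ((cmod (c i))\<^sup>2 * (H_norm (e i))\<^sup>2))"
    using i by (intro sum.cong refl) (simp add: mult.assoc[symmetric] complex_norm_square[symmetric])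
  finally show ?thesis unfolding of_real_sum[symmetric] of_real_eq_iff .
qed

theorem orthogonal_series_converges:
  assumes e: "\<And>i. e i \<in> H_space" and o: "\<And>i j. i \<noteq> j \<Longrightarrow> H_inner (e i) (e j) = 0"
    and s: "summable (\<lambda>i. (cmod (c i))\<^sup>2 * (H_norm (e i))\<^sup>2)"
  obtains f where "f \<in> H_space" "(\<lambda>N. H_norm (\<lambda>x. f x - (\<Sum>i<N. c i * e i x))) \<longlonglongrightarrow> 0"
proof (rule H_complete[of "\<lambda>N x. \<Sum>i<N. c i * e i x"])
  show "(\<lambda>x. \<Sum>i<N. c i * e i x) \<in> H_space" for N by (intro H_sum H_scale e)
  fix r :: real assume r: "0 < r"
  then have "0 < r\<^sup>2" by simp
  then obtain N where N: "\<And>m n. m \<ge> N \<Longrightarrow> norm (\<Sum>i=m..<n. (cmod (c i))\<^sup>2 * (H_norm (e i))\<^sup>2) < r\<^sup>2"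
    using s unfolding summable_Cauchy by blast
  have *: "H_norm (\<lambda>x. (\<Sum>i<n. c i * e i x) - (\<Sum>i<m. c i * e i x)) < r" if "N \<le> m" "m \<le> n" for m n
  proof -
    have "(\<lambda>x. (\<Sum>i<n. c i * e i x) - (\<Sum>i<m. c i * e i x)) = (\<lambda>x. \<Sum>i=m..<n. c i * e i x)"
    proof
      show "(\<Sum>i<n. c i * e i x) - (\<Sum>i<m. c i * e i x) = (\<Sum>i=m..<n. c i * e i x)" for x
        using sum_lessThan_split[OF that(2), of "\<lambda>i. c i * e i x"] by simp
    qed
    then have "(H_norm (\<lambda>x. (\<Sum>i<n. c i * e i x) - (\<Sum>i<m. c i * e i x)))\<^sup>2 = (\<Sum>i=m..<n. (cmod (c i))\<^sup>2 * (H_norm (e i))\<^sup>2)"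
      using orthogonal_sum_norm[OF e o finite_atLeastLessThan[of m n], where c=c] by simp
    also have "\<dots> < r\<^sup>2" using N[OF that(1), of n] by (simp add: abs_less_iff)
    finally show ?thesis using r by (auto intro: power_less_imp_less_base)
  qed
  show "\<exists>N. \<forall>m\<ge>N. \<forall>n\<ge>N. H_norm (\<lambda>x. (\<Sum>i<m. c i * e i x) - (\<Sum>i<n. c i * e i x)) < r"
  proof (intro exI[of _ N] allI impI)
    fix m n assume "N \<le> m" "N \<le> n"
    then show "H_norm (\<lambda>x. (\<Sum>i<m. c i * e i x) - (\<Sum>i<n. c i * e i x)) < r"
      using *[of m n] *[of n m] H_norm_minus_commute[of "\<lambda>x. \<Sum>i<m. c i * e i x" "\<lambda>x. \<Sum>i<n. c i * e i x"]
      by (cases "m \<le> n") auto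
  qed
qed (rule that)

definition coef :: "(real \<Rightarrow> complex) \<Rightarrow> nat \<Rightarrow> complex" where
  "coef f n = H_inner f (Phi n)"

definition psum :: "(nat \<Rightarrow> complex) \<Rightarrow> nat \<Rightarrow> real \<Rightarrow> complex" where
  "psum c N x = (\<Sum>n<N. c n * Phi n x)"

lemma psum_H: "psum c N \<in> H_space"
  unfolding psum_def[abs_def] by (intro H_sum H_scale Phi_H)

lemma H_norm_Phi: "(H_norm (Phi n))\<^sup>2 = 1"
  using H_inner_self[of "Phi n"] Phi_orthonormal[of n n] by (metis of_real_eq_1_iff)

lemma H_norm_dPhi: "(H_norm (dPhi n))\<^sup>2 = mu n"
  using H_inner_self[of "dPhi n"] dPhi_orthogonal[of n n] by (metis of_real_eq_iff)

lemma coef_psum: "coef (psum c N) m = (if m < N then c m else 0)"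
proof -
  have "coef (psum c N) m = (\<Sum>n<N. c n * H_inner (Phi n) (Phi m))"
    unfolding coef_def psum_def[abs_def]
    by (subst H_inner_sum_left) (auto intro!: H_scale Phi_H simp: H_inner_scale_left)
  also have "\<dots> = (\<Sum>n<N. if n = m then c m else 0)" by (intro sum.cong) (auto simp: Phi_orthonormal)
  finally show ?thesis by simp
qed

lemma coef_limit:
  assumes "f \<in> H_space" "(\<lambda>N. H_norm (\<lambda>x. f x - psum c N x)) \<longlonglongrightarrow> 0"
  shows "coef f = c"
proof
  fix m
  have "(\<lambda>N. coef (psum c N) m) \<longlonglongrightarrow> coef f m"
    unfolding coef_def by (rule H_inner_tendsto[OF psum_H assms(1) Phi_H assms(2)])
  moreover have "(\<lambda>N. coef (psum c N) m) \<longlonglongrightarrow> c m"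
    by (rule tendsto_eventually) (auto simp: coef_psum eventually_sequentially intro!: exI[of _ "Suc m"])
  ultimately show "coef f m = c m" by (rule LIMSEQ_unique)
qed

lemma Bessel:
  assumes "f \<in> H_space" shows "(\<Sum>n<N. (cmod (coef f n))\<^sup>2) \<le> (H_norm f)\<^sup>2"
proof -
  have "H_inner f (psum (coef f) N) = (\<Sum>n<N. cnj (coef f n) * coef f n)"
    unfolding psum_def[abs_def]
    by (subst H_inner_sum_right) (auto intro!: H_scale Phi_H assms simp: H_inner_scale_right coef_def)
  also have "\<dots> = complex_of_real (\<Sum>n<N. (cmod (coef f n))\<^sup>2)" by (simp add: complex_norm_square[symmetric] mult.commute)
  finally have i: "Re (H_inner f (psum (coef f) N)) = (\<Sum>n<N. (cmod (coef f n))\<^sup>2)" by simp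
  have n: "(H_norm (psum (coef f) N))\<^sup>2 = (\<Sum>n<N. (cmod (coef f n))\<^sup>2)"
    using orthogonal_sum_norm[of Phi "{..<N}" "coef f", OF Phi_H] Phi_orthonormal
    by (simp add: psum_def[abs_def] H_norm_Phi)
  have "0 \<le> (H_norm (\<lambda>x. f x - psum (coef f) N x))\<^sup>2" by simp
  also have "\<dots> = (H_norm f)\<^sup>2 - (\<Sum>n<N. (cmod (coef f n))\<^sup>2)"
    by (simp add: H_norm_diff_sq assms psum_H i n)
  finally show ?thesis by simp
qed

lemma coef_summable: assumes "f \<in> H_space" shows "summable (\<lambda>n. (cmod (coef f n))\<^sup>2)"
  by (rule summableI_nonneg_bounded[OF _ Bessel[OF assms]]) simp

lemma coef_determines:
  assumes "f \<in> H_space" "g \<in> H_space" "coef f = coef g"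
  shows "AE x in Mw. f x = g x"
proof -
  have "H_inner (\<lambda>x. f x - g x) (Phi n) = 0" for n
    using fun_cong[OF assms(3), of n] assms(1,2) by (simp add: H_inner_diff_left Phi_H coef_def)
  then have "AE x in Mw. f x - g x = 0" using Phi_complete H_diff assms(1,2) by blast
  then show ?thesis by eventually_elim simp
qed

theorem Riesz_Fischer:
  assumes "summable (\<lambda>n. (cmod (c n))\<^sup>2)"
  obtains f where "f \<in> H_space" "coef f = c" "(\<lambda>N. H_norm (\<lambda>x. f x - psum c N x)) \<longlonglongrightarrow> 0"
proof -
  obtain f where f: "f \<in> H_space" "(\<lambda>N. H_norm (\<lambda>x. f x - (\<Sum>i<N. c i * Phi i x))) \<longlonglongrightarrow> 0"
    using orthogonal_series_converges[of Phi c, OF Phi_H] Phi_orthonormal assms by (auto simp: H_norm_Phi)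
  then have "(\<lambda>N. H_norm (\<lambda>x. f x - psum c N x)) \<longlonglongrightarrow> 0" by (simp add: psum_def)
  then show ?thesis using that f(1) coef_limit by blast
qed

theorem psum_coef_tendsto:
  assumes "f \<in> H_space" shows "(\<lambda>N. H_norm (\<lambda>x. f x - psum (coef f) N x)) \<longlonglongrightarrow> 0"
proof -
  obtain g where g: "g \<in> H_space" "coef g = coef f" "(\<lambda>N. H_norm (\<lambda>x. g x - psum (coef f) N x)) \<longlonglongrightarrow> 0"
    using Riesz_Fischer[OF coef_summable[OF assms]] by blast
  have ae: "AE x in Mw. g x = f x" by (rule coef_determines[OF g(1) assms g(2)])
  have "AE x in Mw. g x - psum (coef f) N x = f x - psum (coef f) N x" for N
    using ae by eventually_elim simp
  then have "H_norm (\<lambda>x. g x - psum (coef f) N x) = H_norm (\<lambda>x. f x - psum (coef f) N x)" for N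
    by (intro H_norm_cong_AE H_diff psum_H g assms)
  then show ?thesis using g(3) by simp
qed

theorem Parseval: assumes "f \<in> H_space" shows "(\<lambda>n. (cmod (coef f n))\<^sup>2) sums (H_norm f)\<^sup>2"
proof -
  have "(\<lambda>N. (H_norm (psum (coef f) N))\<^sup>2) \<longlonglongrightarrow> (H_norm f)\<^sup>2"
    by (intro tendsto_power H_norm_tendsto[OF psum_H assms psum_coef_tendsto[OF assms]])
  moreover have "(H_norm (psum (coef f) N))\<^sup>2 = (\<Sum>n<N. (cmod (coef f n))\<^sup>2)" for N
    using orthogonal_sum_norm[of Phi "{..<N}" "coef f", OF Phi_H] Phi_orthonormal
    by (simp add: psum_def[abs_def] H_norm_Phi)
  ultimately show ?thesis by (simp add: sums_def)
qed

lemma kappa_sq: "(kappa n)\<^sup>2 = 4 * mu n + 1/4"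
  by (simp add: kappa_def mu_def power2_eq_square algebra_simps)

lemma kappa_pos: "0 < kappa n" by (simp add: kappa_def)

lemma mu_nonneg: "0 \<le> mu n" by (simp add: mu_def)

definition dpsum :: "(nat \<Rightarrow> complex) \<Rightarrow> nat \<Rightarrow> real \<Rightarrow> complex" where
  "dpsum c N x = (\<Sum>n<N. c n * dPhi n x)"

lemma dpsum_H: "dpsum c N \<in> H_space"
  unfolding dpsum_def[abs_def] by (intro H_sum H_scale dPhi_H)

lemma psum_weak_deriv: "is_weak_deriv (psum c N) (dpsum c N)"
  unfolding psum_def[abs_def] dpsum_def[abs_def]
  by (rule is_weak_deriv_sum[OF Phi_H dPhi_H Phi_weak_deriv])

lemma psum_V: "psum c N \<in> V_space"
  by (rule V_spaceI(1)[OF psum_H dpsum_H psum_weak_deriv])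

lemma V_norm_diff_psum:
  assumes "f \<in> V_space" "AE x in Mw. weak_deriv f x = g x" "g \<in> H_space"
  shows "V_norm (\<lambda>x. f x - psum c N x) = sqrt (4 * (H_norm (\<lambda>x. g x - dpsum c N x))\<^sup>2 + (H_norm (\<lambda>x. f x - psum c N x))\<^sup>2)"
proof -
  note D = V_diff[OF assms(1) psum_V[of c N]]
  have "AE x in Mw. weak_deriv (psum c N) x = dpsum c N x"
    by (rule V_spaceI(2)[OF psum_H dpsum_H psum_weak_deriv])
  with D(2) assms(2) have "AE x in Mw. weak_deriv (\<lambda>x. f x - psum c N x) x = g x - dpsum c N x"
    by eventually_elim simp
  then have "H_norm (weak_deriv (\<lambda>x. f x - psum c N x)) = H_norm (\<lambda>x. g x - dpsum c N x)"
    by (rule H_norm_cong_AE[OF V_weak_deriv(2)[OF D(1)] H_diff[OF assms(3) dpsum_H]])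
  then show ?thesis using V_norm_sq[OF D(1)] by simp
qed

text \<open>The partial sums and their derivatives are both orthogonal series and converge separately. The
  limits are related by a weak derivative because that relation is closed.\<close>

lemma V_limit_exists:
  assumes s: "summable (\<lambda>n. (kappa n)\<^sup>2 * (cmod (c n))\<^sup>2)"
  obtains f where "f \<in> V_space" "(\<lambda>N. V_norm (\<lambda>x. f x - psum c N x)) \<longlonglongrightarrow> 0"
    "(\<lambda>N. H_norm (\<lambda>x. weak_deriv f x - dpsum c N x)) \<longlonglongrightarrow> 0"
proof -
  have "summable (\<lambda>n. (cmod (c n))\<^sup>2)"
  proof (rule summable_comparison_test'[of "\<lambda>n. 4 * ((kappa n)\<^sup>2 * (cmod (c n))\<^sup>2)"])
    show "norm ((cmod (c n))\<^sup>2) \<le> 4 * ((kappa n)\<^sup>2 * (cmod (c n))\<^sup>2)" for n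
      using mult_right_mono[of 1 "4 * (kappa n)\<^sup>2" "(cmod (c n))\<^sup>2"] mu_nonneg[of n] by (simp add: kappa_sq algebra_simps)
  qed (use s in simp)
  then obtain f where f: "f \<in> H_space" "(\<lambda>N. H_norm (\<lambda>x. f x - psum c N x)) \<longlonglongrightarrow> 0"
    using Riesz_Fischer by blast
  have "summable (\<lambda>n. (cmod (c n))\<^sup>2 * (H_norm (dPhi n))\<^sup>2)"
  proof (rule summable_comparison_test'[OF s])
    show "norm ((cmod (c n))\<^sup>2 * (H_norm (dPhi n))\<^sup>2) \<le> (kappa n)\<^sup>2 * (cmod (c n))\<^sup>2" for n
      using mult_right_mono[of "mu n" "(kappa n)\<^sup>2" "(cmod (c n))\<^sup>2"] mu_nonneg[of n]
      by (simp add: kappa_sq H_norm_dPhi mult.commute)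
  qed
  then obtain g where g: "g \<in> H_space" "(\<lambda>N. H_norm (\<lambda>x. g x - dpsum c N x)) \<longlonglongrightarrow> 0"
    using orthogonal_series_converges[of dPhi c, OF dPhi_H] dPhi_orthogonal unfolding dpsum_def by auto
  have w: "is_weak_deriv f g"
    by (rule is_weak_deriv_limit[OF psum_H dpsum_H psum_weak_deriv f(1) g(1) f(2) g(2)])
  note V = V_spaceI[OF f(1) g(1) w]
  have "(\<lambda>N. sqrt (4 * (H_norm (\<lambda>x. g x - dpsum c N x))\<^sup>2 + (H_norm (\<lambda>x. f x - psum c N x))\<^sup>2)) \<longlonglongrightarrow> sqrt (4 * 0\<^sup>2 + 0\<^sup>2)"
    by (intro tendsto_intros f(2) g(2))
  then have "(\<lambda>N. V_norm (\<lambda>x. f x - psum c N x)) \<longlonglongrightarrow> 0"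
    by (simp add: V_norm_diff_psum[OF V g(1)])
  moreover have "AE x in Mw. weak_deriv f x - dpsum c N x = g x - dpsum c N x" for N
    using V(2) by eventually_elim simp
  then have "H_norm (\<lambda>x. weak_deriv f x - dpsum c N x) = H_norm (\<lambda>x. g x - dpsum c N x)" for N
    by (intro H_norm_cong_AE H_diff dpsum_H g V_weak_deriv(2) V)
  then have "(\<lambda>N. H_norm (\<lambda>x. weak_deriv f x - dpsum c N x)) \<longlonglongrightarrow> 0" using g(2) by simp
  ultimately show ?thesis using that V(1) by blast
qed

lemma V_limit_coef:
  assumes "f \<in> V_space" "(\<lambda>N. V_norm (\<lambda>x. f x - psum c N x)) \<longlonglongrightarrow> 0"
  shows "coef f = c"
proof (rule coef_limit[OF V_weak_deriv(1)[OF assms(1)]])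
  show "(\<lambda>N. H_norm (\<lambda>x. f x - psum c N x)) \<longlonglongrightarrow> 0"
  proof (rule Lim_null_comparison[OF always_eventually assms(2)], rule)
    fix N
    have "(H_norm (\<lambda>x. f x - psum c N x))\<^sup>2 \<le> 4 * (H_norm (weak_deriv (\<lambda>x. f x - psum c N x)))\<^sup>2 + (H_norm (\<lambda>x. f x - psum c N x))\<^sup>2"
      by simp
    then show "norm (H_norm (\<lambda>x. f x - psum c N x)) \<le> V_norm (\<lambda>x. f x - psum c N x)"
      unfolding V_norm_sq[OF V_diff(1)[OF assms(1) psum_V]] by (simp add: real_le_rsqrt)
  qed
qed

text \<open>The choice in the definition of the resolvent is determined up to null sets by its coefficients,
  and all later estimates use only these.\<close>

theorem Rz_coef:
  assumes "summable (\<lambda>n. (kappa n)\<^sup>2 * (cmod (F (Phi n) / (z\<^sup>2 - complex_of_real ((kappa n)\<^sup>2))))\<^sup>2)"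
  shows "Rz z F \<in> V_space" "coef (Rz z F) = (\<lambda>n. F (Phi n) / (z\<^sup>2 - complex_of_real ((kappa n)\<^sup>2)))"
proof -
  let ?c = "\<lambda>n. F (Phi n) / (z\<^sup>2 - complex_of_real ((kappa n)\<^sup>2))"
  have d: "Rz z F = (SOME f. f \<in> V_space \<and> (\<lambda>N. V_norm (\<lambda>x. f x - psum ?c N x)) \<longlonglongrightarrow> 0)"
    by (simp add: Rz_def psum_def)
  obtain f where "f \<in> V_space \<and> (\<lambda>N. V_norm (\<lambda>x. f x - psum ?c N x)) \<longlonglongrightarrow> 0"
    using V_limit_exists[OF assms] by blast
  then have "Rz z F \<in> V_space \<and> (\<lambda>N. V_norm (\<lambda>x. Rz z F x - psum ?c N x)) \<longlonglongrightarrow> 0"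
    unfolding d by (rule someI[of "\<lambda>f. f \<in> V_space \<and> (\<lambda>N. V_norm (\<lambda>x. f x - psum ?c N x)) \<longlonglongrightarrow> 0" f])
  then show "Rz z F \<in> V_space" "coef (Rz z F) = ?c" using V_limit_coef by auto
qed

section \<open>The operator of the form and its square root\<close>

text \<open>From left to right, test with the eigenfunctions. From right to left, the coefficients of \<open>f\<close> and \<open>h\<close>
  are square summable, hence so are the numbers \<open>\<kappa>\<^sub>n\<close> times the coefficients of \<open>f\<close>; then \<open>f\<close> lies in the
  form domain, and the form is computed on partial sums.\<close>

theorem A0_iff: "(f, h) \<in> A0 \<longleftrightarrow> f \<in> H_space \<and> h \<in> H_space \<and> (\<forall>n. coef h n = 4 * mu n * coef f n)"
proof
  assume *: "(f, h) \<in> A0"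
  then have f: "f \<in> V_space" and h: "h \<in> H_space" and a: "\<And>g. g \<in> V_space \<Longrightarrow> form_a0 f g = H_inner h g"
    by (auto simp: A0_def)
  note fd = V_weak_deriv[OF f]
  have "coef h n = 4 * mu n * coef f n" for n
  proof -
    have "coef h n = form_a0 f (Phi n)" using a[OF Phi_V] by (simp add: coef_def)
    also have "\<dots> = 4 * H_inner (weak_deriv f) (weak_deriv (Phi n))" by (simp add: form_a0_def H_inner_def)
    also have "H_inner (weak_deriv f) (weak_deriv (Phi n)) = H_inner (weak_deriv f) (dPhi n)"
      using Phi_deriv_AE by (intro H_inner_cong_AE fd V_weak_deriv(2)[OF Phi_V] dPhi_H) auto
    also have "\<dots> = mu n * H_inner f (Phi n)" by (rule green_Phi[OF fd])
    finally show ?thesis by (simp add: coef_def)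
  qed
  then show "f \<in> H_space \<and> h \<in> H_space \<and> (\<forall>n. coef h n = 4 * mu n * coef f n)" using fd h by blast
next
  assume *: "f \<in> H_space \<and> h \<in> H_space \<and> (\<forall>n. coef h n = 4 * mu n * coef f n)"
  then have f: "f \<in> H_space" and h: "h \<in> H_space" and c: "\<And>n. coef h n = 4 * mu n * coef f n" by auto
  have "summable (\<lambda>n. (cmod (coef h n))\<^sup>2 + (cmod (coef f n))\<^sup>2)"
    by (intro summable_add coef_summable f h)
  then have s: "summable (\<lambda>n. (kappa n)\<^sup>2 * (cmod (coef f n))\<^sup>2)"
  proof (rule summable_comparison_test')
    fix n
    have "4 * mu n \<le> 1/2 + (4 * mu n)\<^sup>2" using sum_squares_bound[of "4 * mu n" "1"] mu_nonneg[of n] zero_le_power2[of "4 * mu n - 1/2"]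
      by (simp add: power2_eq_square algebra_simps)
    then have "(kappa n)\<^sup>2 \<le> (4 * mu n)\<^sup>2 + 1" by (simp add: kappa_sq)
    then have "(kappa n)\<^sup>2 * (cmod (coef f n))\<^sup>2 \<le> ((4 * mu n)\<^sup>2 + 1) * (cmod (coef f n))\<^sup>2" by (rule mult_right_mono) simp
    also have "\<dots> = (cmod (coef h n))\<^sup>2 + (cmod (coef f n))\<^sup>2"
      using mu_nonneg[of n] by (simp add: c norm_mult power_mult_distrib algebra_simps)
    finally show "norm ((kappa n)\<^sup>2 * (cmod (coef f n))\<^sup>2) \<le> (cmod (coef h n))\<^sup>2 + (cmod (coef f n))\<^sup>2" by simp
  qed
  obtain f' where f': "f' \<in> V_space" "(\<lambda>N. V_norm (\<lambda>x. f' x - psum (coef f) N x)) \<longlonglongrightarrow> 0"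
    "(\<lambda>N. H_norm (\<lambda>x. weak_deriv f' x - dpsum (coef f) N x)) \<longlonglongrightarrow> 0"
    using V_limit_exists[OF s] by blast
  note d = V_weak_deriv[OF f'(1)]
  have ae: "AE x in Mw. f' x = f x"
    by (rule coef_determines[OF d(1) f V_limit_coef[OF f'(1,2)]])
  have w: "is_weak_deriv f (weak_deriv f')"
    unfolding is_weak_deriv_iff[OF f d(2)]
  proof
    fix \<psi> assume \<psi>: "\<psi> \<in> test_functions"
    have "H_inner f (over_weight (deriv \<psi>)) = H_inner f' (over_weight (deriv \<psi>))"
      using ae f d(1) over_weight_H[OF test_compact_cont(2)[OF \<psi>]]
      by (intro H_inner_cong_AE) auto
    then show "H_inner f (over_weight (deriv \<psi>)) = - H_inner (weak_deriv f') (over_weight \<psi>)"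
      using d(3) \<psi> unfolding is_weak_deriv_iff[OF d(1,2)] by simp
  qed
  note V = V_spaceI[OF f d(2) w]
  have "form_a0 f g = H_inner h g" if g: "g \<in> V_space" for g
  proof -
    note gd = V_weak_deriv[OF g]
    have "(\<lambda>N. 4 * H_inner (dpsum (coef f) N) (weak_deriv g)) \<longlonglongrightarrow> 4 * H_inner (weak_deriv f') (weak_deriv g)"
      by (intro tendsto_mult tendsto_const H_inner_tendsto[OF dpsum_H d(2) gd(2) f'(3)])
    moreover have "4 * H_inner (dpsum (coef f) N) (weak_deriv g) = H_inner (psum (coef h) N) g" for N
    proof -
      have i: "H_inner (dPhi n) (weak_deriv g) = mu n * H_inner (Phi n) g" for n
      proof -
        have "H_inner (dPhi n) (weak_deriv g) = cnj (H_inner (weak_deriv g) (dPhi n))" by (rule H_inner_cnj)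
        also have "\<dots> = mu n * cnj (H_inner g (Phi n))" unfolding green_Phi[OF gd] by simp
        also have "cnj (H_inner g (Phi n)) = H_inner (Phi n) g" by (rule H_inner_cnj[symmetric])
        finally show ?thesis .
      qed
      have "H_inner (dpsum (coef f) N) (weak_deriv g) = (\<Sum>n<N. coef f n * H_inner (dPhi n) (weak_deriv g))"
        unfolding dpsum_def[abs_def] by (subst H_inner_sum_left) (auto intro!: H_scale dPhi_H gd simp: H_inner_scale_left)
      moreover have "H_inner (psum (coef h) N) g = (\<Sum>n<N. coef h n * H_inner (Phi n) g)"
        unfolding psum_def[abs_def] by (subst H_inner_sum_left) (auto intro!: H_scale Phi_H gd simp: H_inner_scale_left)
      ultimately show ?thesis by (simp add: i c sum_distrib_left mult_ac)
    qed
    moreover have "(\<lambda>N. H_inner (psum (coef h) N) g) \<longlonglongrightarrow> H_inner h g"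
      by (rule H_inner_tendsto[OF psum_H h gd(1) psum_coef_tendsto[OF h]])
    ultimately have "4 * H_inner (weak_deriv f') (weak_deriv g) = H_inner h g" by (simp add: LIMSEQ_unique)
    moreover have "H_inner (weak_deriv f) (weak_deriv g) = H_inner (weak_deriv f') (weak_deriv g)"
      using V(2) by (intro H_inner_cong_AE V_weak_deriv(2)[OF V(1)] d gd) auto
    ultimately show ?thesis by (simp add: form_a0_def H_inner_def)
  qed
  then show "(f, h) \<in> A0" using V(1) h by (simp add: A0_def)
qed

lemma coef_add: "f \<in> H_space \<Longrightarrow> g \<in> H_space \<Longrightarrow> coef (\<lambda>x. f x + g x) n = coef f n + coef g n"
  by (simp add: coef_def H_inner_add_left Phi_H)

lemma coef_diff: "f \<in> H_space \<Longrightarrow> g \<in> H_space \<Longrightarrow> coef (\<lambda>x. f x - g x) n = coef f n - coef g n"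
  by (simp add: coef_def H_inner_diff_left Phi_H)

lemma coef_scale: "coef (\<lambda>x. c * f x) n = c * coef f n"
  by (simp add: coef_def H_inner_scale_left)

theorem L0_iff: "(f, k) \<in> L0 \<longleftrightarrow> f \<in> H_space \<and> k \<in> H_space \<and> (\<forall>n. coef k n = (kappa n)\<^sup>2 * coef f n)"
proof
  assume "(f, k) \<in> L0"
  then obtain h where h: "(f, h) \<in> A0" and k: "k = (\<lambda>x. h x + (1/4) * f x)" by (auto simp: L0_def)
  then have H: "f \<in> H_space" "h \<in> H_space" "\<And>n. coef h n = 4 * mu n * coef f n" by (auto simp: A0_iff)
  have "coef k n = (kappa n)\<^sup>2 * coef f n" for n
    unfolding k coef_add[OF H(2) H_scale[OF H(1)]] coef_scale H(3) kappa_sq by (simp add: algebra_simps)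
  then show "f \<in> H_space \<and> k \<in> H_space \<and> (\<forall>n. coef k n = (kappa n)\<^sup>2 * coef f n)"
    using H_add[OF H(2) H_scale[OF H(1)]] H k by blast
next
  assume *: "f \<in> H_space \<and> k \<in> H_space \<and> (\<forall>n. coef k n = (kappa n)\<^sup>2 * coef f n)"
  then have H: "f \<in> H_space" "k \<in> H_space" "\<And>n. coef k n = (kappa n)\<^sup>2 * coef f n" by auto
  have "coef (\<lambda>x. k x - (1/4) * f x) n = 4 * mu n * coef f n" for n
    unfolding coef_diff[OF H(2) H_scale[OF H(1)]] coef_scale H(3) kappa_sq by (simp add: algebra_simps)
  moreover have "(\<lambda>x. k x - (1/4) * f x) \<in> H_space" by (rule H_diff[OF H(2) H_scale[OF H(1)]])
  ultimately have "(f, \<lambda>x. k x - (1/4) * f x) \<in> A0"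
    unfolding A0_iff using H(1) by blast
  then show "(f, k) \<in> L0"
    unfolding L0_def by (intro CollectI exI[of _ f] exI[of _ "\<lambda>x. k x - (1/4) * f x"] conjI) simp_all
qed

definition Lroot :: graph where
  "Lroot = {(f, h). f \<in> H_space \<and> h \<in> H_space \<and> (\<forall>n. coef h n = kappa n * coef f n)}"

lemma H_inner_Parseval:
  assumes "f \<in> H_space" "g \<in> H_space"
  shows "(\<lambda>n. coef f n * cnj (coef g n)) sums H_inner f g"
proof -
  have "H_inner (psum (coef f) N) g = (\<Sum>n<N. coef f n * cnj (coef g n))" for N
    unfolding psum_def[abs_def]
    by (subst H_inner_sum_left) (auto intro!: H_scale Phi_H assms sum.cong simp: H_inner_scale_left coef_def H_inner_cnj[of "Phi _" g])
  then show ?thesis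
    using H_inner_tendsto[OF psum_H assms(1,2) psum_coef_tendsto[OF assms(1)]] by (simp add: sums_def)
qed

lemma Phi_Lroot: "(Phi n, \<lambda>x. kappa n * Phi n x) \<in> Lroot"
  by (auto simp: Lroot_def Phi_H H_scale coef_scale) (auto simp: coef_def Phi_orthonormal)

lemma psum_Lroot: "(psum c N, psum (\<lambda>n. complex_of_real (kappa n) * c n) N) \<in> Lroot"
  by (auto simp: Lroot_def psum_H coef_psum)

lemma Lroot_self_adjoint: "self_adjoint Lroot"
  unfolding self_adjoint_def
proof
  show "densely_defined Lroot"
    unfolding densely_defined_def
  proof (intro ballI allI impI)
    fix f :: "real \<Rightarrow> complex" and e :: real assume f: "f \<in> H_space" and e: "0 < e"
    then obtain N where "norm (H_norm (\<lambda>x. f x - psum (coef f) N x) - 0) < e"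
      using LIMSEQ_D[OF psum_coef_tendsto[OF f] e] by blast
    then show "\<exists>g\<in>Domain Lroot. H_norm (\<lambda>\<phi>. f \<phi> - g \<phi>) < e"
      using psum_Lroot[of "coef f" N] by (intro bexI[of _ "psum (coef f) N"]) auto
  qed
  show "adjoint_graph Lroot = Lroot"
  proof (intro set_eqI iffI; clarify)
    fix g k assume "(g, k) \<in> adjoint_graph Lroot"
    then have gk: "g \<in> H_space" "k \<in> H_space" "\<And>f h. (f, h) \<in> Lroot \<Longrightarrow> H_inner h g = H_inner f k"
      by (auto simp: adjoint_graph_def)
    have "coef k n = kappa n * coef g n" for n
    proof -
      have "kappa n * H_inner (Phi n) g = H_inner (Phi n) k"
        using gk(3)[OF Phi_Lroot[of n]] by (simp add: H_inner_scale_left)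
      then have "cnj (kappa n * cnj (coef g n)) = cnj (cnj (coef k n))"
        unfolding coef_def H_inner_cnj[of "Phi n", symmetric] by simp
      then show ?thesis by simp
    qed
    then show "(g, k) \<in> Lroot" using gk by (simp add: Lroot_def)
  next
    fix g k assume gk: "(g, k) \<in> Lroot"
    have "H_inner h g = H_inner f k" if "(f, h) \<in> Lroot" for f h
    proof -
      have "(\<lambda>n. coef h n * cnj (coef g n)) sums H_inner h g" "(\<lambda>n. coef f n * cnj (coef k n)) sums H_inner f k"
      proof -
        have "h \<in> H_space" "g \<in> H_space" "f \<in> H_space" "k \<in> H_space" using that gk by (auto simp: Lroot_def)
        then show "(\<lambda>n. coef h n * cnj (coef g n)) sums H_inner h g" "(\<lambda>n. coef f n * cnj (coef k n)) sums H_inner f k"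
          by (simp_all only: H_inner_Parseval)
      qed
      moreover have "coef h n * cnj (coef g n) = coef f n * cnj (coef k n)" for n
        using that gk by (simp add: Lroot_def)
      ultimately show ?thesis by (simp add: sums_unique2)
    qed
    then show "(g, k) \<in> adjoint_graph Lroot" using gk by (auto simp: adjoint_graph_def Lroot_def)
  qed
qed

lemma Lroot_nonneg: "nonneg_graph Lroot"
  unfolding nonneg_graph_def
proof clarify
  fix f h assume fh: "(f, h) \<in> Lroot"
  then have "h \<in> H_space" "f \<in> H_space" by (auto simp: Lroot_def)
  then have "(\<lambda>n. coef h n * cnj (coef f n)) sums H_inner h f" by (rule H_inner_Parseval)
  then have "(\<lambda>n. Re (coef h n * cnj (coef f n))) sums Re (H_inner h f)" by (rule sums_Re)
  moreover have "Re (coef h n * cnj (coef f n)) = kappa n * (cmod (coef f n))\<^sup>2" for n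
  proof -
    have "coef h n * cnj (coef f n) = complex_of_real (kappa n * (cmod (coef f n))\<^sup>2)"
      using fh unfolding Lroot_def of_real_mult complex_norm_square by (auto simp: mult.assoc)
    then show ?thesis by (metis Re_complex_of_real)
  qed
  ultimately have s: "(\<lambda>n. kappa n * (cmod (coef f n))\<^sup>2) sums Re (H_inner h f)" by simp
  have "0 \<le> kappa n * (cmod (coef f n))\<^sup>2" for n using kappa_pos[of n] by simp
  then show "0 \<le> Re (H_inner h f)" by (rule sums_le[OF _ sums_zero s])
qed

lemma Lroot_exists:
  assumes "f \<in> H_space" "summable (\<lambda>n. (kappa n)\<^sup>2 * (cmod (coef f n))\<^sup>2)"
  obtains h where "(f, h) \<in> Lroot"
proof -
  have "summable (\<lambda>n. (cmod (kappa n * coef f n))\<^sup>2)"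
    using assms(2) by (simp add: norm_mult power_mult_distrib)
  then obtain h where "h \<in> H_space" "coef h = (\<lambda>n. kappa n * coef f n)"
    "(\<lambda>N. H_norm (\<lambda>x. h x - psum (\<lambda>n. kappa n * coef f n) N x)) \<longlonglongrightarrow> 0"
    by (rule Riesz_Fischer)
  then show ?thesis using assms(1) by (intro that[of h]) (simp add: Lroot_def)
qed

lemma Lroot_square: "Lroot O Lroot = L0"
proof (intro set_eqI iffI; clarify)
  fix f g h assume "(f, g) \<in> Lroot" "(g, h) \<in> Lroot"
  then show "(f, h) \<in> L0" by (auto simp: Lroot_def L0_iff power2_eq_square)
next
  fix f k assume "(f, k) \<in> L0"
  then have fk: "f \<in> H_space" "k \<in> H_space" "\<And>n. coef k n = (kappa n)\<^sup>2 * coef f n" by (auto simp: L0_iff)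
  have "summable (\<lambda>n. 4 * (cmod (coef k n))\<^sup>2)" by (intro summable_mult coef_summable fk)
  then have "summable (\<lambda>n. (kappa n)\<^sup>2 * (cmod (coef f n))\<^sup>2)"
  proof (rule summable_comparison_test')
    fix n
    have "1 \<le> 4 * (kappa n)\<^sup>2" using mu_nonneg[of n] by (simp add: kappa_sq)
    then have "1 * ((kappa n)\<^sup>2 * (cmod (coef f n))\<^sup>2) \<le> (4 * (kappa n)\<^sup>2) * ((kappa n)\<^sup>2 * (cmod (coef f n))\<^sup>2)"
      by (rule mult_right_mono) simp
    also have "\<dots> = 4 * (cmod (coef k n))\<^sup>2"
      by (simp add: fk(3) norm_mult norm_power power_mult_distrib power2_eq_square)
    finally show "norm ((kappa n)\<^sup>2 * (cmod (coef f n))\<^sup>2) \<le> 4 * (cmod (coef k n))\<^sup>2" by simp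
  qed
  then obtain g where g: "(f, g) \<in> Lroot" using Lroot_exists fk(1) by blast
  then have "(g, k) \<in> Lroot" using fk by (simp add: Lroot_def power2_eq_square)
  with g show "(f, k) \<in> Lroot O Lroot" by blast
qed

lemma adjoint_graph_AE:
  assumes "(g, k) \<in> adjoint_graph S" "S \<subseteq> H_space \<times> H_space" "g' \<in> H_space" "k' \<in> H_space"
    "AE x in Mw. g x = g' x" "AE x in Mw. k x = k' x"
  shows "(g', k') \<in> adjoint_graph S"
  unfolding adjoint_graph_def
proof (intro CollectI case_prodI conjI assms(3,4) ballI; clarify)
  fix f h assume fh: "(f, h) \<in> S"
  have "H_inner h g' = H_inner h g" "H_inner f k' = H_inner f k"
    using fh assms by (auto intro!: H_inner_cong_AE simp: adjoint_graph_def)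
  then show "H_inner h g' = H_inner f k'" using assms(1) fh by (auto simp: adjoint_graph_def)
qed

lemma adjoint_graph_combine:
  assumes "(g, k) \<in> adjoint_graph S" "(g', k') \<in> adjoint_graph S" "S \<subseteq> H_space \<times> H_space"
  shows "(\<lambda>x. g x - c * g' x, \<lambda>x. k x - c * k' x) \<in> adjoint_graph S"
  unfolding adjoint_graph_def
proof (intro CollectI case_prodI conjI ballI; clarify?)
  have H: "g \<in> H_space" "k \<in> H_space" "g' \<in> H_space" "k' \<in> H_space" using assms by (auto simp: adjoint_graph_def)
  then show "(\<lambda>x. g x - c * g' x) \<in> H_space" "(\<lambda>x. k x - c * k' x) \<in> H_space" by (auto intro: H_diff H_scale)
  fix f h assume fh: "(f, h) \<in> S"
  then have F: "f \<in> H_space" "h \<in> H_space" using assms(3) by auto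
  have "H_inner h g = H_inner f k" "H_inner h g' = H_inner f k'" using assms(1,2) fh by (auto simp: adjoint_graph_def)
  then show "H_inner h (\<lambda>x. g x - c * g' x) = H_inner f (\<lambda>x. k x - c * k' x)"
    using H F by (simp add: H_inner_diff_right H_scale H_inner_scale_right)
qed

text \<open>Let \<open>S\<close> be another root and \<open>g = S \<Phi>\<^sub>n\<close>. Then \<open>u = g - \<kappa>\<^sub>n \<Phi>\<^sub>n\<close> satisfies \<open>S u = - \<kappa>\<^sub>n u\<close>, which for a
  nonnegative \<open>S\<close> forces \<open>u = 0\<close>. So \<open>S\<close> agrees with the candidate on the eigenbasis; its symmetry then
  gives \<open>S \<subseteq> Lroot\<close>, and taking adjoints reverses the inclusion.\<close>

theorem L0_half_eq: "L0_half = Lroot"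
  unfolding L0_half_def
proof (rule the_equality)
  show "self_adjoint Lroot \<and> nonneg_graph Lroot \<and> Lroot O Lroot = L0"
    using Lroot_self_adjoint Lroot_nonneg Lroot_square by blast
next
  fix S assume S: "self_adjoint S \<and> nonneg_graph S \<and> S O S = L0"
  then have adj: "adjoint_graph S = S" by (simp add: self_adjoint_def)
  have sub: "S \<subseteq> H_space \<times> H_space" by (subst adj[symmetric]) (auto simp: adjoint_graph_def)
  have Phi: "(Phi n, \<lambda>x. kappa n * Phi n x) \<in> S" for n
  proof -
    have "(Phi n, \<lambda>x. complex_of_real ((kappa n)\<^sup>2) * Phi n x) \<in> L0"
      by (auto simp: L0_iff Phi_H H_scale coef_scale) (auto simp: coef_def Phi_orthonormal)
    then obtain g where g: "(Phi n, g) \<in> S" "(g, \<lambda>x. complex_of_real ((kappa n)\<^sup>2) * Phi n x) \<in> S" using S by blast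
    \<comment> \<open>an eigenvector for a negative eigenvalue, unless it is zero\<close>
    define u where "u x = g x - kappa n * Phi n x" for x
    have gH: "g \<in> H_space" using g sub by auto
    have uH: "u \<in> H_space" unfolding u_def[abs_def] by (intro H_diff H_scale gH Phi_H)
    have "(\<lambda>x. g x - kappa n * Phi n x, \<lambda>x. complex_of_real ((kappa n)\<^sup>2) * Phi n x - kappa n * g x) \<in> S"
      using adjoint_graph_combine[of g _ S "Phi n" g "complex_of_real (kappa n)"] g sub unfolding adj by blast
    moreover have "(\<lambda>x. complex_of_real ((kappa n)\<^sup>2) * Phi n x - kappa n * g x) = (\<lambda>x. complex_of_real (- kappa n) * u x)"
      by (simp add: u_def fun_eq_iff power2_eq_square algebra_simps)
    ultimately have "(u, \<lambda>x. complex_of_real (- kappa n) * u x) \<in> S" by (simp add: u_def[abs_def])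
    then have "0 \<le> Re (H_inner (\<lambda>x. complex_of_real (- kappa n) * u x) u)"
      using S unfolding nonneg_graph_def by blast
    also have "\<dots> = - kappa n * (H_norm u)\<^sup>2"
      unfolding H_inner_scale_left H_inner_self of_real_mult[symmetric] by simp
    finally have "H_norm u = 0" using kappa_pos[of n] by (simp add: mult_le_0_iff)
    then have "AE x in Mw. u x = 0" using H_norm_eq_0[OF uH] by simp
    then have "AE x in Mw. g x = kappa n * Phi n x" by eventually_elim (simp add: u_def)
    then show ?thesis
      using adjoint_graph_AE[of "Phi n" g S "Phi n" "\<lambda>x. kappa n * Phi n x"] g(1) sub
      unfolding adj by (auto intro: Phi_H H_scale)
  qed
  have "S \<subseteq> Lroot"
  proof clarify
    fix f h assume fh: "(f, h) \<in> S"
    then have F: "f \<in> H_space" "h \<in> H_space" using sub by auto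
    have "(f, h) \<in> adjoint_graph S" using fh adj by simp
    then have "H_inner (\<lambda>x. kappa n * Phi n x) f = H_inner (Phi n) h" for n
      using Phi[of n] by (auto simp: adjoint_graph_def)
    then have "cnj (kappa n * H_inner (Phi n) f) = cnj (H_inner (Phi n) h)" for n by (simp add: H_inner_scale_left)
    then have "coef h n = kappa n * coef f n" for n
      unfolding coef_def H_inner_cnj[of h "Phi n"] H_inner_cnj[of f "Phi n"] by simp
    then show "(f, h) \<in> Lroot" using F by (simp add: Lroot_def)
  qed
  moreover have "Lroot \<subseteq> S"
  proof -
    have "adjoint_graph Lroot \<subseteq> adjoint_graph S" using calculation by (auto simp: adjoint_graph_def)
    then show ?thesis using Lroot_self_adjoint adj by (simp add: self_adjoint_def)
  qed
  ultimately show "S = Lroot" by blast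
qed

section \<open>Boundary values\<close>

definition end_value :: "nat \<Rightarrow> real" where
  "end_value n = gegenbauer (1/4) n 1 / sqrt (h_const n)"

lemma gegenbauer_at_1_pos: "0 < gegenbauer (1/4) n 1"
proof (induction n)
  case (Suc n)
  have "0 < (real n + 2 * (1/4)) * gegenbauer (1/4) n 1" using Suc by simp
  then have "0 < (real n + 1) * gegenbauer (1/4) (Suc n) 1" unfolding gegenbauer_at_1 .
  then show ?case by (simp add: zero_less_mult_iff del: gegenbauer.simps)
qed simp

lemma end_value_pos: "0 < end_value n"
  using gegenbauer_at_1_pos h_const_pos by (simp add: end_value_def)

lemma Phi_0: "Phi n 0 = complex_of_real (end_value n)"
  by (simp add: Phi_def end_value_def)

lemma Phi_pi: "Phi n pi = complex_of_real ((-1) ^ n * end_value n)"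
  using gegenbauer_parity[of "1/4" n 1] by (simp add: Phi_def end_value_def)

lemma Phi_bound: "cmod (Phi n x) \<le> end_value n"
proof -
  have "\<bar>gegenbauer (1/4) n (cos x)\<bar> \<le> \<bar>gegenbauer (1/4) n 1\<bar>" by (rule gegenbauer_le_at_1) auto
  then have "\<bar>gegenbauer (1/4) n (cos x)\<bar> / sqrt (h_const n) \<le> gegenbauer (1/4) n 1 / sqrt (h_const n)"
    using h_const_pos[of n] gegenbauer_at_1_pos[of n] by (intro divide_right_mono) auto
  then show ?thesis using h_const_pos[of n] unfolding Phi_def norm_of_real by (simp add: end_value_def abs_divide)
qed

lemma Phi_cont: "continuous_on S (Phi n)"
  unfolding Phi_eq by (intro continuous_intros gcos_cont)

text \<open>Both sides satisfy the same first-order recursion in \<open>n\<close>.\<close>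

lemma end_value_sq: "(end_value n)\<^sup>2 = 2 / h_const 0 * (kappa n * wallis n)"
proof (induction n)
  case 0
  show ?case using h_const_pos[of 0] by (simp add: end_value_def power_divide kappa_def)
next
  case (Suc n)
  define g g' h h' where "g = gegenbauer (1/4) n 1" and "g' = gegenbauer (1/4) (Suc n) 1" and "h = h_const n" and "h' = h_const (Suc n)"
  define N where "N = real n"
  have N: "N \<ge> 0" by (simp add: N_def)
  have p: "h > 0" "h' > 0" by (simp_all add: h_def h'_def h_const_pos)
  have "(N + 1) * g' = (N + 1/2) * g" using gegenbauer_at_1[of n "1/4"] by (simp add: g_def g'_def N_def del: gegenbauer.simps)
  then have g': "g' = (N + 1/2) * g / (N + 1)" using N by (simp add: field_simps)
  have "h' * ((N + 1) * (N + 5/4)) = (N + 1/4) * (N + 1/2) * h" using h_const_Suc[of n] by (simp add: h_def h'_def N_def)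
  then have h': "h' = (N + 1/4) * (N + 1/2) * h / ((N + 1) * (N + 5/4))" using N by (simp add: eq_divide_eq)
  have a: "(end_value n)\<^sup>2 = g\<^sup>2 / h" "(end_value (Suc n))\<^sup>2 = g'\<^sup>2 / h'"
    using p by (simp_all add: end_value_def power_divide g_def g'_def h_def h'_def del: gegenbauer.simps)
  have "g'\<^sup>2 / h' = (g\<^sup>2 / h) * ((N + 1/2) * (N + 5/4) / ((N + 1) * (N + 1/4)))"
  proof -
    have nz: "N + 1 \<noteq> 0" "N + 1/2 \<noteq> 0" "N + 1/4 \<noteq> 0" "N + 5/4 \<noteq> 0" using N by auto
    have "(A * g / B)\<^sup>2 / (D * A * h / (B * E)) = (g\<^sup>2 / h) * (A * E / (B * D))" if "A \<noteq> 0" "B \<noteq> 0" "D \<noteq> 0" "E \<noteq> 0" for A B D E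
      using that p by (simp add: field_simps power2_eq_square)
    from this[OF nz(2,1,3,4)] show ?thesis unfolding g' h' .
  qed
  also have "g\<^sup>2 / h = 2 / h_const 0 * (kappa n * wallis n)" using Suc a by simp
  also have "2 / h_const 0 * (kappa n * wallis n) * ((N + 1/2) * (N + 5/4) / ((N + 1) * (N + 1/4))) =
      2 / h_const 0 * (kappa (Suc n) * wallis (Suc n))"
  proof -
    have k: "kappa n = 2 * (N + 1/4)" "kappa (Suc n) = 2 * (N + 5/4)" by (auto simp: kappa_def N_def)
    have "2 * D * w * (A * E / (B * D)) = 2 * E * (w * A / B)" if "D \<noteq> 0" for A B D E w :: real
      using that by simp
    from this[of "N + 1/4" "wallis n" "N + 1/2" "N + 5/4" "N + 1"]
    have R: "kappa n * wallis n * ((N + 1/2) * (N + 5/4) / ((N + 1) * (N + 1/4))) = kappa (Suc n) * wallis (Suc n)"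
      unfolding k wallis.simps N_def[symmetric] using N by simp
    show ?thesis unfolding R[symmetric] by (simp only: mult.assoc)
  qed
  finally show ?case using a by simp
qed

lemma end_value_sq_le: "(end_value n)\<^sup>2 \<le> 4 / h_const 0 * sqrt (kappa n)"
proof -
  have "kappa n * wallis n \<le> kappa n * rsq n" using wallis_le kappa_pos by (simp add: less_imp_le)
  also have "\<dots> = sqrt (kappa n) * (sqrt (kappa n) * rsq n)" using kappa_pos[of n] by simp
  also have "\<dots> \<le> sqrt (kappa n) * 2"
  proof (rule mult_left_mono)
    have "sqrt (kappa n) \<le> sqrt (4 * (real n + 1))" by (intro real_sqrt_le_mono) (simp add: kappa_def)
    also have "\<dots> = 2 * sqrt (real n + 1)" by (simp only: real_sqrt_mult real_sqrt_four)
    finally show "sqrt (kappa n) * rsq n \<le> 2" by (simp add: rsq_def field_simps)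
  qed (use kappa_pos[of n] in simp)
  finally have "2 / h_const 0 * (kappa n * wallis n) \<le> 2 / h_const 0 * (sqrt (kappa n) * 2)"
    using h_const_pos[of 0] by (intro mult_left_mono) auto
  then show ?thesis unfolding end_value_sq by simp
qed

text \<open>The set where two continuous functions differ is open, and nonempty open sets are not null.\<close>

lemma continuous_AE_unique:
  fixes h1 h2 :: "real \<Rightarrow> complex"
  assumes c: "continuous_on {0..pi} h1" "continuous_on {0..pi} h2" and ae: "AE x in Mw. h1 x = h2 x" and x: "x \<in> {0..pi}"
  shows "h1 x = h2 x"
proof -
  let ?N = "{0<..<pi} \<inter> (\<lambda>x. h1 x - h2 x) -` (- {0})"
  have "continuous_on {0<..<pi} (\<lambda>x. h1 x - h2 x)"
    by (intro continuous_intros continuous_on_subset[OF c(1)] continuous_on_subset[OF c(2)]) auto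
  then have op: "open ?N" by (rule continuous_open_preimage) auto
  have "AE x in lborel. x \<notin> ?N" using ae unfolding AE_Mw by eventually_elim auto
  moreover have "?N \<in> sets lborel" using op by (simp add: borel_open)
  ultimately have "?N \<in> null_sets lborel" by (simp add: AE_iff_null_sets)
  then have "negligible ?N" by (metis null_sets_completionI negligible_iff_null_sets)
  then have N: "?N = {}" using open_not_negligible[OF op] by blast
  have "closed {x \<in> {0..pi}. h1 x - h2 x = 0}"
    by (intro continuous_closed_preimage_constant continuous_intros c)
  moreover have "{0<..<pi} \<subseteq> {x \<in> {0..pi}. h1 x - h2 x = 0}" using N by auto
  ultimately have "closure {0<..<pi} \<subseteq> {x \<in> {0..pi}. h1 x - h2 x = 0}" by (intro closure_minimal)
  then show ?thesis using x by (auto simp: closure_greaterThanLessThan)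
qed

lemma cont_rep_eq:
  assumes "continuous_on {0..pi} g" "AE x in Mw. g x = f x" "x \<in> {0..pi}"
  shows "cont_rep f x = g x"
proof -
  have "continuous_on {0..pi} (cont_rep f) \<and> (AE x in Mw. cont_rep f x = f x)"
    unfolding cont_rep_def by (rule someI[of "\<lambda>h. continuous_on {0..pi} h \<and> (AE \<phi> in Mw. h \<phi> = f \<phi>)" g]) (use assms in blast)
  then have c: "continuous_on {0..pi} (cont_rep f)" and ae: "AE x in Mw. cont_rep f x = f x" by auto
  from ae assms(2) have "AE x in Mw. cont_rep f x = g x" by eventually_elim simp
  then show ?thesis by (rule continuous_AE_unique[OF c assms(1) _ assms(3)])
qed

definition end_sign :: "2 \<Rightarrow> nat \<Rightarrow> real" where "end_sign i n = (if i = 1 then 1 else (-1) ^ n)"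

lemma abs_end_sign: "\<bar>end_sign i n\<bar> = 1" by (simp add: end_sign_def)

text \<open>The coefficient condition is the Weierstrass criterion for uniform convergence, since
  \<open>end_value n\<close> is the maximum of \<open>\<bar>\<Phi>\<^sub>n\<bar>\<close>. The continuous sum has the coefficients of \<open>f\<close>, so it is its
  continuous representative.\<close>

theorem Ctr_series:
  assumes f: "f \<in> H_space" and s: "summable (\<lambda>n. cmod (coef f n) * end_value n)"
  shows "(\<lambda>n. coef f n * complex_of_real (end_sign i n * end_value n)) sums (Ctr f $ i)"
proof -
  define g where "g x = (\<Sum>n. coef f n * Phi n x)" for x
  have b: "cmod (coef f n * Phi n x) \<le> cmod (coef f n) * end_value n" for n x
    unfolding norm_mult using Phi_bound by (intro mult_left_mono) auto
  have ul: "uniform_limit UNIV (\<lambda>N x. \<Sum>n<N. coef f n * Phi n x) g sequentially"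
    unfolding g_def by (rule Weierstrass_m_test[OF b s])
  have cg: "continuous_on UNIV g"
    by (rule uniform_limit_theorem[OF _ ul])
       (auto intro!: always_eventually continuous_intros Phi_cont)
  have lim: "(\<lambda>N. psum (coef f) N x) \<longlonglongrightarrow> g x" for x
    using tendsto_uniform_limitI[OF ul, of x] by (simp add: psum_def)
  have bd: "cmod (psum (coef f) N x) \<le> (\<Sum>n. cmod (coef f n) * end_value n)" for N x
  proof -
    have "cmod (psum (coef f) N x) \<le> (\<Sum>n<N. cmod (coef f n) * end_value n)"
      unfolding psum_def by (rule sum_norm_le[OF b])
    also have "\<dots> \<le> (\<Sum>n. cmod (coef f n) * end_value n)"
      using end_value_pos by (intro sum_le_suminf s) (auto simp: less_imp_le)
    finally show ?thesis .
  qed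
  have gH: "g \<in> H_space" by (rule continuous_H_space[OF cg])
  have "coef g m = coef f m" for m
  proof -
    have "(\<lambda>N. H_inner (Phi m) (psum (coef f) N)) \<longlonglongrightarrow> H_inner (Phi m) g"
      by (rule H_inner_dominated[OF Phi_H H_space_measurable[OF psum_H] H_space_measurable[OF gH] bd lim])
    then have "(\<lambda>N. cnj (H_inner (Phi m) (psum (coef f) N))) \<longlonglongrightarrow> cnj (H_inner (Phi m) g)" by (rule tendsto_cnj)
    then have "(\<lambda>N. coef (psum (coef f) N) m) \<longlonglongrightarrow> coef g m"
      unfolding coef_def H_inner_cnj[of _ "Phi m"] by simp
    moreover have "(\<lambda>N. coef (psum (coef f) N) m) \<longlonglongrightarrow> coef f m"
      by (rule tendsto_eventually) (auto simp: coef_psum eventually_sequentially intro!: exI[of _ "Suc m"])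
    ultimately show ?thesis by (rule LIMSEQ_unique)
  qed
  then have ae: "AE x in Mw. g x = f x" by (intro coef_determines gH f ext)
  have "Ctr f $ i = g (if i = 1 then 0 else pi)"
  proof -
    have "cont_rep f 0 = g 0" "cont_rep f pi = g pi"
      by (auto intro!: cont_rep_eq continuous_on_subset[OF cg] ae)
    then show ?thesis using exhaust_2[of i] by (auto simp: Ctr_def vector_2)
  qed
  moreover have "(\<lambda>n. coef f n * Phi n x) sums g x" for x
    using lim[of x] by (simp add: sums_def psum_def)
  ultimately have "(\<lambda>n. coef f n * Phi n (if i = 1 then 0 else pi)) sums (Ctr f $ i)" by simp
  moreover have "Phi n (if i = 1 then 0 else pi) = complex_of_real (end_sign i n * end_value n)" for n
    by (simp add: Phi_0 Phi_pi end_sign_def)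
  ultimately show ?thesis by (simp only:)
qed

lemma Ctr_Phi: "Ctr (Phi n) $ i = complex_of_real (end_sign i n * end_value n)"
proof -
  have "cont_rep (Phi n) 0 = Phi n 0" "cont_rep (Phi n) pi = Phi n pi"
    by (auto intro!: cont_rep_eq Phi_cont)
  then show ?thesis using exhaust_2[of i] by (auto simp: Ctr_def vector_2 end_sign_def Phi_0 Phi_pi)
qed

lemma Ctr_dual_Phi: "Ctr_dual g (Phi n) = (\<Sum>i\<in>UNIV. g $ i * complex_of_real (end_sign i n * end_value n))"
  by (simp add: Ctr_dual_def Ctr_Phi)

lemma Ctr_dual_Phi_bound: "cmod (Ctr_dual g (Phi n)) \<le> 2 * norm g * end_value n"
proof -
  have "cmod (g $ i * complex_of_real (end_sign i n * end_value n)) \<le> norm g * end_value n" for i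
    unfolding norm_mult norm_of_real abs_mult abs_end_sign using end_value_pos[of n]
    by (simp add: Finite_Cartesian_Product.norm_nth_le mult_right_mono)
  then have "cmod (\<Sum>i\<in>(UNIV::2 set). g $ i * complex_of_real (end_sign i n * end_value n)) \<le> (\<Sum>i\<in>(UNIV::2 set). norm g * end_value n)"
    by (rule sum_norm_le)
  then show ?thesis by (simp add: Ctr_dual_Phi)
qed

lemma norm_vec2_le: "(\<And>i. cmod (v $ i) \<le> B) \<Longrightarrow> norm (v :: complex ^ 2) \<le> 2 * B"
proof -
  assume *: "\<And>i. cmod (v $ i) \<le> B"
  have "norm v \<le> (\<Sum>i\<in>UNIV. cmod (v $ i))" unfolding norm_vec_def by (rule L2_set_le_sum) simp
  also have "\<dots> \<le> (\<Sum>i\<in>(UNIV::2 set). B)" by (intro sum_mono *)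
  finally show ?thesis by simp
qed

section \<open>Resolvent estimates\<close>

lemma H_norm_le_coef_bound:
  assumes "f \<in> H_space" "\<And>n. (cmod (coef f n))\<^sup>2 \<le> b n" "\<And>N. (\<Sum>n<N. b n) \<le> B"
  shows "H_norm f \<le> sqrt B"
proof (rule real_le_rsqrt, rule LIMSEQ_le_const2)
  show "(\<lambda>N. \<Sum>n<N. (cmod (coef f n))\<^sup>2) \<longlonglongrightarrow> (H_norm f)\<^sup>2"
    using Parseval[OF assms(1)] by (simp add: sums_def)
  show "\<exists>N. \<forall>n\<ge>N. (\<Sum>n<n. (cmod (coef f n))\<^sup>2) \<le> B"
    using order_trans[OF sum_mono[OF assms(2)] assms(3)] by blast
qed

lemma H_norm_le_coef_multiple:
  assumes "f \<in> H_space" "h \<in> H_space" "\<And>n. cmod (coef f n) \<le> K * cmod (coef h n)" "0 \<le> K"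
  shows "H_norm f \<le> K * H_norm h"
proof -
  have "H_norm f \<le> sqrt (K\<^sup>2 * (H_norm h)\<^sup>2)"
  proof (rule H_norm_le_coef_bound[OF assms(1), of "\<lambda>n. K\<^sup>2 * (cmod (coef h n))\<^sup>2"])
    show "(cmod (coef f n))\<^sup>2 \<le> K\<^sup>2 * (cmod (coef h n))\<^sup>2" for n
      using power_mono[OF assms(3)[of n], of 2] by (simp add: power_mult_distrib)
    show "(\<Sum>n<N. K\<^sup>2 * (cmod (coef h n))\<^sup>2) \<le> K\<^sup>2 * (H_norm h)\<^sup>2" for N
      unfolding sum_distrib_left[symmetric] by (intro mult_left_mono Bessel assms) auto
  qed
  then show ?thesis using assms(4) by (simp add: real_sqrt_mult)
qed

lemma op_norm_le:
  assumes "\<And>x. x \<in> X \<Longrightarrow> nX x \<le> 1 \<Longrightarrow> nY (T x) \<le> B"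
  shows "op_norm X nX nY T \<le> ennreal B"
  unfolding op_norm_def using assms by (intro SUP_least ennreal_leI) auto

lemma apply_Lroot:
  assumes "f \<in> H_space" "summable (\<lambda>n. (kappa n)\<^sup>2 * (cmod (coef f n))\<^sup>2)"
  shows "f \<in> Domain L0_half" "apply_graph L0_half f \<in> H_space"
    "coef (apply_graph L0_half f) n = kappa n * coef f n"
proof -
  obtain h where h: "(f, h) \<in> Lroot" using Lroot_exists[OF assms] .
  then show "f \<in> Domain L0_half" unfolding L0_half_eq by blast
  have "(f, apply_graph L0_half f) \<in> Lroot"
    unfolding apply_graph_def L0_half_eq by (rule someI[of "\<lambda>h. (f, h) \<in> Lroot", OF h])
  then show "apply_graph L0_half f \<in> H_space" "coef (apply_graph L0_half f) n = kappa n * coef f n"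
    by (auto simp: Lroot_def)
qed

context admissible_shift
begin

context
  fixes \<xi> :: real and z :: complex
  assumes z: "z = Complex \<tau> \<xi>"
begin

abbreviation den :: "nat \<Rightarrow> complex" where
  "den n \<equiv> z\<^sup>2 - complex_of_real ((kappa n)\<^sup>2)"

lemma cmod_den: "cmod (den n) = cmod (z - kappa n) * cmod (z + kappa n)"
proof -
  have "den n = (z - kappa n) * (z + kappa n)" by (simp add: power2_eq_square algebra_simps)
  then show ?thesis by (simp add: norm_mult)
qed

lemma cmod_z_le: "cmod z \<le> cmod (z + kappa n)"
proof (rule power2_le_imp_le)
  have "0 \<le> kappa n * (2 * \<tau> + kappa n)" using tau kappa_pos[of n] by simp
  then show "(cmod z)\<^sup>2 \<le> (cmod (z + kappa n))\<^sup>2"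
    unfolding cmod_power2 by (simp add: z power2_eq_square algebra_simps)
qed simp

lemma gap_pos: "0 < \<bar>\<tau> - kappa n\<bar>" using dist[of n] delta by linarith

lemma den_ge:
  assumes "0 \<le> r" "r \<le> cmod (z + kappa n)"
  shows "r * \<bar>\<tau> - kappa n\<bar> \<le> cmod (den n)"
  unfolding cmod_den using z_minus_kappa[OF z, of n] assms by (subst mult.commute) (intro mult_mono, auto)

lemma den_pos: "0 < cmod (den n)"
proof -
  have "0 < \<tau> * \<bar>\<tau> - kappa n\<bar>" using tau gap_pos[of n] by simp
  also have "\<dots> \<le> cmod (den n)"
    using z_plus_kappa[OF z, of n] tau kappa_pos[of n] by (intro den_ge) auto
  finally show ?thesis .
qed

lemma inverse_den_le:
  assumes "0 \<le> r" "r \<le> cmod (z + kappa n)"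
  shows "r / cmod (den n) \<le> 1 / \<bar>\<tau> - kappa n\<bar>" "r / cmod (den n) \<le> 1 / \<delta>"
proof -
  show 1: "r / cmod (den n) \<le> 1 / \<bar>\<tau> - kappa n\<bar>"
    using den_ge[OF assms] den_pos[of n] gap_pos[of n] by (simp add: field_simps)
  have "1 / \<bar>\<tau> - kappa n\<bar> \<le> 1 / \<delta>" using dist[of n] delta by (intro divide_left_mono) auto
  with 1 show "r / cmod (den n) \<le> 1 / \<delta>" by linarith
qed

lemma tau_le: "0 \<le> \<tau>" "\<tau> \<le> cmod (z + kappa n)"
  using tau z_plus_kappa[OF z, of n] kappa_pos[of n] by auto

lemma kappa_le: "0 \<le> kappa n" "kappa n \<le> cmod (z + kappa n)"
  using tau z_plus_kappa[OF z, of n] kappa_pos[of n] by auto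

definition trace_const :: real where "trace_const = 64 / h_const 0 / \<delta>\<^sup>2"

lemma sum_end_value: "(\<Sum>n<N. (end_value n)\<^sup>2 / (\<tau> - kappa n)\<^sup>2) \<le> trace_const * sqrt \<tau>"
proof -
  have "(\<Sum>n<N. (end_value n)\<^sup>2 / (\<tau> - kappa n)\<^sup>2) \<le> (\<Sum>n<N. 4 / h_const 0 * (sqrt (kappa n) / (\<tau> - kappa n)\<^sup>2))"
    using divide_right_mono[OF end_value_sq_le zero_le_power2] by (intro sum_mono) simp
  also have "\<dots> = 4 / h_const 0 * (\<Sum>n<N. sqrt (kappa n) / (\<tau> - kappa n)\<^sup>2)" by (rule sum_distrib_left[symmetric])
  also have "\<dots> \<le> 4 / h_const 0 * (16 / \<delta>\<^sup>2 * sqrt \<tau>)"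
    using h_const_pos[of 0] by (intro mult_left_mono sum_sqrt_kappa) auto
  finally show ?thesis by (simp add: trace_const_def)
qed

lemma summable_end_value: "summable (\<lambda>n. (end_value n)\<^sup>2 / (\<tau> - kappa n)\<^sup>2)"
  by (rule summableI_nonneg_bounded[OF _ sum_end_value]) simp

lemma sqrt_trace_const: "sqrt (trace_const * sqrt \<tau>) = sqrt trace_const * \<tau> powr (1/4)"
proof -
  have "sqrt (sqrt \<tau>) = (\<tau> powr (1/2)) powr (1/2)" using tau by (simp add: powr_half_sqrt)
  also have "\<dots> = \<tau> powr (1/4)" by (simp add: powr_powr)
  finally show ?thesis by (simp add: real_sqrt_mult)
qed

lemma RzH:
  assumes h: "h \<in> H_space"
  shows "RzH z h \<in> H_space" "coef (RzH z h) n = coef h n / den n"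
    "summable (\<lambda>n. (kappa n)\<^sup>2 * (cmod (coef (RzH z h) n))\<^sup>2)"
proof -
  have c: "pivot h (Phi n) = coef h n" for n by (simp add: pivot_def coef_def)
  have s: "summable (\<lambda>n. (kappa n)\<^sup>2 * (cmod (pivot h (Phi n) / den n))\<^sup>2)"
  proof (rule summable_comparison_test'[of "\<lambda>n. (1 / \<delta>)\<^sup>2 * (cmod (coef h n))\<^sup>2"])
    show "summable (\<lambda>n. (1 / \<delta>)\<^sup>2 * (cmod (coef h n))\<^sup>2)" by (intro summable_mult coef_summable h)
    fix n
    have "(kappa n)\<^sup>2 * (cmod (pivot h (Phi n) / den n))\<^sup>2 = (kappa n / cmod (den n))\<^sup>2 * (cmod (coef h n))\<^sup>2"
      by (simp add: c norm_divide power_divide)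
    also have "\<dots> \<le> (1 / \<delta>)\<^sup>2 * (cmod (coef h n))\<^sup>2"
      using inverse_den_le(2)[OF kappa_le] kappa_pos[of n] by (intro mult_right_mono power_mono) (auto simp: less_imp_le)
    finally show "norm ((kappa n)\<^sup>2 * (cmod (pivot h (Phi n) / den n))\<^sup>2) \<le> (1 / \<delta>)\<^sup>2 * (cmod (coef h n))\<^sup>2" by simp
  qed
  note R = Rz_coef[of "pivot h" z, OF s]
  show "RzH z h \<in> H_space" using R(1) V_weak_deriv(1) by (simp add: RzH_def)
  show "coef (RzH z h) n = coef h n / den n" unfolding RzH_def R(2) c ..
  show "summable (\<lambda>n. (kappa n)\<^sup>2 * (cmod (coef (RzH z h) n))\<^sup>2)" using s unfolding RzH_def R(2) .
qed

text \<open>One statement for the operators \<open>R(z)\<close>, \<open>z R(z)\<close> and \<open>L\<^sub>0\<^sup>1\<^sup>/\<^sup>2 R(z)\<close>, with \<open>r\<close> equal to \<open>1\<close>, \<open>\<bar>z\<bar>\<close> and \<open>\<kappa>\<^sub>n\<close>.\<close>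

lemma RzH_multiplier_bound:
  assumes h: "h \<in> H_space" and f: "f \<in> H_space" "\<And>n. cmod (coef f n) = r n * cmod (coef (RzH z h) n)"
    and r: "\<And>n. r n / cmod (den n) \<le> K" and K: "0 \<le> K"
  shows "H_norm f \<le> K * H_norm h"
proof (rule H_norm_le_coef_multiple[OF f(1) h _ K])
  fix n
  have "cmod (coef f n) = (r n / cmod (den n)) * cmod (coef h n)"
    unfolding f(2) RzH(2)[OF h] by (simp add: norm_divide)
  also have "\<dots> \<le> K * cmod (coef h n)" using r by (intro mult_right_mono) auto
  finally show "cmod (coef f n) \<le> K * cmod (coef h n)" .
qed

lemma RzH_norm: "h \<in> H_space \<Longrightarrow> H_norm (RzH z h) \<le> (1 / \<delta> / \<tau>) * H_norm h"
proof (rule RzH_multiplier_bound[OF _ RzH(1), of h h "\<lambda>_. 1"])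
  show "1 / cmod (den n) \<le> 1 / \<delta> / \<tau>" for n
    using divide_right_mono[OF inverse_den_le(2)[OF tau_le], of \<tau> n] tau by simp
qed (use tau delta in auto)

lemma z_RzH_norm: "h \<in> H_space \<Longrightarrow> H_norm (\<lambda>x. z * RzH z h x) \<le> (1 / \<delta>) * H_norm h"
  using inverse_den_le(2)[OF norm_ge_zero cmod_z_le] delta
  by (intro RzH_multiplier_bound[where r="\<lambda>_. cmod z"] H_scale RzH(1)) (auto simp: coef_scale norm_mult)

lemma root_RzH_norm: "h \<in> H_space \<Longrightarrow> H_norm (apply_graph L0_half (RzH z h)) \<le> (1 / \<delta>) * H_norm h"
  using inverse_den_le(2)[OF kappa_le] delta kappa_pos apply_Lroot[OF RzH(1) RzH(3)]
  by (intro RzH_multiplier_bound[where r=kappa]) (auto simp: norm_mult less_imp_le)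

text \<open>Cauchy and Schwarz, applied to the coefficients of \<open>h\<close> and the numbers \<open>\<bar>v\<^sub>n\<bar> / \<bar>\<tau> - \<kappa>\<^sub>n\<bar>\<close>.\<close>

lemma Ctr_RzH_norm:
  assumes h: "h \<in> H_space"
  shows "norm (Ctr (RzH z h)) \<le> 2 * (sqrt trace_const * \<tau> powr (1/4) / \<tau>) * H_norm h"
proof -
  define B where "B = sqrt trace_const * \<tau> powr (1/4) / \<tau> * H_norm h"
  have part: "(\<Sum>n<N. cmod (coef (RzH z h) n) * end_value n) \<le> B" for N
  proof -
    have t: "cmod (coef (RzH z h) n) * end_value n \<le> cmod (coef h n) * (end_value n / \<bar>\<tau> - kappa n\<bar>) * (1 / \<tau>)" for n
    proof -
      have "1 / cmod (den n) \<le> 1 / \<bar>\<tau> - kappa n\<bar> * (1 / \<tau>)"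
        using divide_right_mono[OF inverse_den_le(1)[OF tau_le], of \<tau> n] tau by simp
      then have "(cmod (coef h n) * end_value n) * (1 / cmod (den n)) \<le> (cmod (coef h n) * end_value n) * (1 / \<bar>\<tau> - kappa n\<bar> * (1 / \<tau>))"
        using end_value_pos[of n] by (intro mult_left_mono) auto
      then show ?thesis unfolding RzH(2)[OF h] by (simp add: norm_divide)
    qed
    have "(\<Sum>n<N. cmod (coef (RzH z h) n) * end_value n) \<le> (\<Sum>n<N. cmod (coef h n) * (end_value n / \<bar>\<tau> - kappa n\<bar>) * (1 / \<tau>))"
      by (intro sum_mono t)
    also have "\<dots> = (\<Sum>n<N. cmod (coef h n) * (end_value n / \<bar>\<tau> - kappa n\<bar>)) * (1 / \<tau>)" by (rule sum_distrib_right[symmetric])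
    also have "\<dots> \<le> (H_norm h * sqrt (trace_const * sqrt \<tau>)) * (1 / \<tau>)"
    proof (rule mult_right_mono)
      have "(\<Sum>n<N. cmod (coef h n) * (end_value n / \<bar>\<tau> - kappa n\<bar>))\<^sup>2 \<le>
          (\<Sum>n<N. (cmod (coef h n))\<^sup>2) * (\<Sum>n<N. (end_value n / \<bar>\<tau> - kappa n\<bar>)\<^sup>2)"
        by (rule Cauchy_Schwarz_ineq_sum)
      also have "\<dots> \<le> (H_norm h)\<^sup>2 * (trace_const * sqrt \<tau>)"
        using Bessel[OF h] sum_end_value by (intro mult_mono sum_nonneg) (auto simp: power_divide)
      finally have "(\<Sum>n<N. cmod (coef h n) * (end_value n / \<bar>\<tau> - kappa n\<bar>)) \<le> sqrt ((H_norm h)\<^sup>2 * (trace_const * sqrt \<tau>))"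
        by (rule real_le_rsqrt)
      then show "(\<Sum>n<N. cmod (coef h n) * (end_value n / \<bar>\<tau> - kappa n\<bar>)) \<le> H_norm h * sqrt (trace_const * sqrt \<tau>)"
        by (simp add: real_sqrt_mult)
    qed (use tau in simp)
    finally show ?thesis unfolding sqrt_trace_const B_def by (simp add: mult_ac)
  qed
  have nn: "0 \<le> cmod (coef (RzH z h) n) * end_value n" for n using end_value_pos[of n] by simp
  have s: "summable (\<lambda>n. cmod (coef (RzH z h) n) * end_value n)" by (rule summableI_nonneg_bounded[OF nn part])
  have "cmod (Ctr (RzH z h) $ i) \<le> B" for i
  proof -
    have "cmod (Ctr (RzH z h) $ i) = cmod (\<Sum>n. coef (RzH z h) n * complex_of_real (end_sign i n * end_value n))"
      using Ctr_series[OF RzH(1)[OF h] s, of i] by (simp add: sums_iff)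
    also have "\<dots> \<le> (\<Sum>n. cmod (coef (RzH z h) n) * end_value n)"
      using end_value_pos by (intro norm_suminf_le s) (auto simp: norm_mult abs_mult abs_end_sign less_imp_le)
    also have "\<dots> \<le> B" by (rule suminf_le_const[OF s part])
    finally show ?thesis .
  qed
  from norm_vec2_le[OF this] show ?thesis by (simp add: B_def)
qed

lemma RzC:
  shows "RzC z g \<in> H_space" "coef (RzC z g) n = Ctr_dual g (Phi n) / den n"
    "summable (\<lambda>n. (kappa n)\<^sup>2 * (cmod (coef (RzC z g) n))\<^sup>2)"
proof -
  have s: "summable (\<lambda>n. (kappa n)\<^sup>2 * (cmod (Ctr_dual g (Phi n) / den n))\<^sup>2)"
  proof (rule summable_comparison_test'[of "\<lambda>n. (2 * norm g)\<^sup>2 * ((end_value n)\<^sup>2 / (\<tau> - kappa n)\<^sup>2)"])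
    show "summable (\<lambda>n. (2 * norm g)\<^sup>2 * ((end_value n)\<^sup>2 / (\<tau> - kappa n)\<^sup>2))" by (intro summable_mult summable_end_value)
    fix n
    have "(kappa n)\<^sup>2 * (cmod (Ctr_dual g (Phi n) / den n))\<^sup>2 = ((kappa n / cmod (den n)) * cmod (Ctr_dual g (Phi n)))\<^sup>2"
      by (simp add: norm_divide power_divide power_mult_distrib)
    also have "\<dots> \<le> ((1 / \<bar>\<tau> - kappa n\<bar>) * (2 * norm g * end_value n))\<^sup>2"
      using inverse_den_le(1)[OF kappa_le, of n] kappa_pos[of n] Ctr_dual_Phi_bound[of g n]
      by (intro power_mono mult_mono) (auto simp: less_imp_le)
    also have "\<dots> = (2 * norm g)\<^sup>2 * ((end_value n)\<^sup>2 / (\<tau> - kappa n)\<^sup>2)" by (simp add: power_mult_distrib power_divide)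
    finally show "norm ((kappa n)\<^sup>2 * (cmod (Ctr_dual g (Phi n) / den n))\<^sup>2) \<le> (2 * norm g)\<^sup>2 * ((end_value n)\<^sup>2 / (\<tau> - kappa n)\<^sup>2)" by simp
  qed
  note R = Rz_coef[of "Ctr_dual g" z, OF s]
  show "RzC z g \<in> H_space" using R(1) V_weak_deriv(1) by (simp add: RzC_def)
  show "coef (RzC z g) n = Ctr_dual g (Phi n) / den n" unfolding RzC_def R(2) ..
  show "summable (\<lambda>n. (kappa n)\<^sup>2 * (cmod (coef (RzC z g) n))\<^sup>2)" using s unfolding RzC_def R(2) .
qed

lemma RzC_multiplier_bound:
  assumes f: "f \<in> H_space" "\<And>n. cmod (coef f n) = r n * cmod (coef (RzC z g) n)"
    and r: "\<And>n. 0 \<le> r n" "\<And>n. r n / cmod (den n) \<le> K / \<bar>\<tau> - kappa n\<bar>" and K: "0 \<le> K"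
  shows "H_norm f \<le> 2 * K * (sqrt trace_const * \<tau> powr (1/4)) * norm g"
proof -
  have "H_norm f \<le> sqrt ((2 * K * norm g)\<^sup>2 * (trace_const * sqrt \<tau>))"
  proof (rule H_norm_le_coef_bound[OF f(1)])
    fix n
    have "cmod (coef f n) = (r n / cmod (den n)) * cmod (Ctr_dual g (Phi n))"
      unfolding f(2) RzC(2) by (simp add: norm_divide)
    also have "\<dots> \<le> (K / \<bar>\<tau> - kappa n\<bar>) * (2 * norm g * end_value n)"
      using r[of n] K Ctr_dual_Phi_bound[of g n] by (intro mult_mono) auto
    finally have "(cmod (coef f n))\<^sup>2 \<le> ((K / \<bar>\<tau> - kappa n\<bar>) * (2 * norm g * end_value n))\<^sup>2" by (rule power_mono) simp
    then show "(cmod (coef f n))\<^sup>2 \<le> (2 * K * norm g)\<^sup>2 * ((end_value n)\<^sup>2 / (\<tau> - kappa n)\<^sup>2)"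
      by (simp add: power_mult_distrib power_divide mult_ac)
  next
    show "(\<Sum>n<N. (2 * K * norm g)\<^sup>2 * ((end_value n)\<^sup>2 / (\<tau> - kappa n)\<^sup>2)) \<le> (2 * K * norm g)\<^sup>2 * (trace_const * sqrt \<tau>)" for N
      unfolding sum_distrib_left[symmetric] by (intro mult_left_mono sum_end_value) auto
  qed
  also have "\<dots> = \<bar>2 * K * norm g\<bar> * (sqrt trace_const * \<tau> powr (1/4))"
    by (simp only: real_sqrt_mult[of "(2 * K * norm g)\<^sup>2"] real_sqrt_abs sqrt_trace_const)
  also have "\<bar>2 * K * norm g\<bar> = 2 * K * norm g" using K by simp
  finally show ?thesis by (simp add: mult_ac)
qed

lemma RzC_norm: "H_norm (RzC z g) \<le> 2 * (1 / \<tau>) * (sqrt trace_const * \<tau> powr (1/4)) * norm g"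
proof (rule RzC_multiplier_bound[OF RzC(1), of g "\<lambda>_. 1"])
  show "1 / cmod (den n) \<le> 1 / \<tau> / \<bar>\<tau> - kappa n\<bar>" for n
    using divide_right_mono[OF inverse_den_le(1)[OF tau_le], of \<tau> n] tau by (simp add: mult.commute)
qed (use tau in auto)

lemma z_RzC_norm: "H_norm (\<lambda>x. z * RzC z g x) \<le> 2 * 1 * (sqrt trace_const * \<tau> powr (1/4)) * norm g"
  using inverse_den_le(1)[OF norm_ge_zero cmod_z_le]
  by (intro RzC_multiplier_bound[where r="\<lambda>_. cmod z"] H_scale RzC(1)) (auto simp: coef_scale norm_mult)

lemma root_RzC_norm: "H_norm (apply_graph L0_half (RzC z g)) \<le> 2 * 1 * (sqrt trace_const * \<tau> powr (1/4)) * norm g"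
  using inverse_den_le(1)[OF kappa_le] kappa_pos apply_Lroot[OF RzC(1) RzC(3), of g]
  by (intro RzC_multiplier_bound[where r=kappa]) (auto simp: norm_mult less_imp_le)

definition bdry_const :: real where "bdry_const = 112 / h_const 0 / \<delta>\<^sup>2"

text \<open>Since \<open>\<bar>\<tau> - \<kappa>\<^sub>n\<bar> \<le> \<tau> + \<kappa>\<^sub>n\<close>, the denominator dominates \<open>(\<tau> - \<kappa>\<^sub>n)\<^sup>2\<close>. This gives convergence but not
  the decay in \<open>\<tau>\<close>.\<close>

lemma summable_end_value_den: "summable (\<lambda>n. (end_value n)\<^sup>2 / cmod (den n))"
proof (rule summable_comparison_test'[OF summable_end_value])
  fix n
  have "\<bar>\<tau> - kappa n\<bar> \<le> cmod (z + kappa n)"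
    using z_plus_kappa[OF z, of n] tau kappa_pos[of n] by (simp add: abs_if)
  then have "\<bar>\<tau> - kappa n\<bar> * \<bar>\<tau> - kappa n\<bar> \<le> cmod (den n)" by (intro den_ge) auto
  then have "(\<tau> - kappa n)\<^sup>2 \<le> cmod (den n)" by (simp only: power2_eq_square[of "\<tau> - kappa n"] abs_mult_self_eq)
  then have "(end_value n)\<^sup>2 / cmod (den n) \<le> (end_value n)\<^sup>2 / (\<tau> - kappa n)\<^sup>2"
    using gap_pos[of n] by (intro frac_le) auto
  then show "norm ((end_value n)\<^sup>2 / cmod (den n)) \<le> (end_value n)\<^sup>2 / (\<tau> - kappa n)\<^sup>2" by simp
qed

text \<open>The entries of \<open>K(z)\<close>: the sum with \<open>s = 1\<close> on the diagonal and with \<open>s = -1\<close> off the diagonal. A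
  sign \<open>s\<^sup>n\<close> is unchanged by \<open>n \<mapsto> 2m - n\<close>, as the cancellation requires.\<close>

lemma sign_sum_bound:
  assumes s: "s = 1 \<or> s = -1"
  shows "summable (\<lambda>n. s ^ n * complex_of_real ((end_value n)\<^sup>2) / den n)"
    and "cmod (\<Sum>n. s ^ n * complex_of_real ((end_value n)\<^sup>2) / den n) \<le> bdry_const / sqrt \<tau>"
proof -
  have ns1: "cmod s = 1" using s by auto
  then have ns: "cmod (s ^ n) = 1" for n by (simp add: norm_power)
  show sm: "summable (\<lambda>n. s ^ n * complex_of_real ((end_value n)\<^sup>2) / den n)"
    by (rule summable_norm_cancel) (use summable_end_value_den in \<open>simp add: norm_mult norm_divide ns1 norm_power\<close>)
  have e: "s ^ (2 * m - n) = s ^ n" if "n \<le> 2 * m" for n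
    using s that by (auto simp: minus_one_power_iff)
  have part: "cmod (\<Sum>n<N. s ^ n * complex_of_real ((end_value n)\<^sup>2) / den n) \<le> bdry_const / sqrt \<tau>" if N: "2 * m + 1 \<le> N" for N
  proof -
    have "s ^ n * complex_of_real ((end_value n)\<^sup>2) / den n =
        complex_of_real (1 / h_const 0) * (s ^ n * complex_of_real (2 * kappa n * wallis n) / (z\<^sup>2 - (complex_of_real (kappa n))\<^sup>2))" for n
      unfolding end_value_sq by simp
    then have "(\<Sum>n<N. s ^ n * complex_of_real ((end_value n)\<^sup>2) / den n) = complex_of_real (1 / h_const 0) *
        (\<Sum>n<N. s ^ n * complex_of_real (2 * kappa n * wallis n) / (z\<^sup>2 - (complex_of_real (kappa n))\<^sup>2))"
      by (simp only: sum_distrib_left)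
    then have "cmod (\<Sum>n<N. s ^ n * complex_of_real ((end_value n)\<^sup>2) / den n) = 1 / h_const 0 *
        cmod (\<Sum>n<N. s ^ n * complex_of_real (2 * kappa n * wallis n) / (z\<^sup>2 - (complex_of_real (kappa n))\<^sup>2))"
      using h_const_pos[of 0] by (simp only: norm_mult norm_of_real) simp
    also have "\<dots> \<le> 1 / h_const 0 * (112 / \<delta>\<^sup>2 / sqrt \<tau>)"
      using resolvent_sum_bound[OF z, of "\<lambda>n. s ^ n" N] e ns N h_const_pos[of 0]
      by (intro mult_left_mono) auto
    finally show ?thesis by (simp add: bdry_const_def)
  qed
  have "(\<lambda>N. cmod (\<Sum>n<N. s ^ n * complex_of_real ((end_value n)\<^sup>2) / den n)) \<longlonglongrightarrow>
      cmod (\<Sum>n. s ^ n * complex_of_real ((end_value n)\<^sup>2) / den n)"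
    by (intro tendsto_norm summable_LIMSEQ sm)
  then show "cmod (\<Sum>n. s ^ n * complex_of_real ((end_value n)\<^sup>2) / den n) \<le> bdry_const / sqrt \<tau>"
    by (rule LIMSEQ_le_const2) (use part in blast)
qed

lemma Kz_norm: "norm (Kz z g) \<le> 4 * (bdry_const / sqrt \<tau>) * norm g"
proof -
  have s: "summable (\<lambda>n. cmod (coef (RzC z g) n) * end_value n)"
  proof (rule summable_comparison_test'[of "\<lambda>n. 2 * norm g * ((end_value n)\<^sup>2 / cmod (den n))"])
    show "summable (\<lambda>n. 2 * norm g * ((end_value n)\<^sup>2 / cmod (den n)))" by (intro summable_mult summable_end_value_den)
    fix n
    have "cmod (coef (RzC z g) n) * end_value n = cmod (Ctr_dual g (Phi n)) / cmod (den n) * end_value n"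
      unfolding RzC(2) by (simp add: norm_divide)
    also have "\<dots> \<le> 2 * norm g * end_value n / cmod (den n) * end_value n"
      using Ctr_dual_Phi_bound[of g n] end_value_pos[of n] by (intro mult_right_mono divide_right_mono) auto
    finally show "norm (cmod (coef (RzC z g) n) * end_value n) \<le> 2 * norm g * ((end_value n)\<^sup>2 / cmod (den n))"
      using end_value_pos[of n] by (simp add: power2_eq_square)
  qed
  have "cmod (Ctr (RzC z g) $ i) \<le> 2 * (bdry_const / sqrt \<tau>) * norm g" for i
  proof -
    \<comment> \<open>the signs of column \<open>j\<close> and row \<open>i\<close> multiply to \<open>1\<close> or \<open>(-1)\<^sup>n\<close>\<close>
    define S where "S j = (\<Sum>n. complex_of_real (if j = i then 1 else -1) ^ n * complex_of_real ((end_value n)\<^sup>2) / den n)" for j :: 2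
    have Sb: "cmod (S j) \<le> bdry_const / sqrt \<tau>" for j
      unfolding S_def by (rule sign_sum_bound(2)) auto
    have t: "coef (RzC z g) n * complex_of_real (end_sign i n * end_value n) =
        (\<Sum>j\<in>UNIV. g $ j * (complex_of_real (if j = i then 1 else -1) ^ n * complex_of_real ((end_value n)\<^sup>2) / den n))" for n
    proof -
      have ss: "complex_of_real (end_sign j n) * complex_of_real (end_sign i n) = complex_of_real (if j = i then 1 else -1) ^ n" for j
        using exhaust_2[of i] exhaust_2[of j] by (auto simp: end_sign_def simp flip: power_mult_distrib)
      have "coef (RzC z g) n * complex_of_real (end_sign i n * end_value n) =
          (\<Sum>j\<in>UNIV. g $ j * ((complex_of_real (end_sign j n) * complex_of_real (end_sign i n)) * complex_of_real ((end_value n)\<^sup>2) / den n))"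
        unfolding RzC(2) Ctr_dual_Phi sum_divide_distrib sum_distrib_right
        by (intro sum.cong refl) (simp add: power2_eq_square)
      then show ?thesis unfolding ss .
    qed
    have "(\<lambda>n. coef (RzC z g) n * complex_of_real (end_sign i n * end_value n)) sums (\<Sum>j\<in>UNIV. g $ j * S j)"
      unfolding t S_def by (intro sums_sum sums_mult summable_sums sign_sum_bound(1)) auto
    then have "Ctr (RzC z g) $ i = (\<Sum>j\<in>UNIV. g $ j * S j)"
      using Ctr_series[OF RzC(1) s, of i] sums_unique2 by blast
    also have "cmod \<dots> \<le> (\<Sum>j\<in>(UNIV :: 2 set). norm g * (bdry_const / sqrt \<tau>))"
    proof (rule sum_norm_le)
      show "cmod (g $ j * S j) \<le> norm g * (bdry_const / sqrt \<tau>)" for j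
        unfolding norm_mult by (intro mult_mono Sb Finite_Cartesian_Product.norm_nth_le norm_ge_zero)
    qed
    finally show ?thesis by (simp add: mult_ac)
  qed
  from norm_vec2_le[OF this] show ?thesis by (simp add: Kz_def RzC_def)
qed

end

end

theorem lemma13p3:
  fixes \<delta> :: real
  assumes "0 < \<delta>" and "\<delta> < 1/4"
  shows "\<exists>C>0. \<forall>(\<tau>::real) (\<xi>::real) (z::complex).
    admissible \<delta> \<tau> \<and> z = complex_of_real \<tau> + \<i> * complex_of_real \<xi> \<longrightarrow>
      norm_HH (RzH z) \<le> ennreal (C * \<tau> powr (-1)) \<and>
      norm_HC (\<lambda>h. Ctr (RzH z h)) + norm_CH (RzC z) \<le> ennreal (C * \<tau> powr (-3/4)) \<and>
      norm_CC (Kz z) \<le> ennreal (C * \<tau> powr (-1/2)) \<and>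
      (\<forall>h\<in>H_space. RzH z h \<in> Domain L0_half) \<and>
      norm_HH (\<lambda>h \<phi>. z * RzH z h \<phi>) + norm_HH (\<lambda>h. apply_graph L0_half (RzH z h))
        \<le> ennreal C \<and>
      (\<forall>g. RzC z g \<in> Domain L0_half) \<and>
      norm_CH (\<lambda>g \<phi>. z * RzC z g \<phi>) + norm_CH (\<lambda>g. apply_graph L0_half (RzC z g))
        \<le> ennreal (C * \<tau> powr (1/4))"
proof -
  define k where "k = sqrt (64 / h_const 0 / \<delta>\<^sup>2)"
  define k' where "k' = 112 / h_const 0 / \<delta>\<^sup>2"
  have k: "0 < k" "0 < k'" using assms h_const_pos[of 0] by (auto simp: k_def k'_def)
  \<comment> \<open>the three summands serve the bounds on the Hilbert space, those with one trace, and that of \<open>K(z)\<close>\<close>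
  define C where "C = 2 / \<delta> + 4 * k + 4 * k'"
  have C: "2 / \<delta> \<le> C" "4 * k \<le> C" "4 * k' \<le> C" "0 < C" using assms k by (auto simp: C_def add_pos_pos)
  show ?thesis
  proof (intro exI[of _ C] conjI[OF C(4)] allI impI, goal_cases)
    case (1 \<tau> \<xi> z)
    then have t: "2 \<le> \<tau>" "\<delta> \<le> infdist \<tau> (range kappa)" and z: "z = Complex \<tau> \<xi>"
      by (auto simp: admissible_def complex_eq_iff)
    define m where "m = nat \<lfloor>\<tau> / 2\<rfloor>"
    have m: "real m \<le> \<tau> / 2" "\<tau> / 2 < real m + 1" using t(1) unfolding m_def by linarith+
    interpret admissible_shift \<tau> \<delta> m
    proof
      show "\<delta> \<le> \<bar>\<tau> - kappa n\<bar>" for n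
        using t(2) infdist_le[of "kappa n" "range kappa" \<tau>] by (simp add: dist_real_def)
    qed (use assms t m in auto)
    have K: "sqrt (trace_const) = k" "bdry_const = k'" by (simp_all add: trace_const_def bdry_const_def k_def k'_def)
    have tau_powr: "\<tau> powr (-1) = 1 / \<tau>" "\<tau> powr (-1/2) = 1 / sqrt \<tau>" "\<tau> powr (-3/4) = \<tau> powr (1/4) / \<tau>"
      using t(1) powr_diff[of \<tau> "1/4" 1] by (simp_all add: powr_minus_divide powr_half_sqrt)
    have p: "0 \<le> \<tau> powr (1/4)" "0 < \<tau>" "0 \<le> \<tau> powr (1/4) / \<tau>" using t(1) by auto
    have u: "a * x \<le> a" if "0 \<le> a" "x \<le> 1" for a x :: real using that by (rule mult_left_le[rotated])
    note nn = mult_nonneg_nonneg divide_nonneg_nonneg less_imp_le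
    have 1: "norm_HH (RzH z) \<le> ennreal (1 / \<delta> / \<tau>)"
      using order_trans[OF RzH_norm[OF z] u] assms p by (intro op_norm_le) auto
    have 2: "norm_HC (\<lambda>h. Ctr (RzH z h)) \<le> ennreal (2 * (k * \<tau> powr (1/4) / \<tau>))"
      using order_trans[OF Ctr_RzH_norm[OF z] u] k p unfolding K by (intro op_norm_le) auto
    have 3: "norm_CH (RzC z) \<le> ennreal (2 * (1 / \<tau>) * (k * \<tau> powr (1/4)))"
      using order_trans[OF RzC_norm[OF z] u] k p unfolding K by (intro op_norm_le) auto
    have 4: "norm_CC (Kz z) \<le> ennreal (4 * (k' / sqrt \<tau>))"
      using order_trans[OF Kz_norm[OF z] u] k p unfolding K by (intro op_norm_le) auto
    have 5: "norm_HH (\<lambda>h \<phi>. z * RzH z h \<phi>) \<le> ennreal (1 / \<delta>)"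
      using order_trans[OF z_RzH_norm[OF z] u] assms by (intro op_norm_le) auto
    have 6: "norm_HH (\<lambda>h. apply_graph L0_half (RzH z h)) \<le> ennreal (1 / \<delta>)"
      using order_trans[OF root_RzH_norm[OF z] u] assms by (intro op_norm_le) auto
    have 7: "norm_CH (\<lambda>g \<phi>. z * RzC z g \<phi>) \<le> ennreal (2 * 1 * (k * \<tau> powr (1/4)))"
      using order_trans[OF z_RzC_norm[OF z] u] k p unfolding K by (intro op_norm_le) auto
    have 8: "norm_CH (\<lambda>g. apply_graph L0_half (RzC z g)) \<le> ennreal (2 * 1 * (k * \<tau> powr (1/4)))"
      using order_trans[OF root_RzC_norm[OF z] u] k p unfolding K by (intro op_norm_le) auto
    have plus: "a + b \<le> ennreal r" if "a \<le> ennreal x" "b \<le> ennreal y" "x + y \<le> r" "0 \<le> x" "0 \<le> y" for a b x y r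
      using add_mono[OF that(1,2)] that(3-5) by (metis ennreal_leI ennreal_plus order_trans)
    have "norm_HH (RzH z) \<le> ennreal (C * \<tau> powr (-1))"
    proof (rule order_trans[OF 1 ennreal_leI])
      have "1 / \<delta> \<le> C" using C(1) assms by (simp add: field_simps)
      then show "1 / \<delta> / \<tau> \<le> C * \<tau> powr (-1)" 
        unfolding tau_powr using divide_right_mono[of "1 / \<delta>" C \<tau>] p by simp
    qed
    moreover have "norm_HC (\<lambda>h. Ctr (RzH z h)) + norm_CH (RzC z) \<le> ennreal (C * \<tau> powr (-3/4))"
    proof (rule plus[OF 2 3])
      have "4 * k * (\<tau> powr (1/4) / \<tau>) \<le> C * (\<tau> powr (1/4) / \<tau>)" using C(2) p(3) by (rule mult_right_mono)
      then show "2 * (k * \<tau> powr (1/4) / \<tau>) + 2 * (1 / \<tau>) * (k * \<tau> powr (1/4)) \<le> C * \<tau> powr (-3/4)"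
        unfolding tau_powr by simp
    qed (use k p in auto)
    moreover have "norm_CC (Kz z) \<le> ennreal (C * \<tau> powr (-1/2))"
    proof (rule order_trans[OF 4 ennreal_leI])
      show "4 * (k' / sqrt \<tau>) \<le> C * \<tau> powr (-1/2)"
        unfolding tau_powr using divide_right_mono[OF C(3), of "sqrt \<tau>"] p by simp
    qed
    moreover have "\<forall>h\<in>H_space. RzH z h \<in> Domain L0_half"
      using apply_Lroot(1)[OF RzH(1,3)[OF z]] by blast
    moreover have "norm_HH (\<lambda>h \<phi>. z * RzH z h \<phi>) + norm_HH (\<lambda>h. apply_graph L0_half (RzH z h)) \<le> ennreal C"
      by (rule plus[OF 5 6]) (use C assms in auto)
    moreover have "\<forall>g. RzC z g \<in> Domain L0_half"
      using apply_Lroot(1)[OF RzC(1,3)[OF z]] by blast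
    moreover have "norm_CH (\<lambda>g \<phi>. z * RzC z g \<phi>) + norm_CH (\<lambda>g. apply_graph L0_half (RzC z g)) \<le> ennreal (C * \<tau> powr (1/4))"
    proof (rule plus[OF 7 8])
      show "2 * 1 * (k * \<tau> powr (1/4)) + 2 * 1 * (k * \<tau> powr (1/4)) \<le> C * \<tau> powr (1/4)"
        using mult_right_mono[OF C(2) p(1)] by simp
    qed (use k p in auto)
    ultimately show ?case by blast
  qed
qed

end
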